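(* Let $n\ge1$ and let $(d)=(d_1,\dots,d_n)$ be positive integers. For every $\widehat f\in\mathcal H_{(d)}$ and every $\sigma>0$, $$\mathbb E_{f\sim N(\widehat f,\sigma^2\mathrm{Id})}\ \frac{\mu_{F,\mathrm{av}}^2(f)}{\|f\|^2}\ \le\ \frac{n}{\sigma^2},$$ and equality holds in the centered case $\widehat f=0$.
   Context: $\mathcal H_{d}$ is the complex vector space of homogeneous polynomials of degree $d$ in $n+1$ complex variables $z_0,\dots,z_n$, with the Weyl Hermitian product: $\langle z^\alpha,z^\beta\rangle=0$ for $\alpha\ne\beta$ and $\langle z^\alpha,z^\alpha\rangle=\left(\frac{d!}{\alpha_0!\cdots\alpha_n!}\right)^{-1}$. $\mathcal H_{(d)}=\prod_{i=1}^n\mathcal H_{d_i}$ has the product Hermitian structure $\langle f,g\rangle=\sum_i\langle f_i,g_i\rangle$ with norm $\|\cdot\|$; $N=\dim_{\mathbb C}\mathcal H_{(d)}=\sum_i\binom{n+d_i}{n}$ and $\mathcal D=\prod_i d_i$. $N(\widehat f,\sigma^2\mathrm{Id})$ denotes the complex Gaussian measure on $\mathcal H_{(d)}$ with density $\frac{1}{\sigma^{2N}\pi^N}e^{-\|f-\widehat f\|^2/\sigma^2}$ with respect to Lebesgue measure. $\mathbb C^{n+1}$ has its usual Hermitian product and $\zeta^\perp$ is the Hermitian complement of $\zeta\ne0$. The Frobenius condition number of $f\in\mathcal H_{(d)}$ at a zero $\zeta\in\mathbb P(\mathbb C^{n+1})$ is $$\mu_F(f,\zeta)=\|f\|\,\big\|(Df(\zeta)|_{\zeta^\perp})^{-1}\,\mathrm{diag}(\|\zeta\|^{d_i-1}d_i^{1/2})\big\|_F$$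 ($\|\cdot\|_F$ the Frobenius norm; $\mu_F=\infty$ if $Df(\zeta)|_{\zeta^\perp}$ is not invertible); it does not depend on the representative of $\zeta$. Let $\Sigma\subset\mathcal H_{(d)}$ be the set of systems $f$ having some zero $\zeta\in\mathbb P(\mathbb C^{n+1})$ with $Df(\zeta)|_{\zeta^\perp}$ not invertible. For $f\notin\Sigma$, $f$ has exactly $\mathcal D$ zeros in $\mathbb P(\mathbb C^{n+1})$ and $$\mu_{F,\mathrm{av}}^2(f)=\frac1{\mathcal D}\sum_{\zeta\in\mathbb P(\mathbb C^{n+1}):\,f(\zeta)=0}\mu_F^2(f,\zeta);$$ for $f\in\Sigma$, $\mu_{F,\mathrm{av}}^2(f)=\infty$. *)

theory Defs
  imports "HOL-Probability.Probability"
begin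

text \<open>
  The equations are indexed by \<open>'n\<close>, so \<open>n = CARD('n) \<ge> 1\<close>, and the \<open>n + 1\<close> variables
  \<open>z_0, \<dots>, z_n\<close> by \<open>'n option\<close>, with \<open>None\<close> in the role of the index 0.
\<close>

type_synonym 'n point = "complex ^ 'n option"

text \<open>A homogeneous polynomial is given by its coefficients with respect to the monomials.\<close>

type_synonym 'n hpoly = "('n option \<Rightarrow> nat) \<Rightarrow> complex"

definition multi_indices :: "nat \<Rightarrow> ('n::finite option \<Rightarrow> nat) set" where
  "multi_indices d = {\<alpha>. (\<Sum>v\<in>UNIV. \<alpha> v) = d}"

definition multinom :: "nat \<Rightarrow> ('n::finite option \<Rightarrow> nat) \<Rightarrow> real" where
  "multinom d \<alpha> = fact d / (\<Prod>v\<in>UNIV. fact (\<alpha> v))"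

text \<open>
  Coefficient families are \<open>undefined\<close> off the index set, so that these spaces are the
  underlying sets of product measures.  Everything below reads only the coefficients in the
  index set; in particular the pointwise difference of two families represents the
  difference of the polynomials.
\<close>

definition hpolys :: "nat \<Rightarrow> 'n::finite hpoly set" where
  "hpolys d = multi_indices d \<rightarrow>\<^sub>E UNIV"

definition hsystems :: "('n::finite \<Rightarrow> nat) \<Rightarrow> ('n \<Rightarrow> 'n hpoly) set" where
  "hsystems d = {f. \<forall>i. f i \<in> hpolys (d i)}"

definition zero_system :: "('n::finite \<Rightarrow> nat) \<Rightarrow> 'n \<Rightarrow> 'n hpoly" where
  "zero_system d = (\<lambda>i. \<lambda>\<alpha>\<in>multi_indices (d i). 0)"

definition eval_hpoly :: "nat \<Rightarrow> 'n::finite hpoly \<Rightarrow> 'n point \<Rightarrow> complex" where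
  "eval_hpoly d p z = (\<Sum>\<alpha>\<in>multi_indices d. p \<alpha> * (\<Prod>v\<in>UNIV. z $ v ^ \<alpha> v))"

definition eval_system ::
    "('n::finite \<Rightarrow> nat) \<Rightarrow> ('n \<Rightarrow> 'n hpoly) \<Rightarrow> 'n point \<Rightarrow> complex ^ 'n" where
  "eval_system d f z = (\<chi> i. eval_hpoly (d i) (f i) z)"

definition weyl_inner :: "nat \<Rightarrow> 'n::finite hpoly \<Rightarrow> 'n hpoly \<Rightarrow> complex" where
  "weyl_inner d p q =
     (\<Sum>\<alpha>\<in>multi_indices d. p \<alpha> * cnj (q \<alpha>) * of_real (inverse (multinom d \<alpha>)))"

definition system_inner ::
    "('n::finite \<Rightarrow> nat) \<Rightarrow> ('n \<Rightarrow> 'n hpoly) \<Rightarrow> ('n \<Rightarrow> 'n hpoly) \<Rightarrow> complex" where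
  "system_inner d f g = (\<Sum>i\<in>UNIV. weyl_inner (d i) (f i) (g i))"

definition system_norm :: "('n::finite \<Rightarrow> nat) \<Rightarrow> ('n \<Rightarrow> 'n hpoly) \<Rightarrow> real" where
  "system_norm d f = sqrt (Re (system_inner d f f))"

text \<open>
  Lebesgue measure of the Hermitian space of homogeneous polynomials: the monomials scaled by
  \<open>sqrt (multinom d \<alpha>)\<close> form an orthonormal basis, and Lebesgue measure is transported along
  the corresponding coordinates.
\<close>

definition hpoly_lebesgue :: "nat \<Rightarrow> 'n::finite hpoly measure" where
  "hpoly_lebesgue d =
     distr (Pi\<^sub>M (multi_indices d) (\<lambda>_. lborel)) (Pi\<^sub>M (multi_indices d) (\<lambda>_. borel))
       (\<lambda>x. \<lambda>\<alpha>\<in>multi_indices d. of_real (sqrt (multinom d \<alpha>)) * x \<alpha>)"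

definition system_lebesgue :: "('n::finite \<Rightarrow> nat) \<Rightarrow> ('n \<Rightarrow> 'n hpoly) measure" where
  "system_lebesgue d = Pi\<^sub>M UNIV (\<lambda>i. hpoly_lebesgue (d i))"

definition system_dim :: "('n::finite \<Rightarrow> nat) \<Rightarrow> nat" where
  "system_dim d = (\<Sum>i\<in>UNIV. (CARD('n) + d i) choose CARD('n))"

definition gaussian ::
    "('n::finite \<Rightarrow> nat) \<Rightarrow> ('n \<Rightarrow> 'n hpoly) \<Rightarrow> real \<Rightarrow> ('n \<Rightarrow> 'n hpoly) measure" where
  "gaussian d fhat \<sigma> =
     density (system_lebesgue d)
       (\<lambda>f. ennreal (1 / (\<sigma> ^ (2 * system_dim d) * pi ^ system_dim d) *
          exp (- (system_norm d (\<lambda>i \<alpha>. f i \<alpha> - fhat i \<alpha>))\<^sup>2 / \<sigma>\<^sup>2)))"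

definition hermitian_complement :: "complex ^ 'v::finite \<Rightarrow> (complex ^ 'v) set" where
  "hermitian_complement \<zeta> = {w. (\<Sum>v\<in>UNIV. w $ v * cnj (\<zeta> $ v)) = 0}"

text \<open>
  The Frechet derivative is taken over the reals; for a polynomial map it coincides with the
  complex-linear derivative.
\<close>

definition D_system ::
    "('n::finite \<Rightarrow> nat) \<Rightarrow> ('n \<Rightarrow> 'n hpoly) \<Rightarrow> 'n point \<Rightarrow> 'n point \<Rightarrow> complex ^ 'n" where
  "D_system d f \<zeta> = frechet_derivative (eval_system d f) (at \<zeta>)"

definition nondegenerate ::
    "('n::finite \<Rightarrow> nat) \<Rightarrow> ('n \<Rightarrow> 'n hpoly) \<Rightarrow> 'n point \<Rightarrow> bool" where
  "nondegenerate d f \<zeta> \<longleftrightarrow> bij_betw (D_system d f \<zeta>) (hermitian_complement \<zeta>) UNIV"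

text \<open>
  Frobenius norm of a linear map.  The codomain may be replaced by a subspace containing the
  range without changing the value.
\<close>

definition frobenius_norm :: "(complex ^ 'm::finite \<Rightarrow> complex ^ 'v::finite) \<Rightarrow> real" where
  "frobenius_norm A = sqrt (\<Sum>j\<in>UNIV. (norm (A (axis j 1)))\<^sup>2)"

definition mu_F ::
    "('n::finite \<Rightarrow> nat) \<Rightarrow> ('n \<Rightarrow> 'n hpoly) \<Rightarrow> 'n point \<Rightarrow> ennreal" where
  "mu_F d f \<zeta> =
     (if nondegenerate d f \<zeta> then
        ennreal (system_norm d f *
          frobenius_norm (\<lambda>y. inv_into (hermitian_complement \<zeta>) (D_system d f \<zeta>)
            (\<chi> i. of_real (norm \<zeta> ^ (d i - 1) * sqrt (real (d i))) * y $ i)))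
      else \<infinity>)"

text \<open>Points of projective space are complex lines through the origin.\<close>

definition proj_point :: "'n::finite point \<Rightarrow> 'n point set" where
  "proj_point \<zeta> = vec.span {\<zeta>}"

definition representative :: "'n::finite point set \<Rightarrow> 'n point" where
  "representative L = (SOME \<zeta>. \<zeta> \<noteq> 0 \<and> proj_point \<zeta> = L)"

definition proj_zeros ::
    "('n::finite \<Rightarrow> nat) \<Rightarrow> ('n \<Rightarrow> 'n hpoly) \<Rightarrow> 'n point set set" where
  "proj_zeros d f = {proj_point \<zeta> | \<zeta>. \<zeta> \<noteq> 0 \<and> eval_system d f \<zeta> = 0}"

definition discriminant :: "('n::finite \<Rightarrow> nat) \<Rightarrow> ('n \<Rightarrow> 'n hpoly) set" where
  "discriminant d =
     {f \<in> hsystems d. \<exists>L\<in>proj_zeros d f. \<not> nondegenerate d f (representative L)}"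

text \<open>
  The sum is written as an unordered sum in \<open>ennreal\<close>, which agrees with the finite sum
  because a system outside the discriminant has finitely many projective zeros.
\<close>

definition mu_F_av_sq :: "('n::finite \<Rightarrow> nat) \<Rightarrow> ('n \<Rightarrow> 'n hpoly) \<Rightarrow> ennreal" where
  "mu_F_av_sq d f =
     (if f \<in> discriminant d then \<infinity>
      else (\<Sum>\<^sub>\<infinity>L\<in>proj_zeros d f. (mu_F d f (representative L))\<^sup>2) / of_nat (\<Prod>i\<in>UNIV. d i))"

end

theory Submission
  imports Defs
begin

text \<open>
  In the affine chart \<open>\<zeta> = (1, z)\<close> let \<open>G\<close> be the complex Jacobian of \<open>f(1, z)\<close>.  At a nondegenerate zero
  \<open>\<mu>\<^sub>F\<^sup>2 / \<parallel>f\<parallel>\<^sup>2\<close> is \<open>\<Sum>\<^sub>j \<nu>\<^sub>j / \<bar>det G\<bar>\<^sup>2\<close>, where \<open>\<nu>\<^sub>j\<close> is the squared norm, on the hyperplane of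
  polynomials vanishing at \<open>\<zeta>\<close>, of the functional that expands \<open>det G\<close> along row \<open>j\<close>.  A Kac--Rice formula
  turns the expected sum over the zeros into an integral over \<open>z\<close> of a Gaussian integral over that
  hyperplane, with \<open>\<nu>\<^sub>j\<close> in place of \<open>\<nu>\<^sub>j / \<bar>det G\<bar>\<^sup>2\<close>.  Conditionally on the other equations \<open>det G\<close> is
  Gaussian of variance \<open>\<sigma>\<^sup>2 \<nu>\<^sub>j\<close>, so the integral of \<open>\<bar>det G\<bar>\<^sup>2\<close> is at least \<open>\<sigma>\<^sup>2\<close> times that of \<open>\<nu>\<^sub>j\<close>,
  with equality when the mean vanishes.  By Kac--Rice once more the integral of \<open>\<bar>det G\<bar>\<^sup>2\<close> is the
  expected number of zeros, which is \<open>\<D>\<close>: for almost every \<open>f\<close> the real segment from \<open>z_i ^ d_i - z_0 ^ d_i\<close>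
  to \<open>f\<close> avoids the degenerate systems, a set of real codimension two, and the number of zeros is
  constant along it.
\<close>

text \<open>The zeros move with \<open>f\<close>, so the two expectations cannot be compared system
  by system; only at a fixed point does the determinant become linear in one equation with the
  others frozen. The passage to a fixed point uses shifts of the coefficients of
  \<open>z_0 ^ d_i\<close>: they add a constant vector to \<open>f(1, z)\<close> and leave
  \<open>G\<close> alone, so the zeros of the shifted systems are the fibres of one map, and the
  area formula between spaces of equal dimension suffices. For the same reason the integral over the
  hyperplane asks for no basis of it: one integrates over all systems, confines those coefficients
  to the unit cube, and corrects them in the density so that \<open>f\<close> vanishes at the point.
  The number \<open>\<nu>\<^sub>j\<close> appears both in the inverse of the derivative and as a
  variance because both come from the same cofactor vector, projected to the complement of
  \<open>\<zeta>\<close>; the reproducing kernel of the Weyl product gives its exact value. A second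
  obstacle is measurability: Fubini and the area formula are applied to sums over zeros, whose
  dependence on \<open>f\<close> has to be shown Borel.\<close>

subsection \<open>Averaging over orbits\<close>

text \<open>
  Averaging over the orbits of a measure preserving action of a Euclidean space: \<open>K\<close> is an
  equivariant coordinate, and the unit cube serves as a window of total mass one.
\<close>

lemma nn_integral_slice:
  fixes K :: "'x \<Rightarrow> 'e::euclidean_space" and act :: "'x \<Rightarrow> 'e \<Rightarrow> 'x"
  assumes sf: "sigma_finite_measure M"
    and act: "(\<lambda>(x, e). act x e) \<in> measurable (M \<Otimes>\<^sub>M borel) M"
    and inv: "\<And>e. distr M M (\<lambda>x. act x e) = M"
    and undo: "\<And>x e. x \<in> space M \<Longrightarrow> act (act x e) (- e) = x"
    and K[measurable]: "K \<in> borel_measurable M"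
    and Kact: "\<And>x e. x \<in> space M \<Longrightarrow> K (act x e) = K x + e"
    and \<Phi>[measurable]: "\<Phi> \<in> borel_measurable M"
  shows "(\<integral>\<^sup>+x. \<Phi> x \<partial>M) = (\<integral>\<^sup>+x. indicator (cbox 0 One) (K x) * (\<integral>\<^sup>+e. \<Phi> (act x e) \<partial>lborel) \<partial>M)"
proof -
  interpret sigma_finite_measure M by fact
  interpret pair_sigma_finite M "lborel :: 'e measure" ..
  have act'[measurable (raw)]: "(\<lambda>w. act (f w) (g w)) \<in> measurable N M"
    if "f \<in> measurable N M" "g \<in> measurable N borel" for f g and N :: "'z measure"
    using measurable_compose[OF measurable_Pair[OF that] act] by simp
  let ?\<theta> = "\<lambda>e :: 'e. indicator (cbox 0 One) e :: ennreal"
  have unit: "(\<integral>\<^sup>+e. ?\<theta> (k - e) \<partial>lborel) = 1" for k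
  proof -
    have "(\<integral>\<^sup>+e. ?\<theta> (k - e) \<partial>lborel) = (\<integral>\<^sup>+e. ?\<theta> e \<partial>distr lborel borel (\<lambda>e. k + (-1) *\<^sub>R e))"
      by (subst nn_integral_distr) auto
    also have "distr lborel borel (\<lambda>e :: 'e. k + (-1) *\<^sub>R e) = lborel"
      using lborel_affine[of "-1" k] by (simp add: density_1)
    also have "(\<integral>\<^sup>+e. ?\<theta> e \<partial>lborel) = 1" by (simp add: emeasure_lborel_cbox_eq)
    finally show ?thesis .
  qed
  have actsp: "act x e \<in> space M" if "x \<in> space M" for x e
    using measurable_space[OF act, of "(x, e)"] that by (simp add: space_pair_measure)
  have shift: "(\<integral>\<^sup>+x. h (act x e) \<partial>M) = (\<integral>\<^sup>+x. h x \<partial>M)" if [measurable]: "h \<in> borel_measurable M" for h :: "'x \<Rightarrow> ennreal" and e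
    by (subst (2) inv[of e, symmetric]) (simp add: nn_integral_distr)
  \<comment> \<open>The factor 1 is inserted as the mass of the window translated to
    \<open>K x\<close>. After swapping the integrals, \<open>x\<close> is replaced by
    \<open>act x e\<close> for each fixed \<open>e\<close>; equivariance then frees the window from
    \<open>e\<close>.\<close>
  have "(\<integral>\<^sup>+x. \<Phi> x \<partial>M) = (\<integral>\<^sup>+x. \<Phi> x * (\<integral>\<^sup>+e. ?\<theta> (K x - e) \<partial>lborel) \<partial>M)"
    by (simp add: unit)
  also have "\<dots> = (\<integral>\<^sup>+x. (\<integral>\<^sup>+e. \<Phi> x * ?\<theta> (K x - e) \<partial>lborel) \<partial>M)"
    by (intro nn_integral_cong nn_integral_cmult[symmetric]) auto
  also have "\<dots> = (\<integral>\<^sup>+e. (\<integral>\<^sup>+x. \<Phi> x * ?\<theta> (K x - e) \<partial>M) \<partial>lborel)"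
    by (rule Fubini'[symmetric]) measurable
  also have "\<dots> = (\<integral>\<^sup>+e. (\<integral>\<^sup>+x. \<Phi> (act x e) * ?\<theta> (K (act x e) - e) \<partial>M) \<partial>lborel)"
    by (intro nn_integral_cong shift[symmetric]) measurable
  also have "\<dots> = (\<integral>\<^sup>+e. (\<integral>\<^sup>+x. ?\<theta> (K x) * \<Phi> (act x e) \<partial>M) \<partial>lborel)"
    by (intro nn_integral_cong) (simp add: Kact mult.commute)
  also have "\<dots> = (\<integral>\<^sup>+x. (\<integral>\<^sup>+e. ?\<theta> (K x) * \<Phi> (act x e) \<partial>lborel) \<partial>M)"
    by (rule Fubini') measurable
  also have "\<dots> = (\<integral>\<^sup>+x. ?\<theta> (K x) * (\<integral>\<^sup>+e. \<Phi> (act x e) \<partial>lborel) \<partial>M)"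
    by (intro nn_integral_cong nn_integral_cmult) measurable
  finally show ?thesis .
qed

section \<open>Translation invariance of product measures\<close>

definition shift_family :: "'i set \<Rightarrow> ('i \<Rightarrow> complex) \<Rightarrow> ('i \<Rightarrow> complex) \<Rightarrow> 'i \<Rightarrow> complex"
  where "shift_family I x t = (\<lambda>i\<in>I. x i + t i)"

text \<open>Invariance is checked on rectangles, where it splits into the factors. The factors are
  arbitrary invariant measures because the coefficient measures are dilated copies of Lebesgue
  measure, with a dilation depending on the index.\<close>

lemma distr_shift_family:
  assumes I: "finite I" and sf: "\<And>i. sigma_finite_measure (N i)"
    and sets[measurable_cong]: "\<And>i. sets (N i) = sets borel"
    and inv: "\<And>i c. distr (N i) borel (\<lambda>x. x + c) = N i"
  shows "distr (Pi\<^sub>M I N) (Pi\<^sub>M I N) (\<lambda>x. shift_family I x t) = Pi\<^sub>M I N"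
proof -
  interpret product_sigma_finite N by (intro product_sigma_finite.intro sf)
  have sp: "space (N i) = UNIV" for i using sets_eq_imp_space_eq[OF sets] by simp
  have m: "(\<lambda>x. shift_family I x t) \<in> measurable (Pi\<^sub>M I N) (Pi\<^sub>M I N)"
    unfolding shift_family_def by (rule measurable_restrict) measurable
  show ?thesis
  proof (rule PiM_eqI)
    fix A assume A: "\<And>i. i \<in> I \<Longrightarrow> A i \<in> sets (N i)"
    have A'[measurable]: "i \<in> I \<Longrightarrow> A i \<in> sets borel" for i using A sets by blast
    have "(\<lambda>x. shift_family I x t) -` (Pi\<^sub>E I A) \<inter> space (Pi\<^sub>M I N) = Pi\<^sub>E I (\<lambda>i. (\<lambda>x. x + t i) -` A i)"
      by (auto simp: shift_family_def space_PiM sp PiE_iff)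
    then have "emeasure (distr (Pi\<^sub>M I N) (Pi\<^sub>M I N) (\<lambda>x. shift_family I x t)) (Pi\<^sub>E I A)
        = emeasure (Pi\<^sub>M I N) (Pi\<^sub>E I (\<lambda>i. (\<lambda>x. x + t i) -` A i))"
      using A I by (subst emeasure_distr) (auto intro!: m sets_PiM_I_finite)
    also have "\<dots> = (\<Prod>i\<in>I. emeasure (N i) ((\<lambda>x. x + t i) -` A i))"
      using I by (intro emeasure_PiM) (auto simp: sets intro!: measurable_sets_borel[of _ borel])
    also have "\<dots> = (\<Prod>i\<in>I. emeasure (N i) (A i))"
    proof (rule prod.cong)
      fix i assume i: "i \<in> I"
      have "emeasure (distr (N i) borel (\<lambda>x. x + t i)) (A i) = emeasure (N i) ((\<lambda>x. x + t i) -` A i)"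
        using A'[OF i] by (subst emeasure_distr) (auto simp: sp)
      then show "emeasure (N i) ((\<lambda>x. x + t i) -` A i) = emeasure (N i) (A i)" by (simp add: inv)
    qed simp
    finally show "emeasure (distr (Pi\<^sub>M I N) (Pi\<^sub>M I N) (\<lambda>x. shift_family I x t)) (Pi\<^sub>E I A) = (\<Prod>i\<in>I. emeasure (N i) (A i))" .
  qed (use I in auto)
qed

subsection \<open>The coefficient spaces\<close>

lemma finite_multi_indices [simp]: "finite (multi_indices d :: ('n::finite option \<Rightarrow> nat) set)"
proof (rule finite_subset)
  show "multi_indices d \<subseteq> (UNIV :: 'n option set) \<rightarrow>\<^sub>E {..d}"
    by (auto simp: multi_indices_def PiE_iff intro: member_le_sum)
qed (auto intro: finite_PiE)

lemma multinom_pos [simp]: "multinom d \<alpha> > 0"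
  by (auto simp: multinom_def intro!: divide_pos_pos prod_pos)

text \<open>The law of a single monomial coefficient when the corresponding orthonormal coordinate
  has Lebesgue measure.\<close>

definition coef_measure :: "nat \<Rightarrow> ('n::finite option \<Rightarrow> nat) \<Rightarrow> complex measure" where
  "coef_measure d \<alpha> = distr lborel borel (\<lambda>x. of_real (sqrt (multinom d \<alpha>)) * x)"

lemma sets_coef_measure [simp, measurable_cong]: "sets (coef_measure d \<alpha>) = sets borel"
  and space_coef_measure [simp]: "space (coef_measure d \<alpha>) = UNIV"
  by (simp_all add: coef_measure_def)

lemma sigma_finite_distr_inj:
  assumes "sigma_finite_measure M" and f: "f \<in> measurable M N" and g: "g \<in> measurable N M"
    and gf: "\<And>x. x \<in> space M \<Longrightarrow> g (f x) = x"
  shows "sigma_finite_measure (distr M N f)"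
proof -
  interpret sigma_finite_measure M by fact
  obtain A where A: "countable A" "A \<subseteq> sets M" "\<Union> A = space M" "\<forall>a\<in>A. emeasure M a \<noteq> \<infinity>"
    using sigma_finite_countable by blast
  let ?B = "(\<lambda>a. g -` a \<inter> space N) ` A"
  have pre: "f -` (g -` a \<inter> space N) \<inter> space M = a" if "a \<in> A" for a
    using A that measurable_space[OF f] gf sets.sets_into_space by (fastforce)
  show ?thesis
  proof
    show "\<exists>A. countable A \<and> A \<subseteq> sets (distr M N f) \<and> \<Union> A = space (distr M N f) \<and> (\<forall>a\<in>A. emeasure (distr M N f) a \<noteq> \<infinity>)"
    proof (intro exI[of _ ?B] conjI ballI)
      have "\<Union> ?B = {x \<in> space N. g x \<in> \<Union> A}" by blast
      then show "\<Union> ?B = space (distr M N f)"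
        using measurable_space[OF g] by (auto simp: A(3))
      fix b assume "b \<in> ?B"
      then show "emeasure (distr M N f) b \<noteq> \<infinity>"
        using A pre g by (auto simp: emeasure_distr[OF f] measurable_sets subset_iff)
    qed (use A g in \<open>auto intro: measurable_sets\<close>)
  qed
qed

lemma sigma_finite_coef_measure: "sigma_finite_measure (coef_measure d \<alpha>)"
proof -
  have "sqrt (multinom d \<alpha>) \<noteq> 0" using multinom_pos[of d \<alpha>] by (metis less_irrefl real_sqrt_eq_zero_cancel_iff)
  then show ?thesis unfolding coef_measure_def
    by (intro sigma_finite_distr_inj[where g = "\<lambda>x. x / of_real (sqrt (multinom d \<alpha>))"] sigma_finite_lborel) auto
qed

lemma distr_coef_measure_plus: "distr (coef_measure d \<alpha>) borel (\<lambda>x. x + c) = coef_measure d \<alpha>"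
proof -
  let ?s = "complex_of_real (sqrt (multinom d \<alpha>))"
  have s: "?s \<noteq> 0" using multinom_pos[of d \<alpha>] by (metis less_irrefl real_sqrt_eq_zero_cancel_iff of_real_eq_0_iff)
  have "distr (coef_measure d \<alpha>) borel (\<lambda>x. x + c) = distr lborel borel (\<lambda>x. ?s * x + c)"
    unfolding coef_measure_def by (subst distr_distr) (auto simp: o_def)
  also have "\<dots> = distr (distr lborel borel ((+) (c / ?s))) borel (\<lambda>x. ?s * x)"
    by (subst distr_distr) (use s in \<open>auto simp: o_def algebra_simps\<close>)
  finally show ?thesis by (simp add: lborel_distr_plus coef_measure_def)
qed

interpretation coef: product_sigma_finite "coef_measure d" for d
  by (intro product_sigma_finite.intro sigma_finite_coef_measure)

text \<open>The dilation acts coordinatewise, so it can be moved inside the product. In this form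
  Fubini and product integrals apply to the monomial coefficients themselves.\<close>

lemma hpoly_lebesgue_eq: "hpoly_lebesgue d = Pi\<^sub>M (multi_indices d) (coef_measure d)"
proof (rule coef.PiM_eqI)
  have s: "sets (Pi\<^sub>M (multi_indices d) (\<lambda>_. borel)) = sets (Pi\<^sub>M (multi_indices d) (coef_measure d))"
    by (intro sets_PiM_cong) auto
  then show "sets (hpoly_lebesgue d) = sets (Pi\<^sub>M (multi_indices d) (coef_measure d))"
    by (simp add: hpoly_lebesgue_def)
  interpret product_sigma_finite "\<lambda>_ :: 'b option \<Rightarrow> nat. lborel :: complex measure"
    by (intro product_sigma_finite.intro sigma_finite_lborel)
  let ?c = "\<lambda>\<alpha>. complex_of_real (sqrt (multinom d \<alpha>))"
  fix A assume "\<And>\<alpha>. \<alpha> \<in> multi_indices d \<Longrightarrow> A \<alpha> \<in> sets (coef_measure d \<alpha>)"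
  then have A[measurable]: "\<alpha> \<in> multi_indices d \<Longrightarrow> A \<alpha> \<in> sets borel" for \<alpha> by simp
  have m: "(\<lambda>x. \<lambda>\<alpha>\<in>multi_indices d. ?c \<alpha> * x \<alpha>) \<in> measurable (Pi\<^sub>M (multi_indices d) (\<lambda>_. lborel)) (Pi\<^sub>M (multi_indices d) (\<lambda>_. borel))"
    by (rule measurable_restrict) measurable
  have "(\<lambda>x. \<lambda>\<alpha>\<in>multi_indices d. ?c \<alpha> * x \<alpha>) -` (Pi\<^sub>E (multi_indices d) A) \<inter> space (Pi\<^sub>M (multi_indices d) (\<lambda>_. lborel))
     = Pi\<^sub>E (multi_indices d) (\<lambda>\<alpha>. (\<lambda>x. ?c \<alpha> * x) -` A \<alpha>)"
    by (auto simp: space_PiM PiE_iff)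
  then have "emeasure (hpoly_lebesgue d) (Pi\<^sub>E (multi_indices d) A)
    = emeasure (Pi\<^sub>M (multi_indices d) (\<lambda>_. lborel)) (Pi\<^sub>E (multi_indices d) (\<lambda>\<alpha>. (\<lambda>x. ?c \<alpha> * x) -` A \<alpha>))"
    unfolding hpoly_lebesgue_def by (subst emeasure_distr) (auto intro!: m sets_PiM_I_finite)
  also have "\<dots> = (\<Prod>\<alpha>\<in>multi_indices d. emeasure lborel ((\<lambda>x. ?c \<alpha> * x) -` A \<alpha>))"
    by (intro emeasure_PiM) (auto intro!: measurable_sets_borel[of _ borel])
  also have "\<dots> = (\<Prod>\<alpha>\<in>multi_indices d. emeasure (coef_measure d \<alpha>) (A \<alpha>))"
    unfolding coef_measure_def by (intro prod.cong refl, subst emeasure_distr) auto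
  finally show "emeasure (hpoly_lebesgue d) (Pi\<^sub>E (multi_indices d) A) = (\<Prod>\<alpha>\<in>multi_indices d. emeasure (coef_measure d \<alpha>) (A \<alpha>))" .
qed simp

lemma space_hpoly_lebesgue: "space (hpoly_lebesgue d) = hpolys d"
  by (simp add: hpoly_lebesgue_def space_PiM hpolys_def)

lemma space_system_lebesgue: "space (system_lebesgue d) = hsystems d"
  by (auto simp: system_lebesgue_def space_PiM space_hpoly_lebesgue hsystems_def)

lemma sets_hpoly_lebesgue [measurable_cong]:
  "sets (hpoly_lebesgue d) = sets (Pi\<^sub>M (multi_indices d) (\<lambda>_. borel))"
  by (simp add: hpoly_lebesgue_def)

lemma sigma_finite_hpoly_lebesgue: "sigma_finite_measure (hpoly_lebesgue d)"
  unfolding hpoly_lebesgue_eq by (rule coef.sigma_finite) simp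

interpretation hpoly: product_sigma_finite "\<lambda>i. hpoly_lebesgue (d i)" for d :: "'i \<Rightarrow> nat"
  by (intro product_sigma_finite.intro sigma_finite_hpoly_lebesgue)

lemma sigma_finite_system_lebesgue: "sigma_finite_measure (system_lebesgue d)"
  unfolding system_lebesgue_def by (rule hpoly.sigma_finite) simp

lemma measurable_hpoly_coef:
  "\<alpha> \<in> multi_indices d \<Longrightarrow> (\<lambda>p. p \<alpha>) \<in> borel_measurable (hpoly_lebesgue d)"
  by measurable

lemma measurable_system_coef:
  "\<alpha> \<in> multi_indices (d i) \<Longrightarrow> (\<lambda>f. f i \<alpha>) \<in> borel_measurable (system_lebesgue d)"
  unfolding system_lebesgue_def
  by (rule measurable_compose[OF measurable_component_singleton[of i UNIV "\<lambda>i. hpoly_lebesgue (d i)"]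
      measurable_hpoly_coef[of \<alpha> "d i"]]) auto

section \<open>Translations and slices of the space of systems\<close>

definition hshift :: "nat \<Rightarrow> 'n::finite hpoly \<Rightarrow> 'n hpoly \<Rightarrow> 'n hpoly" where
  "hshift d p q = (\<lambda>\<alpha>\<in>multi_indices d. p \<alpha> + q \<alpha>)"

definition sshift :: "('n::finite \<Rightarrow> nat) \<Rightarrow> ('n \<Rightarrow> 'n hpoly) \<Rightarrow> ('n \<Rightarrow> 'n hpoly) \<Rightarrow> 'n \<Rightarrow> 'n hpoly" where
  "sshift d f h = (\<lambda>i. hshift (d i) (f i) (h i))"

lemma distr_hshift: "distr (hpoly_lebesgue d) (hpoly_lebesgue d) (\<lambda>p. hshift d p q) = hpoly_lebesgue d"
  unfolding hpoly_lebesgue_eq using distr_shift_family[of "multi_indices d" "coef_measure d" q]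
  by (simp add: shift_family_def hshift_def[abs_def] sigma_finite_coef_measure distr_coef_measure_plus)

lemma measurable_hshift:
  assumes "f \<in> measurable N (hpoly_lebesgue d)" and [measurable]: "\<And>\<alpha>. \<alpha> \<in> multi_indices d \<Longrightarrow> (\<lambda>w. q w \<alpha>) \<in> borel_measurable N"
  shows "(\<lambda>w. hshift d (f w) (q w)) \<in> measurable N (hpoly_lebesgue d)"
proof -
  have [measurable]: "\<alpha> \<in> multi_indices d \<Longrightarrow> (\<lambda>w. f w \<alpha>) \<in> borel_measurable N" for \<alpha>
    using measurable_compose[OF assms(1) measurable_hpoly_coef] by simp
  have "(\<lambda>w. hshift d (f w) (q w)) \<in> measurable N (Pi\<^sub>M (multi_indices d) (\<lambda>_. borel))"
    unfolding hshift_def by (rule measurable_restrict) measurable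
  then show ?thesis by (simp cong: measurable_cong_sets add: sets_hpoly_lebesgue)
qed

lemma measurable_sshift:
  assumes f: "f \<in> measurable N (system_lebesgue d)"
    and q: "\<And>i \<alpha>. \<alpha> \<in> multi_indices (d i) \<Longrightarrow> (\<lambda>w. q w i \<alpha>) \<in> borel_measurable N"
  shows "(\<lambda>w. sshift d (f w) (q w)) \<in> measurable N (system_lebesgue d)"
proof -
  have "(\<lambda>w. f w i) \<in> measurable N (hpoly_lebesgue (d i))" for i
    using f measurable_component_singleton[of i UNIV "\<lambda>i. hpoly_lebesgue (d i)"]
    unfolding system_lebesgue_def by (auto dest: measurable_compose)
  then have "(\<lambda>w. \<lambda>i\<in>UNIV. hshift (d i) (f w i) (q w i)) \<in> measurable N (system_lebesgue d)"
    unfolding system_lebesgue_def using q by (intro measurable_restrict measurable_hshift) auto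
  then show ?thesis by (simp add: sshift_def[abs_def] restrict_def)
qed

lemma distr_sshift:
  fixes d :: "'n::finite \<Rightarrow> nat"
  shows "distr (system_lebesgue d) (system_lebesgue d) (\<lambda>f. sshift d f h) = system_lebesgue d"
proof -
  have m: "(\<lambda>f. sshift d f h) \<in> measurable (system_lebesgue d) (system_lebesgue d)"
    by (rule measurable_sshift) auto
  have mh: "(\<lambda>p. hshift (d i) p (h i)) \<in> measurable (hpoly_lebesgue (d i)) (hpoly_lebesgue (d i))" for i
    by (rule measurable_hshift) auto
  show ?thesis
  proof (subst (3) system_lebesgue_def, rule hpoly.PiM_eqI)
    show "sets (distr (system_lebesgue d) (system_lebesgue d) (\<lambda>f. sshift d f h)) = sets (Pi\<^sub>M UNIV (\<lambda>i. hpoly_lebesgue (d i)))"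
      by (simp add: system_lebesgue_def)
    fix A :: "'n \<Rightarrow> 'n hpoly set" assume A: "\<And>i. i \<in> UNIV \<Longrightarrow> A i \<in> sets (hpoly_lebesgue (d i))"
    let ?B = "\<lambda>i. (\<lambda>p. hshift (d i) p (h i)) -` A i \<inter> space (hpoly_lebesgue (d i))"
    have B: "?B i \<in> sets (hpoly_lebesgue (d i))" for i using mh A by (intro measurable_sets) auto
    have "(\<lambda>f. sshift d f h) -` (Pi\<^sub>E UNIV A) \<inter> space (system_lebesgue d) = Pi\<^sub>E UNIV ?B"
      by (auto simp: system_lebesgue_def space_PiM PiE_iff sshift_def)
    then have "emeasure (distr (system_lebesgue d) (system_lebesgue d) (\<lambda>f. sshift d f h)) (Pi\<^sub>E UNIV A)
       = emeasure (Pi\<^sub>M UNIV (\<lambda>i. hpoly_lebesgue (d i))) (Pi\<^sub>E UNIV ?B)"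
      using A by (subst emeasure_distr[OF m]) (auto simp: system_lebesgue_def intro!: sets_PiM_I_finite)
    also have "\<dots> = (\<Prod>i\<in>UNIV. emeasure (hpoly_lebesgue (d i)) (?B i))"
      using B by (intro hpoly.emeasure_PiM) auto
    also have "\<dots> = (\<Prod>i\<in>UNIV. emeasure (hpoly_lebesgue (d i)) (A i))"
    proof (rule prod.cong)
      fix i
      show "emeasure (hpoly_lebesgue (d i)) (?B i) = emeasure (hpoly_lebesgue (d i)) (A i)"
        using A by (subst (2) distr_hshift[of "d i" "h i", symmetric]) (simp add: emeasure_distr mh)
    qed simp
    finally show "emeasure (distr (system_lebesgue d) (system_lebesgue d) (\<lambda>f. sshift d f h)) (Pi\<^sub>E UNIV A) = (\<Prod>i\<in>UNIV. emeasure (hpoly_lebesgue (d i)) (A i))" .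
  qed simp
qed

text \<open>Orbit averaging for a family \<open>T\<close> of additive perturbations, with
  \<open>K\<close> reading off the perturbed coefficients. Oddness of \<open>T\<close> makes the
  shift by \<open>- e\<close> undo the shift by \<open>e\<close>.\<close>

lemma nn_integral_system_slice:
  fixes T :: "'e::euclidean_space \<Rightarrow> 'n::finite \<Rightarrow> 'n hpoly"
  assumes T[measurable]: "\<And>i \<alpha>. (\<lambda>e. T e i \<alpha>) \<in> borel_measurable borel"
    and Tm: "\<And>e i \<alpha>. T (- e) i \<alpha> = - T e i \<alpha>"
    and K: "K \<in> borel_measurable (system_lebesgue d)"
    and KT: "\<And>f e. K (sshift d f (T e)) = K f + e"
    and \<Phi>: "\<Phi> \<in> borel_measurable (system_lebesgue d)"
  shows "(\<integral>\<^sup>+f. \<Phi> f \<partial>system_lebesgue d)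
    = (\<integral>\<^sup>+f. indicator (cbox 0 One) (K f) * (\<integral>\<^sup>+e. \<Phi> (sshift d f (T e)) \<partial>lborel) \<partial>system_lebesgue d)"
proof (rule nn_integral_slice[OF sigma_finite_system_lebesgue _ _ _ K KT \<Phi>])
  show "(\<lambda>(f, e). sshift d f (T e)) \<in> measurable (system_lebesgue d \<Otimes>\<^sub>M borel) (system_lebesgue d)"
    unfolding case_prod_beta by (rule measurable_sshift) measurable
  fix f e assume "f \<in> space (system_lebesgue d)"
  then show "sshift d (sshift d f (T e)) (T (- e)) = f"
    by (auto simp: space_system_lebesgue hsystems_def hpolys_def sshift_def hshift_def Tm fun_eq_iff PiE_iff extensional_def)
qed (rule distr_sshift)

text \<open>Fubini along the directions \<open>T\<close>. It reduces a genericity statement about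
  systems to negligibility of a set of finitely many perturbation parameters, where smooth images of
  hyperplanes can be used.\<close>

lemma null_sets_system_slice:
  fixes T :: "'e::euclidean_space \<Rightarrow> 'n::finite \<Rightarrow> 'n hpoly"
  assumes T: "\<And>i \<alpha>. (\<lambda>e. T e i \<alpha>) \<in> borel_measurable borel"
    and Tm: "\<And>e i \<alpha>. T (- e) i \<alpha> = - T e i \<alpha>"
    and K: "K \<in> borel_measurable (system_lebesgue d)"
    and KT: "\<And>f e. K (sshift d f (T e)) = K f + e"
    and A: "A \<in> sets (system_lebesgue d)"
    and neg: "\<And>f. f \<in> hsystems d \<Longrightarrow> negligible {e. sshift d f (T e) \<in> A}"
  shows "A \<in> null_sets (system_lebesgue d)"
proof -
  have z: "(\<integral>\<^sup>+e. indicator A (sshift d f (T e)) \<partial>lborel) = 0" if f: "f \<in> hsystems d" for f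
  proof -
    have "(\<lambda>e. sshift d f (T e)) \<in> measurable lborel (system_lebesgue d)"
      using f T by (intro measurable_sshift) (auto simp: space_system_lebesgue)
    from measurable_sets[OF this A] have sl: "{e. sshift d f (T e) \<in> A} \<in> sets lborel"
      by (simp add: vimage_def)
    then have "emeasure lborel {e. sshift d f (T e) \<in> A} = 0"
      using neg[OF f] by (simp add: negligible_iff_null_sets null_sets_def)
    moreover have "(\<integral>\<^sup>+e. indicator A (sshift d f (T e)) \<partial>lborel) = emeasure lborel {e. sshift d f (T e) \<in> A}"
    proof -
      have "(\<lambda>e. indicator A (sshift d f (T e)) :: ennreal) = indicator {e. sshift d f (T e) \<in> A}"
        by (auto simp: indicator_def)
      then show ?thesis using sl by simp
    qed
    ultimately show ?thesis by simp
  qed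
  have "emeasure (system_lebesgue d) A = (\<integral>\<^sup>+f. indicator A f \<partial>system_lebesgue d)" using A by simp
  also have "\<dots> = (\<integral>\<^sup>+f. indicator (cbox 0 One) (K f) * (\<integral>\<^sup>+e. indicator A (sshift d f (T e)) \<partial>lborel) \<partial>system_lebesgue d)"
    using A by (intro nn_integral_system_slice T Tm K KT) auto
  also have "\<dots> = (\<integral>\<^sup>+f. 0 \<partial>system_lebesgue d)"
    by (intro nn_integral_cong) (simp add: z space_system_lebesgue)
  finally show ?thesis using A by auto
qed

subsection \<open>Homogeneous polynomials and the reproducing kernel\<close>

definition mon :: "('n::finite option \<Rightarrow> nat) \<Rightarrow> 'n point \<Rightarrow> complex" where
  "mon \<alpha> x = (\<Prod>v\<in>UNIV. x $ v ^ \<alpha> v)"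

definition dmon :: "('n::finite option \<Rightarrow> nat) \<Rightarrow> 'n point \<Rightarrow> 'n point \<Rightarrow> complex" where
  "dmon \<alpha> x w = (\<Sum>v\<in>UNIV. of_nat (\<alpha> v) * w $ v * x $ v ^ (\<alpha> v - 1) * (\<Prod>u\<in>UNIV - {v}. x $ u ^ \<alpha> u))"

definition deriv_hpoly :: "nat \<Rightarrow> 'n::finite hpoly \<Rightarrow> 'n point \<Rightarrow> 'n point \<Rightarrow> complex" where
  "deriv_hpoly d p x w = (\<Sum>\<alpha>\<in>multi_indices d. p \<alpha> * dmon \<alpha> x w)"

text \<open>The pairing is bilinear rather than Hermitian, so that the kernel is polynomial in both
  arguments and can be differentiated in each; conjugation is inserted by \<open>cnjv\<close> at the
  end.\<close>

definition dot :: "complex ^ 'v::finite \<Rightarrow> complex ^ 'v \<Rightarrow> complex" where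
  "dot x y = (\<Sum>v\<in>UNIV. x $ v * y $ v)"

definition cnjv :: "complex ^ 'v::finite \<Rightarrow> complex ^ 'v" where
  "cnjv x = (\<chi> v. cnj (x $ v))"

lemma eval_hpoly_mon: "eval_hpoly d p x = (\<Sum>\<alpha>\<in>multi_indices d. p \<alpha> * mon \<alpha> x)"
  by (simp add: eval_hpoly_def mon_def)

lemma has_derivative_vec_nth' [derivative_intros]: "((\<lambda>x. x $ v) has_derivative (\<lambda>w. w $ v)) F"
  by (rule bounded_linear_imp_has_derivative[OF bounded_linear_vec_nth])

lemma has_derivative_mon: "((\<lambda>x. mon \<alpha> x) has_derivative dmon \<alpha> x) (at x)"
proof -
  have "((\<lambda>x. \<Prod>v\<in>UNIV. x $ v ^ \<alpha> v) has_derivative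
     (\<lambda>w. \<Sum>v\<in>UNIV. (of_nat (\<alpha> v) * w $ v * x $ v ^ (\<alpha> v - 1)) * (\<Prod>u\<in>UNIV - {v}. x $ u ^ \<alpha> u))) (at x)"
    by (rule has_derivative_prod, rule has_derivative_power, rule has_derivative_vec_nth')
  then show ?thesis by (simp add: mon_def[abs_def] dmon_def[abs_def])
qed

lemma has_derivative_eval_hpoly: "(eval_hpoly d p has_derivative deriv_hpoly d p x) (at x)"
  unfolding eval_hpoly_mon[abs_def] deriv_hpoly_def[abs_def]
  by (rule has_derivative_sum, rule has_derivative_mult_right, rule has_derivative_mon)

lemma dmon_add: "dmon \<alpha> x (w + w') = dmon \<alpha> x w + dmon \<alpha> x w'"
  by (simp add: dmon_def algebra_simps sum.distrib)

lemma dmon_scale: "dmon \<alpha> x (c *s w) = c * dmon \<alpha> x w"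
  by (simp add: dmon_def sum_distrib_left mult_ac)

lemma dmon_0 [simp]: "dmon \<alpha> x 0 = 0" by (simp add: dmon_def)

lemma deriv_hpoly_add: "deriv_hpoly d p x (w + w') = deriv_hpoly d p x w + deriv_hpoly d p x w'"
  by (simp add: deriv_hpoly_def dmon_add algebra_simps sum.distrib)

lemma deriv_hpoly_scale: "deriv_hpoly d p x (c *s w) = c * deriv_hpoly d p x w"
  by (simp add: deriv_hpoly_def dmon_scale sum_distrib_left mult_ac)

lemma sum_multi_index: "\<alpha> \<in> multi_indices d \<Longrightarrow> (\<Sum>v\<in>UNIV. \<alpha> v) = d"
  by (simp add: multi_indices_def)

lemma mon_factor:
  assumes "\<alpha> v > 0"
  shows "x $ v * (x $ v ^ (\<alpha> v - 1) * (\<Prod>u\<in>UNIV - {v}. x $ u ^ \<alpha> u)) = mon \<alpha> x"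
proof -
  have "x $ v * x $ v ^ (\<alpha> v - 1) = x $ v ^ \<alpha> v" using assms by (simp add: power_eq_if)
  then show ?thesis unfolding mon_def by (subst (2) prod.remove[of _ v]) (simp_all add: mult.assoc[symmetric])
qed

lemma dmon_self:
  assumes "\<alpha> \<in> multi_indices d" shows "dmon \<alpha> x x = of_nat d * mon \<alpha> x"
proof -
  have "dmon \<alpha> x x = (\<Sum>v\<in>UNIV. of_nat (\<alpha> v) * mon \<alpha> x)"
    unfolding dmon_def
  proof (rule sum.cong)
    fix v show "of_nat (\<alpha> v) * x $ v * x $ v ^ (\<alpha> v - 1) * (\<Prod>u\<in>UNIV - {v}. x $ u ^ \<alpha> u) = of_nat (\<alpha> v) * mon \<alpha> x"
      using mon_factor[of \<alpha> v x] by (cases "\<alpha> v = 0") (simp_all add: mult.assoc)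
  qed simp
  also have "\<dots> = of_nat (\<Sum>v\<in>UNIV. \<alpha> v) * mon \<alpha> x" by (simp add: sum_distrib_right)
  finally show ?thesis using assms by (simp add: sum_multi_index)
qed

text \<open>Euler's identity. At a zero it kills the derivative along the line, so derivatives there
  may be computed on any complement of the line.\<close>

lemma deriv_hpoly_self: "deriv_hpoly d p x x = of_nat d * eval_hpoly d p x"
  by (simp add: deriv_hpoly_def eval_hpoly_mon dmon_self sum_distrib_left mult_ac)

lemma mon_homogeneous:
  assumes "\<alpha> \<in> multi_indices d" shows "mon \<alpha> (c *s x) = c ^ d * mon \<alpha> x"
  by (simp add: mon_def power_mult_distrib prod.distrib power_sum[symmetric] sum_multi_index[OF assms])

lemma eval_hpoly_homogeneous: "eval_hpoly d p (c *s x) = c ^ d * eval_hpoly d p x"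
  by (simp add: eval_hpoly_mon mon_homogeneous sum_distrib_left mult_ac)

lemma dmon_homogeneous:
  assumes "\<alpha> \<in> multi_indices d" shows "dmon \<alpha> (c *s x) w = c ^ (d - 1) * dmon \<alpha> x w"
  unfolding dmon_def sum_distrib_left
proof (rule sum.cong)
  fix v
  have s: "(\<Sum>u\<in>UNIV - {v}. \<alpha> u) + \<alpha> v = d"
    using assms by (metis UNIV_I add.commute finite sum.remove sum_multi_index)
  show "of_nat (\<alpha> v) * w $ v * (c *s x) $ v ^ (\<alpha> v - 1) * (\<Prod>u\<in>UNIV - {v}. (c *s x) $ u ^ \<alpha> u)
     = c ^ (d - 1) * (of_nat (\<alpha> v) * w $ v * x $ v ^ (\<alpha> v - 1) * (\<Prod>u\<in>UNIV - {v}. x $ u ^ \<alpha> u))"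
  \<comment> \<open>For \<open>\<alpha> v = 0\<close> the truncated exponent
    \<open>\<alpha> v - 1\<close> breaks the degree count, but the factor \<open>\<alpha> v\<close>
    removes the term.\<close>
  proof (cases "\<alpha> v = 0")
    case False
    then have "c ^ (d - 1) = c ^ (\<alpha> v - 1) * c ^ (\<Sum>u\<in>UNIV - {v}. \<alpha> u)"
      using s by (simp add: power_add[symmetric] add.commute)
    then show ?thesis
      by (simp only:) (simp add: power_mult_distrib prod.distrib power_sum mult_ac)
  qed simp
qed simp

lemma deriv_hpoly_homogeneous: "deriv_hpoly d p (c *s x) w = c ^ (d - 1) * deriv_hpoly d p x w"
  by (simp add: deriv_hpoly_def dmon_homogeneous sum_distrib_left mult_ac)

lemma dmon_cnj: "dmon \<alpha> (cnjv x) (cnjv w) = cnj (dmon \<alpha> x w)"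
  by (simp add: dmon_def cnjv_def)

lemma mon_cnj: "mon \<alpha> (cnjv x) = cnj (mon \<alpha> x)"
  by (simp add: mon_def cnjv_def)

lemma dot_cnj_self: "dot x (cnjv x) = of_real ((norm x)\<^sup>2)"
  unfolding dot_def cnjv_def norm_vec_def L2_set_def
  by (simp add: sum_nonneg complex_norm_square[symmetric] real_sqrt_pow2)

lemma dot_diff_left: "dot (x - y) z = dot x z - dot y z"
  and dot_scale_left: "dot (c *s x) z = c * dot x z"
  by (simp_all add: dot_def algebra_simps sum.distrib sum_subtractf sum_distrib_left)

lemma dot_commute: "dot x y = dot y x" by (simp add: dot_def mult.commute)

lemma multinomial_theorem: "(\<Sum>\<alpha>\<in>multi_indices d. of_real (multinom d \<alpha>) * mon \<alpha> x) = (\<Sum>v\<in>UNIV. x $ v) ^ d"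
proof (induction d)
  case 0
  have "multi_indices 0 = {\<lambda>_ :: 'a option. 0}" by (auto simp: multi_indices_def)
  then show ?case by (simp add: multinom_def mon_def)
next
  case (Suc d)
  \<comment> \<open>The shares \<open>\<alpha> v / (d + 1)\<close> of a multi-index of degree
    \<open>d + 1\<close> add up to one. The share of \<open>v\<close> turns the multinomial
    coefficient of \<open>\<alpha>\<close> into that of \<open>\<alpha>\<close> lowered by one at
    \<open>v\<close>, so it collects the terms that arise from degree \<open>d\<close> by the factor
    \<open>x $ v\<close>.\<close>
  have step: "(\<Sum>\<alpha>\<in>multi_indices (Suc d). of_real (multinom (Suc d) \<alpha> * real (\<alpha> v) / real (Suc d)) * mon \<alpha> x)
     = x $ v * (\<Sum>\<beta>\<in>multi_indices d. of_real (multinom d \<beta>) * mon \<beta> x)" for v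
  proof -
    let ?up = "\<lambda>\<beta> :: 'a option \<Rightarrow> nat. \<beta>(v := Suc (\<beta> v))"
    let ?S = "{\<alpha> \<in> multi_indices (Suc d). \<alpha> v > 0}"
    have sum_up: "(\<Sum>u\<in>UNIV. ?up \<beta> u) = Suc (\<Sum>u\<in>UNIV. \<beta> u)" for \<beta>
      by (simp add: sum.remove[of UNIV v])
    have bij: "bij_betw ?up (multi_indices d) ?S"
    proof (rule bij_betw_byWitness[where f' = "\<lambda>\<alpha>. \<alpha>(v := \<alpha> v - 1)"])
      show "?up ` multi_indices d \<subseteq> ?S"
        using sum_up by (auto simp: multi_indices_def simp del: fun_upd_apply) auto
      show "(\<lambda>\<alpha>. \<alpha>(v := \<alpha> v - 1)) ` ?S \<subseteq> multi_indices d"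
      proof (rule image_subsetI)
        fix \<alpha> assume \<alpha>: "\<alpha> \<in> ?S"
        then have "?up (\<alpha>(v := \<alpha> v - 1)) = \<alpha>" by (auto simp: fun_eq_iff)
        with sum_up[of "\<alpha>(v := \<alpha> v - 1)"] \<alpha> show "\<alpha>(v := \<alpha> v - 1) \<in> multi_indices d"
          by (simp add: multi_indices_def del: fun_upd_apply)
      qed
    qed (auto simp: fun_eq_iff)
    have coef_up: "multinom (Suc d) (?up \<beta>) * real (?up \<beta> v) / real (Suc d) = multinom d \<beta>" for \<beta>
    proof -
      have "(\<Prod>u\<in>UNIV. fact (?up \<beta> u)) = real (Suc (\<beta> v)) * (\<Prod>u\<in>UNIV. fact (\<beta> u))"
        by (simp add: prod.remove[of UNIV v] algebra_simps)
      then show ?thesis unfolding multinom_def by (simp del: of_nat_Suc)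
    qed
    have mon_up: "mon (?up \<beta>) x = x $ v * mon \<beta> x" for \<beta>
      by (simp add: mon_def prod.remove[of UNIV v])
    have "(\<Sum>\<alpha>\<in>multi_indices (Suc d). of_real (multinom (Suc d) \<alpha> * real (\<alpha> v) / real (Suc d)) * mon \<alpha> x)
      = (\<Sum>\<alpha>\<in>?S. of_real (multinom (Suc d) \<alpha> * real (\<alpha> v) / real (Suc d)) * mon \<alpha> x)"
      by (rule sum.mono_neutral_right) auto
    also have "\<dots> = (\<Sum>\<beta>\<in>multi_indices d. of_real (multinom (Suc d) (?up \<beta>) * real (?up \<beta> v) / real (Suc d)) * mon (?up \<beta>) x)"
      by (rule sum.reindex_bij_betw[OF bij, symmetric])
    also have "\<dots> = x $ v * (\<Sum>\<beta>\<in>multi_indices d. of_real (multinom d \<beta>) * mon \<beta> x)"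
      unfolding coef_up mon_up by (simp add: sum_distrib_left mult_ac)
    finally show ?thesis .
  qed
  have "(\<Sum>\<alpha>\<in>multi_indices (Suc d). of_real (multinom (Suc d) \<alpha>) * mon \<alpha> x)
     = (\<Sum>\<alpha>\<in>multi_indices (Suc d). \<Sum>v\<in>UNIV. of_real (multinom (Suc d) \<alpha> * real (\<alpha> v) / real (Suc d)) * mon \<alpha> x)"
  proof (rule sum.cong)
    fix \<alpha> :: "'a option \<Rightarrow> nat" assume "\<alpha> \<in> multi_indices (Suc d)"
    then have s: "(\<Sum>v\<in>UNIV. real (\<alpha> v)) = real (Suc d)" by (metis of_nat_sum sum_multi_index)
    have "(\<Sum>v\<in>UNIV. multinom (Suc d) \<alpha> * real (\<alpha> v) / real (Suc d)) = multinom (Suc d) \<alpha>"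
      by (subst sum_divide_distrib[symmetric], subst sum_distrib_left[symmetric], subst s) (simp del: of_nat_Suc)
    then show "of_real (multinom (Suc d) \<alpha>) * mon \<alpha> x = (\<Sum>v\<in>UNIV. of_real (multinom (Suc d) \<alpha> * real (\<alpha> v) / real (Suc d)) * mon \<alpha> x)"
      by (simp only: sum_distrib_right[symmetric] of_real_sum[symmetric])
  qed simp
  also have "\<dots> = (\<Sum>v\<in>UNIV. x $ v * (\<Sum>\<beta>\<in>multi_indices d. of_real (multinom d \<beta>) * mon \<beta> x))"
    by (subst sum.swap) (simp only: step)
  also have "\<dots> = (\<Sum>v\<in>UNIV. x $ v) ^ Suc d"
    by (simp add: Suc sum_distrib_right)
  finally show ?case .
qed

text \<open>The weights of the Weyl product are those of the multinomial theorem, which is applied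
  to the vector of products \<open>x $ v * y $ v\<close>. With \<open>y\<close> conjugated this is
  the reproducing kernel; the norms of evaluation and derivative functionals are obtained by
  differentiating it.\<close>

lemma kernel: "(\<Sum>\<alpha>\<in>multi_indices d. of_real (multinom d \<alpha>) * mon \<alpha> x * mon \<alpha> y) = dot x y ^ d"
proof -
  have "mon \<alpha> (\<chi> v. x $ v * y $ v) = mon \<alpha> x * mon \<alpha> y" for \<alpha>
    by (simp add: mon_def power_mult_distrib prod.distrib)
  then show ?thesis
    using multinomial_theorem[of d "\<chi> v. x $ v * y $ v"] by (simp add: dot_def mult.assoc)
qed

lemma has_derivative_dot_left: "((\<lambda>x. dot x y) has_derivative (\<lambda>w. dot w y)) (at x)"
  unfolding dot_def by (rule has_derivative_sum, rule has_derivative_mult_left, rule has_derivative_vec_nth')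

lemma kernel_deriv1:
  "(\<Sum>\<alpha>\<in>multi_indices d. of_real (multinom d \<alpha>) * dmon \<alpha> x w * mon \<alpha> y) = of_nat d * dot x y ^ (d - 1) * dot w y"
proof -
  have 1: "((\<lambda>x. \<Sum>\<alpha>\<in>multi_indices d. of_real (multinom d \<alpha>) * mon \<alpha> x * mon \<alpha> y) has_derivative
    (\<lambda>w. \<Sum>\<alpha>\<in>multi_indices d. of_real (multinom d \<alpha>) * dmon \<alpha> x w * mon \<alpha> y)) (at x)"
    by (rule has_derivative_sum, rule has_derivative_mult_left, rule has_derivative_mult_right, rule has_derivative_mon)
  have 2: "((\<lambda>x. dot x y ^ d) has_derivative (\<lambda>w. of_nat d * dot w y * dot x y ^ (d - 1))) (at x)"
    by (rule has_derivative_power, rule has_derivative_dot_left)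
  have "(\<lambda>w. \<Sum>\<alpha>\<in>multi_indices d. of_real (multinom d \<alpha>) * dmon \<alpha> x w * mon \<alpha> y) = (\<lambda>w. of_nat d * dot w y * dot x y ^ (d - 1))"
    by (rule has_derivative_unique[OF 1]) (simp only: kernel 2)
  then show ?thesis by (simp add: fun_eq_iff mult_ac)
qed

text \<open>Differentiating \<open>kernel_deriv1\<close> in \<open>y\<close> produces, besides the
  stated term, one with the factor \<open>dot w y\<close>; orthogonality removes it.\<close>

lemma kernel_deriv2:
  assumes "dot w y = 0"
  shows "(\<Sum>\<alpha>\<in>multi_indices d. of_real (multinom d \<alpha>) * dmon \<alpha> x w * dmon \<alpha> y u) = of_nat d * dot x y ^ (d - 1) * dot w u"
proof -
  have 1: "((\<lambda>y. \<Sum>\<alpha>\<in>multi_indices d. of_real (multinom d \<alpha>) * dmon \<alpha> x w * mon \<alpha> y) has_derivative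
    (\<lambda>u. \<Sum>\<alpha>\<in>multi_indices d. of_real (multinom d \<alpha>) * dmon \<alpha> x w * dmon \<alpha> y u)) (at y)"
    by (rule has_derivative_sum, rule has_derivative_mult_right, rule has_derivative_mon)
  have r: "((\<lambda>y. dot z y) has_derivative (\<lambda>u. dot z u)) (at y)" for z
    using has_derivative_dot_left[of z y] by (simp add: dot_commute)
  have 2: "((\<lambda>y. of_nat d * dot x y ^ (d - 1) * dot w y) has_derivative
      (\<lambda>u. of_nat d * dot x y ^ (d - 1) * dot w u + (of_nat d * (of_nat (d - 1) * dot x u * dot x y ^ (d - 1 - 1))) * dot w y)) (at y)"
    by (rule has_derivative_mult[OF has_derivative_mult_right[OF has_derivative_power[OF r]] r])
  have "(\<lambda>u. \<Sum>\<alpha>\<in>multi_indices d. of_real (multinom d \<alpha>) * dmon \<alpha> x w * dmon \<alpha> y u)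
     = (\<lambda>u. of_nat d * dot x y ^ (d - 1) * dot w u + (of_nat d * (of_nat (d - 1) * dot x u * dot x y ^ (d - 1 - 1))) * dot w y)"
    by (rule has_derivative_unique[OF 1]) (simp only: kernel_deriv1 2)
  then show ?thesis using assms by (simp add: fun_eq_iff)
qed

subsection \<open>The affine chart\<close>

definition pt :: "complex ^ 'n::finite \<Rightarrow> 'n point" where
  "pt z = (\<chi> v. case v of None \<Rightarrow> 1 | Some k \<Rightarrow> z $ k)"

definition emb :: "complex ^ 'n::finite \<Rightarrow> 'n point" where
  "emb w = (\<chi> v. case v of None \<Rightarrow> 0 | Some k \<Rightarrow> w $ k)"

lemma pt_nth [simp]: "pt z $ None = 1" "pt z $ Some k = z $ k"
  and emb_nth [simp]: "emb w $ None = 0" "emb w $ Some k = w $ k"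
  by (simp_all add: pt_def emb_def)

lemma pt_nz [simp]: "pt z \<noteq> 0" by (metis pt_nth(1) zero_index zero_neq_one)

lemma vec_option_eq_iff: "x = y \<longleftrightarrow> x $ None = y $ None \<and> (\<forall>k. x $ Some k = y $ Some k)"
  by (simp add: vec_eq_iff split_option_all)

lemma has_derivative_pt: "(pt has_derivative emb) (at z)"
proof -
  have bl: "bounded_linear emb"
    by (rule linear_conv_bounded_linear[THEN iffD1], rule linearI) (simp_all add: vec_option_eq_iff)
  have eq: "pt = (\<lambda>z. pt 0 + emb z)" by (auto simp: vec_option_eq_iff)
  have "((\<lambda>z. pt 0 + emb z) has_derivative (\<lambda>w. 0 + emb w)) (at z)"
    by (rule has_derivative_add[OF has_derivative_const bounded_linear_imp_has_derivative[OF bl]])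
  then show ?thesis by (subst eq) simp
qed

definition chart_map :: "('n::finite \<Rightarrow> nat) \<Rightarrow> ('n \<Rightarrow> 'n hpoly) \<Rightarrow> complex ^ 'n \<Rightarrow> complex ^ 'n" where
  "chart_map d f z = eval_system d f (pt z)"

definition chart_jac :: "('n::finite \<Rightarrow> nat) \<Rightarrow> ('n \<Rightarrow> 'n hpoly) \<Rightarrow> complex ^ 'n \<Rightarrow> complex ^ 'n ^ 'n" where
  "chart_jac d f z = (\<chi> i k. deriv_hpoly (d i) (f i) (pt z) (emb (axis k 1)))"

lemma emb_expand: "emb w = (\<Sum>k\<in>UNIV. w $ k *s emb (axis k 1))"
  by (simp add: vec_option_eq_iff axis_def if_distrib[of "\<lambda>x. _ * x"] cong: if_cong)

lemma deriv_hpoly_0 [simp]: "deriv_hpoly d p x 0 = 0" by (simp add: deriv_hpoly_def)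

lemma deriv_hpoly_sum: "deriv_hpoly d p x (\<Sum>k\<in>A. w k) = (\<Sum>k\<in>A. deriv_hpoly d p x (w k))"
  by (induction A rule: infinite_finite_induct) (simp_all add: deriv_hpoly_add)

lemma chart_jac_mult: "(chart_jac d f z *v w) $ i = deriv_hpoly (d i) (f i) (pt z) (emb w)"
  by (subst emb_expand) (simp add: chart_jac_def matrix_vector_mult_def deriv_hpoly_sum deriv_hpoly_scale mult.commute)

lemma has_derivative_vecI:
  fixes f :: "'a::real_normed_vector \<Rightarrow> 'b::euclidean_space ^ 'n::finite"
  assumes der: "\<And>i. ((\<lambda>x. f x $ i) has_derivative (\<lambda>w. f' w $ i)) F"
  shows "(f has_derivative f') F"
proof -
  have bl: "bounded_linear (axis i :: 'b \<Rightarrow> 'b ^ 'n)" for i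
    by (rule linear_conv_bounded_linear[THEN iffD1], rule linearI) (simp_all add: vec_eq_iff axis_def)
  have e: "(\<Sum>i\<in>UNIV. axis i (y $ i)) = y" for y :: "'b ^ 'n"
    by (simp add: vec_eq_iff axis_def)
  have "((\<lambda>x. \<Sum>i\<in>UNIV. axis i (f x $ i)) has_derivative (\<lambda>w. \<Sum>i\<in>UNIV. axis i (f' w $ i))) F"
    by (rule has_derivative_sum, rule bounded_linear.has_derivative[OF bl der])
  then show ?thesis by (simp only: e)
qed

lemma has_derivative_eval_system:
  "(eval_system d f has_derivative (\<lambda>w. \<chi> i. deriv_hpoly (d i) (f i) x w)) (at x)"
  by (rule has_derivative_vecI) (simp add: eval_system_def has_derivative_eval_hpoly)

lemma D_system_eq: "D_system d f x = (\<lambda>w. \<chi> i. deriv_hpoly (d i) (f i) x w)"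
  unfolding D_system_def by (rule frechet_derivative_at[OF has_derivative_eval_system, symmetric])

lemma has_derivative_chart_map: "(chart_map d f has_derivative (\<lambda>w. chart_jac d f z *v w)) (at z)"
proof -
  have "(eval_system d f \<circ> pt has_derivative (\<lambda>w. \<chi> i. deriv_hpoly (d i) (f i) (pt z) w) \<circ> emb) (at z)"
    by (rule diff_chain_at[OF has_derivative_pt has_derivative_eval_system])
  moreover have "(\<lambda>w. \<chi> i. deriv_hpoly (d i) (f i) (pt z) w) \<circ> emb = (\<lambda>w. chart_jac d f z *v w)"
    by (auto simp: vec_eq_iff chart_jac_mult)
  ultimately show ?thesis by (simp add: chart_map_def[abs_def] o_def)
qed

subsection \<open>Gaussian integrals\<close>

text \<open>Open boxes determine Lebesgue measure, and a box of complex numbers is a product of two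
  intervals. This reduces complex Gaussian moments to real ones.\<close>

lemma lborel_complex_eq: "(lborel :: complex measure) = distr (lborel \<Otimes>\<^sub>M lborel) borel (\<lambda>(x, y). Complex x y)"
proof (rule lborel_eqI)
  have m: "(\<lambda>(x, y). Complex x y) \<in> borel_measurable (lborel \<Otimes>\<^sub>M lborel)"
  proof -
    have "(\<lambda>p. complex_of_real (fst p) + \<i> * complex_of_real (snd p)) \<in> borel_measurable (lborel \<Otimes>\<^sub>M lborel)"
      by measurable
    then show ?thesis by (simp add: case_prod_beta complex_eq_iff Complex_eq)
  qed
  fix l u :: complex assume le: "\<And>b. b \<in> Basis \<Longrightarrow> l \<bullet> b \<le> u \<bullet> b"
  have "Re l \<le> Re u" "Im l \<le> Im u" using le[of 1] le[of \<i>] by (auto simp: Basis_complex_def inner_complex_def)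
  moreover have "(\<lambda>(x, y). Complex x y) -` box l u = {Re l <..< Re u} \<times> {Im l <..< Im u}"
    by (auto simp: box_def Basis_complex_def inner_complex_def)
  ultimately show "emeasure (distr (lborel \<Otimes>\<^sub>M lborel) borel (\<lambda>(x, y). Complex x y)) (box l u) = (\<Prod>b\<in>Basis. (u - l) \<bullet> b)"
    using m by (subst emeasure_distr)
      (auto simp: space_pair_measure lborel.emeasure_pair_measure_Times Basis_complex_def inner_complex_def ennreal_mult)
qed simp

lemma nn_integral_complex:
  assumes [measurable]: "h \<in> borel_measurable borel"
  shows "(\<integral>\<^sup>+z. h z \<partial>lborel) = (\<integral>\<^sup>+x. \<integral>\<^sup>+y. h (Complex x y) \<partial>lborel \<partial>lborel)"
proof -
  have m: "(\<lambda>(x, y). Complex x y) \<in> borel_measurable (lborel \<Otimes>\<^sub>M lborel)"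
  proof -
    have "(\<lambda>p. complex_of_real (fst p) + \<i> * complex_of_real (snd p)) \<in> borel_measurable (lborel \<Otimes>\<^sub>M lborel)"
      by measurable
    then show ?thesis by (simp add: case_prod_beta complex_eq_iff Complex_eq)
  qed
  have "(\<integral>\<^sup>+z. h z \<partial>lborel) = (\<integral>\<^sup>+p. h (case p of (x, y) \<Rightarrow> Complex x y) \<partial>(lborel \<Otimes>\<^sub>M lborel))"
    by (subst lborel_complex_eq, subst nn_integral_distr[OF m]) simp_all
  also have "\<dots> = (\<integral>\<^sup>+x. \<integral>\<^sup>+y. h (Complex x y) \<partial>lborel \<partial>lborel)"
    using measurable_compose[OF m assms] by (subst lborel.nn_integral_fst[symmetric]) (simp_all add: case_prod_beta)
  finally show ?thesis .
qed

lemma real_gaussian_moments: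
  assumes \<tau>: "\<tau> > 0"
  shows "(\<integral>\<^sup>+x. ennreal (exp (- (x\<^sup>2 / \<tau>\<^sup>2))) \<partial>lborel) = ennreal (sqrt pi * \<tau>)"
    and "(\<integral>\<^sup>+x. ennreal (x\<^sup>2 * exp (- (x\<^sup>2 / \<tau>\<^sup>2))) \<partial>lborel) = ennreal (sqrt pi * \<tau> * (\<tau>\<^sup>2 / 2))"
proof -
  \<comment> \<open>The exponent carries no factor 1/2, so the matching normal density has variance
    \<open>\<tau>\<^sup>2 / 2\<close>.\<close>
  define s where "s = \<tau> / sqrt 2"
  have s: "s > 0" "s\<^sup>2 = \<tau>\<^sup>2 / 2" using \<tau> by (auto simp: s_def power_divide)
  have nd: "exp (- (x\<^sup>2 / \<tau>\<^sup>2)) = sqrt pi * \<tau> * normal_density 0 s x" for x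
    using \<tau> by (simp add: normal_density_def s real_sqrt_mult)
  have i0: "has_bochner_integral lborel (\<lambda>x. normal_density 0 s x) 1"
    using normal_moment_even[OF s(1), of 0 0] by simp
  have i2: "has_bochner_integral lborel (\<lambda>x. normal_density 0 s x * x\<^sup>2) (\<tau>\<^sup>2 / 2)"
    using normal_moment_even[OF s(1), of 0 1] unfolding s(2)[symmetric] by simp
  have "has_bochner_integral lborel (\<lambda>x. exp (- (x\<^sup>2 / \<tau>\<^sup>2))) (sqrt pi * \<tau> * 1)"
    unfolding nd by (rule has_bochner_integral_mult_right[OF i0])
  then show "(\<integral>\<^sup>+x. ennreal (exp (- (x\<^sup>2 / \<tau>\<^sup>2))) \<partial>lborel) = ennreal (sqrt pi * \<tau>)"
    by (subst nn_integral_eq_integral) (auto simp: has_bochner_integral_iff)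
  have hb: "has_bochner_integral lborel (\<lambda>x. x\<^sup>2 * exp (- (x\<^sup>2 / \<tau>\<^sup>2))) (sqrt pi * \<tau> * (\<tau>\<^sup>2 / 2))"
    using has_bochner_integral_mult_right[OF i2, of "sqrt pi * \<tau>"] unfolding nd by (simp add: mult_ac)
  show "(\<integral>\<^sup>+x. ennreal (x\<^sup>2 * exp (- (x\<^sup>2 / \<tau>\<^sup>2))) \<partial>lborel) = ennreal (sqrt pi * \<tau> * (\<tau>\<^sup>2 / 2))"
    unfolding has_bochner_integral_integral_eq[OF hb, symmetric]
    by (rule nn_integral_eq_integral) (use hb in \<open>auto simp: has_bochner_integral_iff\<close>)
qed

lemma complex_gaussian_moments:
  assumes \<tau>: "\<tau> > 0"
  shows "(\<integral>\<^sup>+u. ennreal (exp (- ((norm u)\<^sup>2 / \<tau>\<^sup>2))) \<partial>(lborel :: complex measure)) = ennreal (pi * \<tau>\<^sup>2)"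
    and "(\<integral>\<^sup>+u. ennreal ((norm u)\<^sup>2 * exp (- ((norm u)\<^sup>2 / \<tau>\<^sup>2))) \<partial>(lborel :: complex measure)) = ennreal (pi * \<tau>\<^sup>2 * \<tau>\<^sup>2)"
proof -
  let ?e = "\<lambda>x. exp (- (x\<^sup>2 / \<tau>\<^sup>2)) :: real"
  let ?E = "ennreal (sqrt pi * \<tau>)" and ?V = "ennreal (sqrt pi * \<tau> * (\<tau>\<^sup>2 / 2))"
  have n: "(norm (Complex x y))\<^sup>2 = x\<^sup>2 + y\<^sup>2" for x y by (simp add: cmod_def)
  have e: "exp (- ((x\<^sup>2 + y\<^sup>2) / \<tau>\<^sup>2)) = ?e x * ?e y" for x y
    by (simp add: exp_add[symmetric] add_divide_distrib diff_divide_distrib)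
  have 1: "ennreal (exp (- ((norm (Complex x y))\<^sup>2 / \<tau>\<^sup>2))) = ennreal (?e x) * ennreal (?e y)" for x y
    unfolding n e by (rule ennreal_mult) auto
  have 2: "ennreal ((norm (Complex x y))\<^sup>2 * exp (- ((norm (Complex x y))\<^sup>2 / \<tau>\<^sup>2)))
     = ennreal (x\<^sup>2 * ?e x) * ennreal (?e y) + ennreal (?e x) * ennreal (y\<^sup>2 * ?e y)" for x y
    unfolding n e by (simp add: ennreal_mult[symmetric] ennreal_plus[symmetric] distrib_right mult_ac del: ennreal_plus)
  have "(\<integral>\<^sup>+u. ennreal (exp (- ((norm u)\<^sup>2 / \<tau>\<^sup>2))) \<partial>(lborel :: complex measure))
      = (\<integral>\<^sup>+x. \<integral>\<^sup>+y. ennreal (?e x) * ennreal (?e y) \<partial>lborel \<partial>lborel)"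
    by (subst nn_integral_complex) (measurable, simp only: 1)
  also have "\<dots> = ?E * ?E"
    by (simp add: nn_integral_cmult nn_integral_multc real_gaussian_moments[OF \<tau>])
  also have "\<dots> = ennreal (pi * \<tau>\<^sup>2)"
    using \<tau> by (simp add: ennreal_mult[symmetric] power2_eq_square algebra_simps)
  finally show "(\<integral>\<^sup>+u. ennreal (exp (- ((norm u)\<^sup>2 / \<tau>\<^sup>2))) \<partial>(lborel :: complex measure)) = ennreal (pi * \<tau>\<^sup>2)" .
  have "(\<integral>\<^sup>+u. ennreal ((norm u)\<^sup>2 * exp (- ((norm u)\<^sup>2 / \<tau>\<^sup>2))) \<partial>(lborel :: complex measure))
      = (\<integral>\<^sup>+x. \<integral>\<^sup>+y. ennreal (x\<^sup>2 * ?e x) * ennreal (?e y) + ennreal (?e x) * ennreal (y\<^sup>2 * ?e y) \<partial>lborel \<partial>lborel)"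
    by (subst nn_integral_complex) (measurable, simp only: 2)
  also have "\<dots> = ?V * ?E + ?E * ?V"
    by (simp add: nn_integral_add nn_integral_cmult nn_integral_multc real_gaussian_moments[OF \<tau>])
  also have "\<dots> = ennreal (pi * \<tau>\<^sup>2 * \<tau>\<^sup>2)"
    using \<tau> by (simp add: ennreal_mult[symmetric] ennreal_plus[symmetric] power2_eq_square algebra_simps del: ennreal_plus)
  finally show "(\<integral>\<^sup>+u. ennreal ((norm u)\<^sup>2 * exp (- ((norm u)\<^sup>2 / \<tau>\<^sup>2))) \<partial>(lborel :: complex measure)) = ennreal (pi * \<tau>\<^sup>2 * \<tau>\<^sup>2)" .
qed

lemma nn_integral_lborel_shift:
  fixes c :: "'a::euclidean_space"
  assumes "h \<in> borel_measurable borel"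
  shows "(\<integral>\<^sup>+x. h (c + x) \<partial>lborel) = (\<integral>\<^sup>+x. h x \<partial>lborel)"
proof -
  have "(\<integral>\<^sup>+x. h x \<partial>distr lborel borel ((+) c)) = (\<integral>\<^sup>+x. h (c + x) \<partial>lborel)"
    by (rule nn_integral_distr) (use assms in auto)
  then show ?thesis by (simp only: lborel_distr_plus)
qed

lemma nn_integral_lborel_uminus:
  fixes h :: "'a::euclidean_space \<Rightarrow> ennreal"
  assumes "h \<in> borel_measurable borel"
  shows "(\<integral>\<^sup>+x. h (- x) \<partial>lborel) = (\<integral>\<^sup>+x. h x \<partial>lborel)"
proof -
  have "(\<integral>\<^sup>+x. h x \<partial>distr lborel borel (\<lambda>x. 0 + (-1) *\<^sub>R x)) = (\<integral>\<^sup>+x. h (- x) \<partial>lborel)"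
    by (subst nn_integral_distr) (use assms in auto)
  moreover have "distr lborel borel (\<lambda>e :: 'a. 0 + (-1) *\<^sub>R e) = lborel"
    using lborel_affine[of "-1" "0 :: 'a"] by (simp add: density_1)
  ultimately show ?thesis by simp
qed

text \<open>Under the weight \<open>E\<close>, the value \<open>a + s * \<nu>\<close> is a complex
  Gaussian of mean \<open>y\<close> and variance \<open>\<sigma>\<^sup>2 * \<nu>\<close>, and the
  second moment is variance plus squared mean. On the right stands the total mass, written with the
  nonvanishing factor that the Kac--Rice formula produces; it differs from 1 at a single
  point.\<close>

lemma gaussian_second_moment:
  fixes a y :: complex
  assumes \<nu>: "\<nu> > 0" and \<sigma>: "\<sigma> > 0"
  defines "E \<equiv> \<lambda>s. exp (- ((norm (a + s * of_real \<nu> - y))\<^sup>2 / (\<nu> * \<sigma>\<^sup>2)))"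
  shows "(\<integral>\<^sup>+s. ennreal ((norm (a + s * of_real \<nu>))\<^sup>2 * E s) \<partial>lborel)
    = ennreal (\<sigma>\<^sup>2 * \<nu> + (norm y)\<^sup>2) * (\<integral>\<^sup>+s. ennreal ((if a + s * of_real \<nu> = 0 then 0 else 1) * E s) \<partial>lborel)"
proof -
  \<comment> \<open>After the substitution \<open>s = c + u\<close> the difference to
    \<open>y\<close> is \<open>u * \<nu>\<close>, so the exponent becomes
    \<open>(norm u)\<^sup>2 * \<nu> / \<sigma>\<^sup>2\<close>.\<close>
  define \<tau> where "\<tau> = \<sigma> / sqrt \<nu>"
  have \<tau>: "\<tau> > 0" "\<tau>\<^sup>2 = \<sigma>\<^sup>2 / \<nu>" using \<nu> \<sigma> by (auto simp: \<tau>_def power_divide)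
  define c where "c = (y - a) / of_real \<nu>"
  let ?g = "\<lambda>u :: complex. exp (- ((norm u)\<^sup>2 / \<tau>\<^sup>2))"
  have Em: "E \<in> borel_measurable borel" unfolding E_def by measurable
  have a: "a + (c + u) * of_real \<nu> = y + u * of_real \<nu>" for u
    using \<nu> by (simp add: c_def field_simps)
  have Ec: "E (c + u) = ?g u" for u
  proof -
    have "a + (c + u) * of_real \<nu> - y = u * of_real \<nu>" by (simp add: a)
    then show ?thesis using \<nu> \<sigma>
      unfolding E_def \<tau>(2) by (simp only:) (simp add: norm_mult power_mult_distrib field_simps power2_eq_square)
  qed
  have I0: "(\<integral>\<^sup>+u. ennreal (?g u) \<partial>lborel) = ennreal (pi * \<tau>\<^sup>2)"
    and I2: "(\<integral>\<^sup>+u. ennreal ((norm u)\<^sup>2 * ?g u) \<partial>lborel) = ennreal (pi * \<tau>\<^sup>2 * \<tau>\<^sup>2)"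
    using complex_gaussian_moments[OF \<tau>(1)] by auto
  have rhs: "(\<integral>\<^sup>+s. ennreal ((if a + s * of_real \<nu> = 0 then 0 else 1) * E s) \<partial>lborel) = ennreal (pi * \<tau>\<^sup>2)"
  proof -
    have "AE s in lborel. s \<noteq> - a / of_real \<nu>"
      by (rule AE_lborel_singleton)
    then have "AE s in lborel. ennreal ((if a + s * of_real \<nu> = 0 then 0 else 1) * E s) = ennreal (E s)"
      by eventually_elim (use \<nu> in \<open>auto simp: field_simps add_eq_0_iff\<close>)
    then have "(\<integral>\<^sup>+s. ennreal ((if a + s * of_real \<nu> = 0 then 0 else 1) * E s) \<partial>lborel) = (\<integral>\<^sup>+s. ennreal (E s) \<partial>lborel)"
      by (rule nn_integral_cong_AE)
    also have "\<dots> = (\<integral>\<^sup>+u. ennreal (E (c + u)) \<partial>lborel)"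
      using Em by (intro nn_integral_lborel_shift[symmetric]) measurable
    finally show ?thesis by (simp only: Ec I0)
  qed
  let ?h = "\<lambda>u. ennreal ((norm (y + u * of_real \<nu>))\<^sup>2 * ?g u)"
  have "(\<integral>\<^sup>+s. ennreal ((norm (a + s * of_real \<nu>))\<^sup>2 * E s) \<partial>lborel)
      = (\<integral>\<^sup>+u. ennreal ((norm (a + (c + u) * of_real \<nu>))\<^sup>2 * E (c + u)) \<partial>lborel)"
    using Em by (intro nn_integral_lborel_shift[symmetric]) measurable
  also have "\<dots> = (\<integral>\<^sup>+u. ?h u \<partial>lborel)" by (simp only: a Ec)
  finally have lhs: "(\<integral>\<^sup>+s. ennreal ((norm (a + s * of_real \<nu>))\<^sup>2 * E s) \<partial>lborel) = (\<integral>\<^sup>+u. ?h u \<partial>lborel)" .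
  \<comment> \<open>Averaging over \<open>u\<close> and \<open>- u\<close> replaces the vanishing of
    the cross term by the parallelogram law, which keeps all integrands nonnegative.\<close>
  have "2 * (\<integral>\<^sup>+u. ?h u \<partial>lborel) = (\<integral>\<^sup>+u. ?h u \<partial>lborel) + (\<integral>\<^sup>+u. ?h (- u) \<partial>lborel)"
    by (subst nn_integral_lborel_uminus) (measurable, simp add: mult_2)
  also have "\<dots> = (\<integral>\<^sup>+u. ?h u + ?h (- u) \<partial>lborel)"
    by (rule nn_integral_add[symmetric]) measurable
  also have "\<dots> = (\<integral>\<^sup>+u. ennreal (2 * \<nu>\<^sup>2) * ennreal ((norm u)\<^sup>2 * ?g u) + ennreal (2 * (norm y)\<^sup>2) * ennreal (?g u) \<partial>lborel)"
  proof (rule nn_integral_cong)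
    fix u :: complex
    have "(norm (y + u * of_real \<nu>))\<^sup>2 + (norm (y + - u * of_real \<nu>))\<^sup>2 = 2 * \<nu>\<^sup>2 * (norm u)\<^sup>2 + 2 * (norm y)\<^sup>2"
      by (simp add: cmod_power2) (simp add: power2_eq_square algebra_simps)
    then have "(norm (y + u * of_real \<nu>))\<^sup>2 * ?g u + (norm (y + - u * of_real \<nu>))\<^sup>2 * ?g u = 2 * \<nu>\<^sup>2 * ((norm u)\<^sup>2 * ?g u) + 2 * (norm y)\<^sup>2 * ?g u"
      by (simp add: distrib_right[symmetric] mult.assoc[symmetric])
    then show "?h u + ?h (- u) = ennreal (2 * \<nu>\<^sup>2) * ennreal ((norm u)\<^sup>2 * ?g u) + ennreal (2 * (norm y)\<^sup>2) * ennreal (?g u)"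
      by (simp add: ennreal_plus[symmetric] ennreal_mult[symmetric] del: ennreal_plus)
  qed
  also have "\<dots> = ennreal (2 * \<nu>\<^sup>2) * ennreal (pi * \<tau>\<^sup>2 * \<tau>\<^sup>2) + ennreal (2 * (norm y)\<^sup>2) * ennreal (pi * \<tau>\<^sup>2)"
    by (subst nn_integral_add) (measurable, simp add: nn_integral_cmult I0 I2)
  also have "\<dots> = 2 * (ennreal (\<sigma>\<^sup>2 * \<nu> + (norm y)\<^sup>2) * ennreal (pi * \<tau>\<^sup>2))"
  proof -
    have "\<sigma>\<^sup>2 = \<nu> * \<tau>\<^sup>2" using \<tau>(2) \<nu> by simp
    then have "2 * \<nu>\<^sup>2 * (pi * \<tau>\<^sup>2 * \<tau>\<^sup>2) + 2 * (norm y)\<^sup>2 * (pi * \<tau>\<^sup>2) = 2 * ((\<sigma>\<^sup>2 * \<nu> + (norm y)\<^sup>2) * (pi * \<tau>\<^sup>2))"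
      by (simp add: algebra_simps power2_eq_square)
    then show ?thesis using \<nu>
      by (simp add: ennreal_plus[symmetric] ennreal_mult[symmetric] ennreal_numeral[symmetric] del: ennreal_plus ennreal_numeral)
  qed
  finally have "(\<integral>\<^sup>+u. ?h u \<partial>lborel) = ennreal (\<sigma>\<^sup>2 * \<nu> + (norm y)\<^sup>2) * ennreal (pi * \<tau>\<^sup>2)"
    by (simp add: ennreal_mult_cancel_left)
  then show ?thesis by (simp only: lhs rhs)
qed

subsection \<open>One equation, conditioned on vanishing at a point\<close>

text \<open>The exponent of \<open>z_0 ^ d\<close>, which is the constant 1 in the chart: changing
  its coefficient moves the values in the chart by a constant and leaves the derivatives along the
  chart alone.\<close>

definition const_index :: "nat \<Rightarrow> 'n::finite option \<Rightarrow> nat" where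
  "const_index d = (\<lambda>v. if v = None then d else 0)"

lemma const_index_multi [simp]: "const_index d \<in> multi_indices d"
  by (simp add: const_index_def multi_indices_def)

lemma mon_const_index: "mon (const_index d) x = x $ None ^ d"
  by (simp add: mon_def const_index_def if_distrib[of "\<lambda>k. _ ^ k"] cong: if_cong)

lemma dmon_const_index_emb: "dmon (const_index d) x (emb w) = 0"
  unfolding dmon_def by (rule sum.neutral) (auto simp: const_index_def emb_def split: option.split)

definition weyl_sq :: "nat \<Rightarrow> 'n::finite hpoly \<Rightarrow> real" where
  "weyl_sq d p = (\<Sum>\<alpha>\<in>multi_indices d. (norm (p \<alpha>))\<^sup>2 / multinom d \<alpha>)"

lemma multinom_nz [simp]: "multinom d \<alpha> \<noteq> 0"
  by (metis less_irrefl multinom_pos)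

lemma weyl_inner_self: "Re (weyl_inner d p p) = weyl_sq d p"
proof -
  have "p \<alpha> * cnj (p \<alpha>) * of_real r = of_real ((norm (p \<alpha>))\<^sup>2 * r)" for \<alpha> r
    by (simp only: of_real_mult complex_norm_square)
  then have "weyl_inner d p p = of_real (weyl_sq d p)"
    unfolding weyl_inner_def weyl_sq_def by (simp only: of_real_sum divide_inverse)
  then show ?thesis by simp
qed

lemma weyl_inner_add_left: "weyl_inner d (\<lambda>\<alpha>. p \<alpha> + q \<alpha>) r = weyl_inner d p r + weyl_inner d q r"
  and weyl_inner_add_right: "weyl_inner d r (\<lambda>\<alpha>. p \<alpha> + q \<alpha>) = weyl_inner d r p + weyl_inner d r q"
  and weyl_inner_diff_left: "weyl_inner d (\<lambda>\<alpha>. p \<alpha> - q \<alpha>) r = weyl_inner d p r - weyl_inner d q r"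
  and weyl_inner_scale_left: "weyl_inner d (\<lambda>\<alpha>. s * p \<alpha>) r = s * weyl_inner d p r"
  and weyl_inner_scale_right: "weyl_inner d r (\<lambda>\<alpha>. s * p \<alpha>) = cnj s * weyl_inner d r p"
  by (simp_all add: weyl_inner_def algebra_simps sum.distrib sum_subtractf sum_distrib_left)

lemma weyl_inner_cnj: "cnj (weyl_inner d p q) = weyl_inner d q p"
  by (simp add: weyl_inner_def mult_ac)

text \<open>Orthogonal projection of the chart direction \<open>w\<close> to the Hermitian
  complement of \<open>pt z\<close>.\<close>

definition tangent :: "complex ^ 'n::finite \<Rightarrow> complex ^ 'n \<Rightarrow> 'n point" where
  "tangent z w = emb w - (dot (emb w) (cnjv (pt z)) / of_real ((norm (pt z))\<^sup>2)) *s pt z"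

lemma dot_tangent: "dot (tangent z w) (cnjv (pt z)) = 0"
  by (simp add: tangent_def dot_diff_left dot_scale_left dot_cnj_self)

text \<open>By Euler's identity the component along \<open>pt z\<close> contributes a multiple of
  the value of \<open>p\<close>. Hence for polynomials vanishing at \<open>pt z\<close> the chart
  direction and its projection have the same derivative.\<close>

lemma deriv_hpoly_tangent:
  "deriv_hpoly d p (pt z) (emb w) = deriv_hpoly d p (pt z) (tangent z w)
     + dot (emb w) (cnjv (pt z)) / of_real ((norm (pt z))\<^sup>2) * (of_nat d * eval_hpoly d p (pt z))"
proof -
  have "emb w = tangent z w + (dot (emb w) (cnjv (pt z)) / of_real ((norm (pt z))\<^sup>2)) *s pt z"
    by (simp add: tangent_def)
  then have "deriv_hpoly d p (pt z) (emb w) = deriv_hpoly d p (pt z) (tangent z w + (dot (emb w) (cnjv (pt z)) / of_real ((norm (pt z))\<^sup>2)) *s pt z)"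
    by simp
  then show ?thesis by (simp only: deriv_hpoly_add deriv_hpoly_scale deriv_hpoly_self)
qed

text \<open>The vector that represents, for the Weyl product, the derivative at \<open>pt z\<close>
  in the direction \<open>tangent z w\<close>.\<close>

definition riesz :: "nat \<Rightarrow> complex ^ 'n::finite \<Rightarrow> complex ^ 'n \<Rightarrow> 'n hpoly" where
  "riesz d z w = (\<lambda>\<alpha>. of_real (multinom d \<alpha>) * cnj (dmon \<alpha> (pt z) (tangent z w)))"

text \<open>The squared Weyl norm of \<open>riesz d z w\<close>, in the closed form that the twice
  differentiated kernel gives.\<close>

definition riesz_sq :: "nat \<Rightarrow> complex ^ 'n::finite \<Rightarrow> complex ^ 'n \<Rightarrow> real" where
  "riesz_sq d z w = real d * (norm (pt z)) ^ (2 * (d - 1)) * (norm (tangent z w))\<^sup>2"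

lemma weyl_inner_riesz: "weyl_inner d p (riesz d z w) = deriv_hpoly d p (pt z) (tangent z w)"
proof -
  have "p \<alpha> * cnj (of_real (multinom d \<alpha>) * cnj u) * of_real (inverse (multinom d \<alpha>)) = p \<alpha> * u" for \<alpha> u
    by (simp add: field_simps)
  then show ?thesis by (simp only: weyl_inner_def riesz_def deriv_hpoly_def)
qed

text \<open>The once differentiated kernel has the factor
  \<open>dot (tangent z w) (cnjv (pt z))\<close>, which is zero. So the representing vector already
  lies in the hyperplane of polynomials vanishing at \<open>pt z\<close>, and restricting the
  functional to that hyperplane does not lower its norm.\<close>

lemma eval_riesz: "eval_hpoly d (riesz d z w) (pt z) = 0"
proof -
  have "cnj (eval_hpoly d (riesz d z w) (pt z))
    = (\<Sum>\<alpha>\<in>multi_indices d. of_real (multinom d \<alpha>) * dmon \<alpha> (pt z) (tangent z w) * mon \<alpha> (cnjv (pt z)))"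
    by (simp add: eval_hpoly_mon riesz_def mon_cnj)
  also have "\<dots> = 0" by (simp add: kernel_deriv1 dot_tangent)
  finally show ?thesis by simp
qed

lemma deriv_riesz: "deriv_hpoly d (riesz d z w) (pt z) (tangent z w) = of_real (riesz_sq d z w)"
proof -
  have "cnj (deriv_hpoly d (riesz d z w) (pt z) (tangent z w))
    = (\<Sum>\<alpha>\<in>multi_indices d. of_real (multinom d \<alpha>) * dmon \<alpha> (pt z) (tangent z w) * dmon \<alpha> (cnjv (pt z)) (cnjv (tangent z w)))"
    by (simp add: deriv_hpoly_def riesz_def dmon_cnj)
  also have "\<dots> = of_real (riesz_sq d z w)"
    by (subst kernel_deriv2) (simp_all add: dot_tangent dot_cnj_self riesz_sq_def power_mult)
  finally show ?thesis by (metis complex_cnj_cnj complex_cnj_complex_of_real)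
qed

lemma riesz_sq_nonneg: "riesz_sq d z w \<ge> 0" by (simp add: riesz_sq_def)

text \<open>The oblique projection along \<open>z_0 ^ d\<close> to the polynomials vanishing at
  \<open>pt z\<close>. It is preferred to the orthogonal one because it does not disturb derivatives
  along the chart.\<close>

definition adjust :: "nat \<Rightarrow> complex ^ 'n::finite \<Rightarrow> 'n hpoly \<Rightarrow> 'n hpoly" where
  "adjust d z p = (\<lambda>\<alpha>. if \<alpha> = const_index d then p \<alpha> - eval_hpoly d p (pt z) else p \<alpha>)"

lemma eval_hpoly_add: "eval_hpoly d (\<lambda>\<alpha>. p \<alpha> + q \<alpha>) x = eval_hpoly d p x + eval_hpoly d q x"
  and deriv_hpoly_add_poly: "deriv_hpoly d (\<lambda>\<alpha>. p \<alpha> + q \<alpha>) x u = deriv_hpoly d p x u + deriv_hpoly d q x u"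
  by (simp_all add: eval_hpoly_mon deriv_hpoly_def algebra_simps sum.distrib)

lemma eval_hpoly_scale: "eval_hpoly d (\<lambda>\<alpha>. s * p \<alpha>) x = s * eval_hpoly d p x"
  and deriv_hpoly_scale_poly: "deriv_hpoly d (\<lambda>\<alpha>. s * p \<alpha>) x u = s * deriv_hpoly d p x u"
  by (simp_all add: eval_hpoly_mon deriv_hpoly_def sum_distrib_left mult_ac)

lemma eval_hpoly_single: "eval_hpoly d (\<lambda>\<alpha>. if \<alpha> = const_index d then c else 0) (pt z) = c"
  and deriv_hpoly_single: "deriv_hpoly d (\<lambda>\<alpha>. if \<alpha> = const_index d then c else 0) x (emb w) = 0"
  by (simp_all add: eval_hpoly_mon deriv_hpoly_def mon_const_index dmon_const_index_emb if_distrib[of "\<lambda>k. k * _"] cong: if_cong)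

lemma adjust_eq: "adjust d z p = (\<lambda>\<alpha>. p \<alpha> + (if \<alpha> = const_index d then - eval_hpoly d p (pt z) else 0))"
  by (auto simp: adjust_def)

lemma eval_adjust: "eval_hpoly d (adjust d z p) (pt z) = 0"
  by (simp only: adjust_eq eval_hpoly_add eval_hpoly_single) simp

lemma deriv_adjust: "deriv_hpoly d (adjust d z p) x (emb w) = deriv_hpoly d p x (emb w)"
  by (simp only: adjust_eq deriv_hpoly_add_poly deriv_hpoly_single) simp

lemma eval_hpoly_cong: "(\<And>\<alpha>. \<alpha> \<in> multi_indices d \<Longrightarrow> p \<alpha> = q \<alpha>) \<Longrightarrow> eval_hpoly d p x = eval_hpoly d q x"
  and deriv_hpoly_cong: "(\<And>\<alpha>. \<alpha> \<in> multi_indices d \<Longrightarrow> p \<alpha> = q \<alpha>) \<Longrightarrow> deriv_hpoly d p x u = deriv_hpoly d q x u"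
  and weyl_sq_cong: "(\<And>\<alpha>. \<alpha> \<in> multi_indices d \<Longrightarrow> p \<alpha> = q \<alpha>) \<Longrightarrow> weyl_sq d p = weyl_sq d q"
  by (auto simp: eval_hpoly_def deriv_hpoly_def weyl_sq_def intro!: sum.cong)

lemma weyl_sq_add_scale:
  "weyl_sq d (\<lambda>\<alpha>. q \<alpha> + s * r \<alpha>) = weyl_sq d q + 2 * Re (cnj s * weyl_inner d q r) + (norm s)\<^sup>2 * weyl_sq d r"
proof -
  have "weyl_inner d (\<lambda>\<alpha>. q \<alpha> + s * r \<alpha>) (\<lambda>\<alpha>. q \<alpha> + s * r \<alpha>)
     = weyl_inner d q q + (cnj s * weyl_inner d q r + cnj (cnj s * weyl_inner d q r)) + s * cnj s * weyl_inner d r r"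
    by (simp add: weyl_inner_add_left weyl_inner_add_right weyl_inner_scale_left weyl_inner_scale_right weyl_inner_cnj algebra_simps)
  then have "Re (weyl_inner d (\<lambda>\<alpha>. q \<alpha> + s * r \<alpha>) (\<lambda>\<alpha>. q \<alpha> + s * r \<alpha>))
     = Re (weyl_inner d q q) + 2 * Re (cnj s * weyl_inner d q r) + (norm s)\<^sup>2 * Re (weyl_inner d r r)"
    by (simp add: complex_norm_square[symmetric])
  then show ?thesis by (simp add: weyl_inner_self)
qed

lemma measurable_eval_hpoly:
  assumes [measurable]: "\<And>\<alpha>. \<alpha> \<in> multi_indices d \<Longrightarrow> (\<lambda>w. p w \<alpha>) \<in> borel_measurable N"
    and x: "\<And>v. (\<lambda>w. x w $ v) \<in> borel_measurable N"
  shows "(\<lambda>w. eval_hpoly d (p w) (x w)) \<in> borel_measurable N"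
proof -
  note x[measurable]
  show ?thesis unfolding eval_hpoly_def by measurable
qed

lemma measurable_deriv_hpoly:
  assumes [measurable]: "\<And>\<alpha>. \<alpha> \<in> multi_indices d \<Longrightarrow> (\<lambda>w. p w \<alpha>) \<in> borel_measurable N"
    and x: "\<And>v. (\<lambda>w. x w $ v) \<in> borel_measurable N" and u: "\<And>v. (\<lambda>w. u w $ v) \<in> borel_measurable N"
  shows "(\<lambda>w. deriv_hpoly d (p w) (x w) (u w)) \<in> borel_measurable N"
proof -
  note x[measurable] u[measurable]
  show ?thesis unfolding deriv_hpoly_def dmon_def by measurable
qed

lemma measurable_weyl_sq:
  assumes [measurable]: "\<And>\<alpha>. \<alpha> \<in> multi_indices d \<Longrightarrow> (\<lambda>w. p w \<alpha>) \<in> borel_measurable N"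
  shows "(\<lambda>w. weyl_sq d (p w)) \<in> borel_measurable N"
  unfolding weyl_sq_def by measurable

text \<open>
  Shifting \<open>p\<close> along the Riesz representative, corrected in the coefficient of \<open>z_0^d\<close> so that the
  free coefficient is kept, splits off a one-dimensional complex Gaussian integral.
\<close>

lemma row_second_moment:
  fixes z w :: "complex ^ 'n::finite" and phat :: "'n hpoly"
  assumes \<sigma>: "\<sigma> > 0" and d: "d > 0" and h: "h \<in> borel_measurable borel"
  defines "Y \<equiv> \<lambda>p. deriv_hpoly d p (pt z) (emb w)"
    and "Q \<equiv> \<lambda>p. exp (- (weyl_sq d (\<lambda>\<alpha>. adjust d z p \<alpha> - phat \<alpha>) / \<sigma>\<^sup>2))"
    and "yhat \<equiv> deriv_hpoly d phat (pt z) (tangent z w)"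
  shows "(\<integral>\<^sup>+p. h (p (const_index d)) * ennreal ((norm (Y p))\<^sup>2 * Q p) \<partial>hpoly_lebesgue d)
    = ennreal (\<sigma>\<^sup>2 * riesz_sq d z w + (norm yhat)\<^sup>2) *
      (\<integral>\<^sup>+p. h (p (const_index d)) * ennreal ((if Y p = 0 then 0 else 1) * Q p) \<partial>hpoly_lebesgue d)"
proof -
  let ?\<nu> = "riesz_sq d z w" and ?v = "riesz d z w"
  have coef: "(\<lambda>p. p \<alpha>) \<in> borel_measurable (hpoly_lebesgue d)" if "\<alpha> \<in> multi_indices d" for \<alpha> :: "'n option \<Rightarrow> nat"
    using that by (rule measurable_hpoly_coef)
  have Ytan: "Y p = deriv_hpoly d (adjust d z p) (pt z) (tangent z w)" for p
    unfolding Y_def using deriv_hpoly_tangent[of d "adjust d z p" z w] by (simp add: deriv_adjust eval_adjust)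
  have Y[measurable]: "Y \<in> borel_measurable (hpoly_lebesgue d)"
    unfolding Y_def by (rule measurable_deriv_hpoly) (auto intro: coef)
  have adj: "(\<lambda>p. adjust d z p \<alpha>) \<in> borel_measurable (hpoly_lebesgue d)" if "\<alpha> \<in> multi_indices d" for \<alpha>
    unfolding adjust_def using that by (cases "\<alpha> = const_index d") (auto intro!: borel_measurable_diff measurable_eval_hpoly coef)
  have Q[measurable]: "Q \<in> borel_measurable (hpoly_lebesgue d)"
  proof -
    have [measurable]: "(\<lambda>p. weyl_sq d (\<lambda>\<alpha>. adjust d z p \<alpha> - phat \<alpha>)) \<in> borel_measurable (hpoly_lebesgue d)"
      by (rule measurable_weyl_sq, rule borel_measurable_diff[OF adj borel_measurable_const])
    show ?thesis unfolding Q_def by measurable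
  qed
  show ?thesis
  proof (cases "?\<nu> = 0")
    case True
    \<comment> \<open>In this case the functional \<open>Y\<close> is identically zero and both
      integrands vanish, the right one through its nonvanishing factor.\<close>
    then have "tangent z w = 0" using d by (simp add: riesz_sq_def)
    then have "Y p = 0" for p by (simp add: Ytan)
    then show ?thesis by simp
  next
    case False
    then have \<nu>: "?\<nu> > 0" using riesz_sq_nonneg[of d z w] by simp
    \<comment> \<open>The representing vector with its coefficient of \<open>z_0 ^ d\<close>
      deleted: shifting along it keeps the argument of \<open>h\<close> fixed, and
      \<open>adjust\<close> puts the deleted coefficient back.\<close>
    define v' where "v' = (\<lambda>\<alpha>. if \<alpha> = const_index d then 0 else ?v \<alpha>)"
    define act where "act p s = hshift d p (\<lambda>\<alpha>. s * v' \<alpha>)" for p and s :: complex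
    have v'_eq: "v' = (\<lambda>\<alpha>. ?v \<alpha> + (if \<alpha> = const_index d then - ?v (const_index d) else 0))" by (auto simp: v'_def)
    have ev': "eval_hpoly d v' (pt z) = - ?v (const_index d)"
      by (simp only: v'_eq eval_hpoly_add eval_hpoly_single eval_riesz) simp
    have act_in: "act p s \<alpha> = p \<alpha> + s * v' \<alpha>" if "\<alpha> \<in> multi_indices d" for p s \<alpha>
      using that by (simp add: act_def hshift_def)
    have eact: "eval_hpoly d (act p s) (pt z) = eval_hpoly d p (pt z) - s * ?v (const_index d)" for p s
    proof -
      have "eval_hpoly d (act p s) (pt z) = eval_hpoly d (\<lambda>\<alpha>. p \<alpha> + s * v' \<alpha>) (pt z)"
        by (rule eval_hpoly_cong) (rule act_in)
      then show ?thesis by (simp add: eval_hpoly_add eval_hpoly_scale ev')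
    qed
    have adj_act: "adjust d z (act p s) \<alpha> = adjust d z p \<alpha> + s * ?v \<alpha>" if "\<alpha> \<in> multi_indices d" for p s \<alpha>
      using that by (auto simp: adjust_def eact act_in v'_def)
    have Yact: "Y (act p s) = Y p + s * of_real ?\<nu>" for p s
    proof -
      have "Y (act p s) = deriv_hpoly d (\<lambda>\<alpha>. adjust d z p \<alpha> + s * ?v \<alpha>) (pt z) (tangent z w)"
        unfolding Ytan by (rule deriv_hpoly_cong) (rule adj_act)
      then show ?thesis by (simp add: Ytan deriv_hpoly_add_poly deriv_hpoly_scale_poly deriv_riesz)
    qed
    have act_const: "act p s (const_index d) = p (const_index d)" for p s by (simp add: act_in v'_def)
    \<comment> \<open>The Gaussian weight of the part of \<open>adjust d z p - phat\<close>
      orthogonal to the representing vector, obtained by subtracting the squared length of the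
      component along it. This part is constant on the orbits of the shift.\<close>
    define R where "R p = exp (- ((weyl_sq d (\<lambda>\<alpha>. adjust d z p \<alpha> - phat \<alpha>) - (norm (Y p - yhat))\<^sup>2 / ?\<nu>) / \<sigma>\<^sup>2))" for p
    have R[measurable]: "R \<in> borel_measurable (hpoly_lebesgue d)"
    proof -
      have [measurable]: "(\<lambda>p. weyl_sq d (\<lambda>\<alpha>. adjust d z p \<alpha> - phat \<alpha>)) \<in> borel_measurable (hpoly_lebesgue d)"
        by (rule measurable_weyl_sq, rule borel_measurable_diff[OF adj borel_measurable_const])
      show ?thesis unfolding R_def by measurable
    qed
    have Rpos: "R p \<ge> 0" for p by (simp add: R_def)
    have QR: "Q p = R p * exp (- ((norm (Y p - yhat))\<^sup>2 / (?\<nu> * \<sigma>\<^sup>2)))" for p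
      unfolding Q_def R_def exp_add[symmetric] using \<nu> \<sigma> by (simp add: field_simps)
    have Ract: "R (act p s) = R p" for p s
    proof -
      let ?q = "\<lambda>\<alpha>. adjust d z p \<alpha> - phat \<alpha>"
      have 1: "weyl_sq d (\<lambda>\<alpha>. adjust d z (act p s) \<alpha> - phat \<alpha>) = weyl_sq d (\<lambda>\<alpha>. ?q \<alpha> + s * ?v \<alpha>)"
        by (rule weyl_sq_cong) (simp add: adj_act)
      have 2: "weyl_inner d ?q ?v = Y p - yhat"
        by (simp add: weyl_inner_diff_left weyl_inner_riesz Ytan yhat_def)
      have 3: "weyl_sq d ?v = ?\<nu>"
        unfolding weyl_inner_self[symmetric] weyl_inner_riesz deriv_riesz by simp
      have 4: "(norm (Y p - yhat + s * of_real ?\<nu>))\<^sup>2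
         = (norm (Y p - yhat))\<^sup>2 + ?\<nu> * (2 * Re (cnj s * (Y p - yhat)) + (norm s)\<^sup>2 * ?\<nu>)" for Yp
        by (simp add: cmod_power2) (simp add: power2_eq_square algebra_simps)
      have "(norm (Y (act p s) - yhat))\<^sup>2 / ?\<nu> = (norm (Y p - yhat))\<^sup>2 / ?\<nu> + (2 * Re (cnj s * (Y p - yhat)) + (norm s)\<^sup>2 * ?\<nu>)"
      proof -
        have "Y (act p s) - yhat = Y p - yhat + s * of_real ?\<nu>" by (simp add: Yact)
        then show ?thesis using \<nu> by (simp only: 4) (simp add: field_simps)
      qed
      then show ?thesis unfolding R_def 1 weyl_sq_add_scale 2 3 by simp
    qed
    \<comment> \<open>Stated for a general function of \<open>Y\<close> because it is applied twice,
      to the squared modulus and to the nonvanishing factor. The equivariant coordinate is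
      \<open>Y / \<nu>\<close>, since a shift by \<open>s\<close> adds \<open>s * \<nu>\<close> to
      \<open>Y\<close>.\<close>
    have split: "(\<integral>\<^sup>+p. h (p (const_index d)) * ennreal (\<phi> (Y p) * Q p) \<partial>hpoly_lebesgue d)
      = (\<integral>\<^sup>+p. indicator (cbox 0 One) (Y p / of_real ?\<nu>) * (h (p (const_index d)) * ennreal (R p) *
          (\<integral>\<^sup>+s. ennreal (\<phi> (Y p + s * of_real ?\<nu>) * exp (- ((norm (Y p + s * of_real ?\<nu> - yhat))\<^sup>2 / (?\<nu> * \<sigma>\<^sup>2)))) \<partial>lborel)) \<partial>hpoly_lebesgue d)"
      if \<phi>[measurable]: "\<phi> \<in> borel_measurable borel" and pos: "\<And>y. \<phi> y \<ge> 0" for \<phi> :: "complex \<Rightarrow> real"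
    proof -
      let ?\<Phi> = "\<lambda>p. h (p (const_index d)) * ennreal (\<phi> (Y p) * Q p)"
      note h[measurable]
      have hm[measurable]: "(\<lambda>p :: 'n hpoly. h (p (const_index d))) \<in> borel_measurable (hpoly_lebesgue d)"
        by (rule measurable_compose[OF coef[OF const_index_multi] h])
      have "(\<integral>\<^sup>+p. ?\<Phi> p \<partial>hpoly_lebesgue d)
         = (\<integral>\<^sup>+p. indicator (cbox 0 One) (Y p / of_real ?\<nu>) * (\<integral>\<^sup>+s. ?\<Phi> (act p s) \<partial>lborel) \<partial>hpoly_lebesgue d)"
      proof (rule nn_integral_slice[OF sigma_finite_hpoly_lebesgue])
        show "(\<lambda>(p, s). act p s) \<in> measurable (hpoly_lebesgue d \<Otimes>\<^sub>M borel) (hpoly_lebesgue d)"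
          unfolding act_def case_prod_beta by (rule measurable_hshift) auto
        fix p :: "'n hpoly" and s assume "p \<in> space (hpoly_lebesgue d)"
        then show "act (act p s) (- s) = p"
          by (auto simp: space_hpoly_lebesgue hpolys_def act_def hshift_def fun_eq_iff PiE_iff extensional_def)
        show "Y (act p s) / of_real ?\<nu> = Y p / of_real ?\<nu> + s"
          using \<nu> by (simp add: Yact add_divide_distrib)
      qed (auto simp: act_def distr_hshift)
      also have "\<dots> = (\<integral>\<^sup>+p. indicator (cbox 0 One) (Y p / of_real ?\<nu>) * (h (p (const_index d)) * ennreal (R p) *
          (\<integral>\<^sup>+s. ennreal (\<phi> (Y p + s * of_real ?\<nu>) * exp (- ((norm (Y p + s * of_real ?\<nu> - yhat))\<^sup>2 / (?\<nu> * \<sigma>\<^sup>2)))) \<partial>lborel)) \<partial>hpoly_lebesgue d)"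
      proof (intro nn_integral_cong arg_cong2[where f = "(*)"] refl)
        fix p
        have "?\<Phi> (act p s) = h (p (const_index d)) * ennreal (R p) *
           ennreal (\<phi> (Y p + s * of_real ?\<nu>) * exp (- ((norm (Y p + s * of_real ?\<nu> - yhat))\<^sup>2 / (?\<nu> * \<sigma>\<^sup>2))))" for s
          using pos by (simp add: act_const QR Ract Yact ennreal_mult Rpos mult_ac)
        then show "(\<integral>\<^sup>+s. ?\<Phi> (act p s) \<partial>lborel) = h (p (const_index d)) * ennreal (R p) *
          (\<integral>\<^sup>+s. ennreal (\<phi> (Y p + s * of_real ?\<nu>) * exp (- ((norm (Y p + s * of_real ?\<nu> - yhat))\<^sup>2 / (?\<nu> * \<sigma>\<^sup>2)))) \<partial>lborel)"
          by (simp only:) (rule nn_integral_cmult, measurable)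
      qed
      finally show ?thesis .
    qed
    have m2: "(\<lambda>y :: complex. if y = 0 then 0 else 1 :: real) \<in> borel_measurable borel" by measurable
    let ?c = "ennreal (\<sigma>\<^sup>2 * ?\<nu> + (norm yhat)\<^sup>2)"
    have hm[measurable]: "(\<lambda>p :: 'n hpoly. h (p (const_index d))) \<in> borel_measurable (hpoly_lebesgue d)"
      by (rule measurable_compose[OF coef[OF const_index_multi] h])
    let ?W = "\<lambda>p. indicator (cbox 0 One) (Y p / of_real ?\<nu>) * (h (p (const_index d)) * ennreal (R p) *
          (\<integral>\<^sup>+s. ennreal ((if Y p + s * of_real ?\<nu> = 0 then 0 else 1) * exp (- ((norm (Y p + s * of_real ?\<nu> - yhat))\<^sup>2 / (?\<nu> * \<sigma>\<^sup>2)))) \<partial>lborel))"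
    have "(\<integral>\<^sup>+p. h (p (const_index d)) * ennreal ((norm (Y p))\<^sup>2 * Q p) \<partial>hpoly_lebesgue d) = (\<integral>\<^sup>+p. ?c * ?W p \<partial>hpoly_lebesgue d)"
    proof (subst split)
      show "(\<lambda>a :: complex. (norm a)\<^sup>2) \<in> borel_measurable borel" by measurable
    qed (simp_all only: gaussian_second_moment[OF \<nu> \<sigma>] mult_ac zero_le_power2)
    also have "\<dots> = ?c * (\<integral>\<^sup>+p. ?W p \<partial>hpoly_lebesgue d)"
      by (rule nn_integral_cmult) measurable
    also have "(\<integral>\<^sup>+p. ?W p \<partial>hpoly_lebesgue d) = (\<integral>\<^sup>+p. h (p (const_index d)) * ennreal ((if Y p = 0 then 0 else 1) * Q p) \<partial>hpoly_lebesgue d)"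
      by (rule split[OF m2, symmetric]) simp
    finally show ?thesis .
  qed
qed

subsection \<open>Linear isometries and complex determinants\<close>

text \<open>A bijection between the two orthonormal bases extends linearly. It carries the area
  formula from real coordinate space to complex vectors without a constant.\<close>

lemma euclidean_isometry_lborel:
  assumes dim: "DIM('a::euclidean_space) = DIM('b::euclidean_space)"
  obtains \<psi> :: "'a::euclidean_space \<Rightarrow> 'b::euclidean_space" and \<psi>' :: "'b \<Rightarrow> 'a"
  where "linear \<psi>" "linear \<psi>'" "\<And>x. \<psi>' (\<psi> x) = x" "\<And>y. \<psi> (\<psi>' y) = y"
    "\<And>x. norm (\<psi> x) = norm x" "distr lborel borel \<psi> = lborel"
proof -
  obtain p where p: "bij_betw p (Basis :: 'a set) (Basis :: 'b set)"
    using dim finite_same_card_bij[of "Basis :: 'a set" "Basis :: 'b set"] by auto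
  define \<psi> :: "'a \<Rightarrow> 'b" where "\<psi> x = (\<Sum>b\<in>Basis. (x \<bullet> b) *\<^sub>R p b)" for x
  define \<psi>' :: "'b \<Rightarrow> 'a" where "\<psi>' y = (\<Sum>b\<in>Basis. (y \<bullet> p b) *\<^sub>R b)" for y
  have pB: "p b \<in> Basis" if "b \<in> Basis" for b using p that by (auto simp: bij_betw_def)
  have pinj: "p b = p c \<longleftrightarrow> b = c" if "b \<in> Basis" "c \<in> Basis" for b c
    using p that by (auto simp: bij_betw_def inj_on_def)
  have inner1: "\<psi> x \<bullet> p c = x \<bullet> c" if "c \<in> Basis" for x c
  proof -
    have "\<psi> x \<bullet> p c = (\<Sum>b\<in>Basis. if b = c then x \<bullet> b else 0)"
      unfolding \<psi>_def inner_sum_left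
      by (rule sum.cong) (auto simp: inner_Basis pB that pinj)
    then show ?thesis using that by simp
  qed
  have inner2: "\<psi>' y \<bullet> c = y \<bullet> p c" if "c \<in> Basis" for y c
    unfolding \<psi>'_def using that by (simp add: inner_sum_left inner_Basis if_distrib cong: if_cong)
  have 1: "\<psi>' (\<psi> x) = x" for x
    by (rule euclidean_eqI) (simp add: inner1 inner2)
  have 2: "\<psi> (\<psi>' y) = y" for y
  proof (rule euclidean_eqI)
    fix c :: 'b assume "c \<in> Basis"
    then obtain b where "b \<in> Basis" "c = p b" using p by (auto simp: bij_betw_def)
    then show "\<psi> (\<psi>' y) \<bullet> c = y \<bullet> c" by (simp add: inner1 inner2)
  qed
  have lin: "linear \<psi>" "linear \<psi>'"
    unfolding \<psi>_def \<psi>'_def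
    by (auto intro!: linearI simp: inner_add_left sum.distrib scaleR_add_left scaleR_sum_right)
  have nrm: "norm (\<psi> x) = norm x" for x
  proof -
    have "(\<psi> x \<bullet> \<psi> x) = (\<Sum>b\<in>Basis. (\<psi> x \<bullet> b) * (\<psi> x \<bullet> b))"
      by (rule euclidean_inner)
    also have "\<dots> = (\<Sum>b\<in>Basis. (\<psi> x \<bullet> p b) * (\<psi> x \<bullet> p b))"
      using sum.reindex_bij_betw[OF p, of "\<lambda>b. (\<psi> x \<bullet> b) * (\<psi> x \<bullet> b)"] by simp
    also have "\<dots> = x \<bullet> x"
      by (subst (3) euclidean_inner) (simp add: inner1)
    finally show ?thesis by (simp add: norm_eq_sqrt_inner)
  qed
  have meas: "\<psi> \<in> borel_measurable borel"
    using lin by (simp add: borel_measurable_continuous_onI linear_continuous_on linear_conv_bounded_linear)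
  have "lborel = distr lborel borel \<psi>"
  proof (rule lborel_eqI)
    fix l u :: 'b assume le: "\<And>b. b \<in> Basis \<Longrightarrow> l \<bullet> b \<le> u \<bullet> b"
    have eq: "\<psi> -` box l u = box (\<psi>' l) (\<psi>' u)"
    proof -
      have "x \<in> \<psi> -` box l u \<longleftrightarrow> (\<forall>c\<in>Basis. l \<bullet> p c < x \<bullet> c \<and> x \<bullet> c < u \<bullet> p c)" for x
      proof -
        have "x \<in> \<psi> -` box l u \<longleftrightarrow> (\<forall>c\<in>p ` Basis. l \<bullet> c < \<psi> x \<bullet> c \<and> \<psi> x \<bullet> c < u \<bullet> c)"
          using p by (simp add: mem_box bij_betw_def)
        then show ?thesis by (simp add: inner1)
      qed
      then show ?thesis by (auto simp: mem_box inner2)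
    qed
    have "emeasure (distr lborel borel \<psi>) (box l u) = emeasure lborel (box (\<psi>' l) (\<psi>' u))"
      using meas by (subst emeasure_distr) (auto simp: eq)
    also have "\<dots> = (\<Prod>b\<in>Basis. (\<psi>' u - \<psi>' l) \<bullet> b)"
      by (subst emeasure_lborel_box) (auto simp: inner2 le pB)
    also have "(\<Prod>b\<in>Basis. (\<psi>' u - \<psi>' l) \<bullet> b) = (\<Prod>b\<in>Basis. (u - l) \<bullet> p b)"
      by (rule prod.cong) (auto simp: inner2 inner_diff_left)
    also have "\<dots> = (\<Prod>b\<in>Basis. (u - l) \<bullet> b)"
      using prod.reindex_bij_betw[OF p, of "\<lambda>b. (u - l) \<bullet> b"] by simp
    finally show "emeasure (distr lborel borel \<psi>) (box l u) = (\<Prod>b\<in>Basis. (u - l) \<bullet> b)" .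
  qed simp
  with 1 2 lin nrm show thesis by (intro that) auto
qed

text \<open>An elementary matrix: multiplication by it on the right scales column \<open>i\<close>
  by \<open>b $ i\<close> and adds \<open>b $ j\<close> times the old column \<open>i\<close> to
  every other column \<open>j\<close>.\<close>

definition single_row :: "'n::finite \<Rightarrow> 'a::comm_ring_1 ^ 'n \<Rightarrow> 'a ^ 'n ^ 'n" where
  "single_row i b = (\<chi> k. if k = i then b else axis k 1)"

lemma matrix_mult_single_row:
  "(A ** single_row i b) $ k = (\<chi> j. (if j = i then 0 else A $ k $ j) + A $ k $ i * b $ j)"
proof -
  have "(\<Sum>l\<in>UNIV. A $ k $ l * (if l = i then b else axis l 1) $ j)
     = (if j = i then 0 else A $ k $ j) + A $ k $ i * b $ j" for j
  proof -
    have "(\<Sum>l\<in>UNIV. A $ k $ l * (if l = i then b else axis l 1) $ j)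
      = A $ k $ i * b $ j + (\<Sum>l\<in>UNIV - {i}. A $ k $ l * (if l = j then 1 else 0))"
      by (subst sum.remove[of _ i]) (auto intro!: sum.cong simp: axis_def eq_commute)
    also have "(\<Sum>l\<in>UNIV - {i}. A $ k $ l * (if l = j then 1 else 0)) = (if j = i then 0 else A $ k $ j)"
      by (auto simp: if_distrib cong: if_cong)
    finally show ?thesis by (simp add: add.commute)
  qed
  then show ?thesis by (simp add: matrix_matrix_mult_def single_row_def vec_eq_iff)
qed

text \<open>
  A multiplicative map on invertible complex matrices is determined by its values on diagonal
  matrices and coordinate swaps: the shears die because each is conjugate to its inverse.
\<close>

locale det_multiplicative =
  fixes \<phi> :: "complex ^ 'n::finite ^ 'n \<Rightarrow> real"
  assumes mult: "\<And>A B. det A \<noteq> 0 \<Longrightarrow> det B \<noteq> 0 \<Longrightarrow> \<phi> (A ** B) = \<phi> A * \<phi> B"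
    and pos: "\<And>A. det A \<noteq> 0 \<Longrightarrow> \<phi> A > 0"
    and unit_diag: "\<And>u. (\<And>i. norm (u i) = 1) \<Longrightarrow> \<phi> (\<chi> i j. if i = j then u i else 0) = 1"
    and scalar: "\<And>r. r > 0 \<Longrightarrow> \<phi> (\<chi> i j. if i = j then complex_of_real r else 0) = 1"
begin

lemma one: "\<phi> (mat 1) = 1"
  using unit_diag[of "\<lambda>_. 1"] by (simp add: mat_def)

lemma involution:
  assumes "A ** A = mat 1" shows "\<phi> A = 1"
proof -
  have "det A * det A = 1" using assms by (metis det_I det_mul)
  then have nz: "det A \<noteq> 0" by auto
  have "\<phi> A * \<phi> A = 1" using mult[OF nz nz] assms one by simp
  with pos[OF nz] show ?thesis by (metis abs_of_pos mult_eq_0_iff one_power2 power2_eq_square real_sqrt_abs real_sqrt_one)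
qed

abbreviation diag_mat :: "('n \<Rightarrow> complex) \<Rightarrow> complex ^ 'n ^ 'n"
  where "diag_mat u \<equiv> (\<chi> i j. if i = j then u i else 0)"

lemma diag_mat_mult: "diag_mat u ** diag_mat v = diag_mat (\<lambda>i. u i * v i)"
  by (simp add: matrix_matrix_mult_def vec_eq_iff if_distrib[of "\<lambda>x. x * _"] cong: if_cong)

lemma det_diag_mat: "det (diag_mat u) = (\<Prod>i\<in>UNIV. u i)"
  by (subst det_diagonal) auto

definition swap_mat :: "'n \<Rightarrow> 'n \<Rightarrow> complex ^ 'n ^ 'n"
  where "swap_mat i k = (\<chi> a b. if a = Transposition.transpose i k b then 1 else 0)"

lemma mult_swap_mat: "(A ** swap_mat i k) $ a $ b = A $ a $ Transposition.transpose i k b"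
  by (simp add: matrix_matrix_mult_def swap_mat_def if_distrib[of "\<lambda>x. _ * x"] cong: if_cong)

lemma swap_mat_self: "swap_mat i k ** swap_mat i k = mat 1"
  by (simp add: vec_eq_iff mult_swap_mat) (simp add: swap_mat_def mat_def)

lemma swap_mat_diag_mat: "swap_mat i k ** diag_mat u ** swap_mat i k = diag_mat (\<lambda>a. u (Transposition.transpose i k a))"
proof -
  have "(swap_mat i k ** diag_mat u) $ a $ b = (if a = Transposition.transpose i k b then u b else 0)" for a b
    by (simp add: matrix_matrix_mult_def swap_mat_def if_distrib[of "\<lambda>x. _ * x"] if_distrib[of "\<lambda>x. x * _"] cong: if_cong)
  then show ?thesis
    by (auto simp: vec_eq_iff mult_swap_mat)
qed

lemma det_swap_mat: "det (swap_mat i k) \<noteq> 0" "\<phi> (swap_mat i k) = 1"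
proof -
  have "det (swap_mat i k) * det (swap_mat i k) = 1" using swap_mat_self by (metis det_I det_mul)
  then show "det (swap_mat i k) \<noteq> 0" by auto
qed (rule involution[OF swap_mat_self])

text \<open>Swaps conjugate the dilations of the single coordinates into one another, so they share
  one value of \<open>\<phi>\<close>. Their product over all coordinates is a scalar matrix, where
  \<open>\<phi>\<close> is 1, and 1 has only one positive root.\<close>

lemma single_real:
  assumes r: "r > 0"
  shows "\<phi> (diag_mat (\<lambda>a. if a = i then complex_of_real r else 1)) = 1"
proof -
  let ?S = "\<lambda>i. diag_mat (\<lambda>a. if a = i then complex_of_real r else 1)"
  have nz: "det (?S k) \<noteq> 0" for k using r by (simp add: det_diag_mat)
  have eq: "\<phi> (?S k) = \<phi> (?S i)" for k
  proof -
    have "?S k = swap_mat i k ** ?S i ** swap_mat i k"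
      unfolding swap_mat_diag_mat by (auto simp: vec_eq_iff Transposition.transpose_def)
    then have "\<phi> (?S k) = \<phi> (swap_mat i k) * \<phi> (?S i) * \<phi> (swap_mat i k)"
      by (simp add: mult nz det_swap_mat det_mul)
    then show ?thesis by (simp add: det_swap_mat)
  qed
  have "\<phi> (diag_mat (\<lambda>a. if a \<in> T then complex_of_real r else 1)) = \<phi> (?S i) ^ card T" if "finite T" for T
    using that
  proof (induction T)
    case empty
    then show ?case using unit_diag[of "\<lambda>_. 1"] by (simp cong: if_cong)
  next
    case (insert k T)
    have "diag_mat (\<lambda>a. if a \<in> insert k T then complex_of_real r else 1)
        = diag_mat (\<lambda>a. if a \<in> T then complex_of_real r else 1) ** ?S k"
      unfolding diag_mat_mult using insert by (auto simp: vec_eq_iff)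
    moreover have "det (diag_mat (\<lambda>a. if a \<in> T then complex_of_real r else 1)) \<noteq> 0"
      using r by (simp add: det_diag_mat)
    ultimately show ?case using insert eq[of k] by (simp add: mult nz)
  qed
  from this[of UNIV] have *: "\<phi> (?S i) ^ CARD('n) = 1 ^ CARD('n)"
    using scalar[OF r] by (simp cong: if_cong)
  show ?thesis
    by (rule power_eq_imp_eq_base[OF * less_imp_le[OF pos[OF nz]]]) simp_all
qed

lemma single:
  assumes c: "c \<noteq> 0"
  shows "\<phi> (diag_mat (\<lambda>a. if a = i then c else 1)) = 1"
proof -
  have "diag_mat (\<lambda>a. if a = i then c else 1) = diag_mat (\<lambda>a. if a = i then complex_of_real (norm c) else 1) ** diag_mat (\<lambda>a. if a = i then sgn c else 1)"
    unfolding diag_mat_mult by (auto simp: vec_eq_iff sgn_eq c)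
  moreover have "\<phi> (diag_mat (\<lambda>a. if a = i then sgn c else 1)) = 1"
    by (rule unit_diag) (auto simp: norm_sgn c)
  moreover have "\<phi> (diag_mat (\<lambda>a. if a = i then complex_of_real (norm c) else 1)) = 1"
    using c by (intro single_real) auto
  ultimately show ?thesis
    by (simp add: mult det_diag_mat c sgn_zero_iff)
qed

lemma single_row_inverse:
  assumes "b $ i \<noteq> (0::complex)"
  shows "single_row i b ** single_row i (\<chi> j. if j = i then 1 / b $ i else - b $ j / b $ i) = mat 1"
  using assms unfolding vec_eq_iff matrix_mult_single_row
  by (auto simp: single_row_def mat_def axis_def)

lemma det_single_row:
  assumes "b $ i \<noteq> (0::complex)" shows "det (single_row i b) \<noteq> 0"
  using single_row_inverse[OF assms] by (metis det_I det_mul mult_zero_left zero_neq_one)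

lemma single_row_one:
  assumes b: "b $ i \<noteq> 0" shows "\<phi> (single_row i b) = 1"
proof -
  \<comment> \<open>Scaling the pivot to 1 leaves the shear \<open>b1\<close>. Its inverse
    \<open>b2\<close> negates the off-pivot entries, and so does conjugation by the diagonal matrix
    with -1 in place \<open>i\<close>.\<close>
  define b1 where "b1 = (\<chi> j. b $ j / b $ i)"
  define b2 where "b2 = (\<chi> j. if j = i then 1 else - b1 $ j)"
  let ?D = "\<lambda>c. diag_mat (\<lambda>a. if a = i then c else 1)"
  have i1: "b1 $ i = 1" "b2 $ i = 1" using b by (simp_all add: b1_def b2_def)
  have left: "(?D c ** A) $ a = (if a = i then (\<chi> j. c * A $ i $ j) else A $ a)" for c A a
    by (auto simp: matrix_matrix_mult_def vec_eq_iff if_distrib[of "\<lambda>x. x * _"] cong: if_cong)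
  have right: "(A ** ?D c) $ a $ j = (if j = i then c * A $ a $ j else A $ a $ j)" for c A a j
    by (auto simp: matrix_matrix_mult_def vec_eq_iff if_distrib[of "\<lambda>x. _ * x"] cong: if_cong)
  have e1: "single_row i b = ?D (b $ i) ** single_row i b1"
    using b by (simp add: vec_eq_iff left) (simp add: single_row_def b1_def)
  have e2: "single_row i b2 = ?D (-1) ** single_row i b1 ** ?D (-1)"
    using i1 by (simp add: vec_eq_iff left right) (auto simp: single_row_def b2_def axis_def)
  have e3: "single_row i b1 ** single_row i b2 = mat 1"
    using single_row_inverse[of b1 i] i1 by (simp add: b2_def cong: if_cong)
  have nz: "det (single_row i b1) \<noteq> 0" "det (single_row i b2) \<noteq> 0" "\<And>c. c \<noteq> 0 \<Longrightarrow> det (?D c) \<noteq> 0"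
    using i1 by (auto intro!: det_single_row simp: det_diag_mat)
  have "\<phi> (single_row i b2) = \<phi> (?D (-1)) * \<phi> (single_row i b1) * \<phi> (?D (-1))"
    unfolding e2 using nz by (simp add: mult det_mul)
  then have "\<phi> (single_row i b2) = \<phi> (single_row i b1)" by (simp add: single)
  moreover have "\<phi> (single_row i b1) * \<phi> (single_row i b2) = 1"
    using e3 one nz by (metis mult)
  ultimately have "\<phi> (single_row i b1) = 1"
    using pos[OF nz(1)] by (metis abs_of_pos mult_eq_0_iff one_power2 power2_eq_square real_sqrt_abs real_sqrt_one)
  then show ?thesis unfolding e1 using nz b by (simp add: mult single)
qed

text \<open>Gaussian elimination by column operations; the induction measure counts the rows that
  are not yet unit vectors, and the step clears one row without spoiling a finished one.\<close>

lemma eq_one: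
  assumes "det A \<noteq> 0" shows "\<phi> A = 1"
  using assms
proof (induction "card {i. A $ i \<noteq> axis i 1}" arbitrary: A rule: less_induct)
  case less
  show ?case
  proof (cases "\<forall>i. A $ i = axis i 1")
    case True
    then have "A = mat 1" by (auto simp: vec_eq_iff mat_def axis_def)
    then show ?thesis using one by simp
  next
    case False
    then obtain i where i: "A $ i \<noteq> axis i 1" by auto
    \<comment> \<open>A pivot outside the finished rows exists: otherwise row \<open>i\<close> would
      be a combination of unit rows and hence be fixed by \<open>A\<close>, and
      \<open>axis i 1\<close> minus row \<open>i\<close> would be a nonzero left null
      vector.\<close>
    have "\<exists>k. A $ k \<noteq> axis k 1 \<and> A $ i $ k \<noteq> 0"
    proof (rule ccontr)
      assume "\<not> ?thesis"
      then have z: "A $ i $ k = 0" if "A $ k \<noteq> axis k 1" for k using that by blast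
      define y where "y = axis i 1 - (\<chi> k. A $ i $ k)"
      have row: "A $ i $ k * A $ k $ j = (if j = k then A $ i $ k else 0)" for k j
        using z by (cases "A $ k = axis k 1") (auto simp: axis_def)
      have "y v* A = 0"
      proof -
        have "(\<Sum>k\<in>UNIV. A $ k $ j * y $ k) = 0" for j
        proof -
          have "(\<Sum>k\<in>UNIV. A $ k $ j * y $ k) = (\<Sum>k\<in>UNIV. (if k = i then A $ k $ j else 0) - (if j = k then A $ i $ k else 0))"
            by (rule sum.cong) (auto simp: y_def axis_def right_diff_distrib row mult.commute[of _ "A $ i $ _"])
          also have "\<dots> = 0" by (simp add: sum_subtractf)
          finally show ?thesis .
        qed
        then show ?thesis by (simp add: vector_matrix_mult_def vec_eq_iff mult.commute)
      qed
      moreover obtain A' where "A ** A' = mat 1"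
        using less.prems invertible_det_nz[of A] by (auto simp: invertible_def)
      ultimately have "y = 0"
        by (metis vector_matrix_mul_assoc vector_matrix_mul_rid vector_matrix_mult_0)
      then have "A $ i = axis i 1" by (simp add: y_def vec_eq_iff)
      with i show False by simp
    qed
    then obtain k where k: "A $ k \<noteq> axis k 1" "A $ i $ k \<noteq> 0" by blast
    \<comment> \<open>The swap brings the pivot to the diagonal, and \<open>b\<close> is chosen so
      that the column operation turns row \<open>i\<close> into a unit vector. Finished rows have
      zeros in columns \<open>i\<close> and \<open>k\<close>, so they survive both
      operations.\<close>
    define A1 where "A1 = A ** swap_mat i k"
    define b where "b = (\<chi> j. if j = i then 1 / A1 $ i $ i else - A1 $ i $ j / A1 $ i $ i)"
    define A2 where "A2 = A1 ** single_row i b"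
    have A1i: "A1 $ i $ i \<noteq> 0" using k by (simp add: A1_def mult_swap_mat)
    have d1: "det A1 \<noteq> 0" using less.prems by (simp add: A1_def det_mul det_swap_mat)
    have bi: "b $ i \<noteq> 0" using A1i by (simp add: b_def)
    have d2: "det A2 \<noteq> 0" using d1 det_single_row[OF bi] by (simp add: A2_def det_mul)
    have A2i: "A2 $ i = axis i 1"
      using A1i by (simp add: A2_def matrix_mult_single_row vec_eq_iff b_def axis_def)
    have A2t: "A2 $ t = axis t 1" if t: "A $ t = axis t 1" for t
    proof -
      have ti: "t \<noteq> i" "t \<noteq> k" using t i k by auto
      have "A1 $ t = axis t 1"
        using ti unfolding vec_eq_iff A1_def mult_swap_mat t by (auto simp: axis_def Transposition.transpose_def)
      then show ?thesis
        using ti by (auto simp: A2_def matrix_mult_single_row vec_eq_iff axis_def)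
    qed
    have "{t. A2 $ t \<noteq> axis t 1} \<subset> {t. A $ t \<noteq> axis t 1}"
      using A2i A2t i by blast
    then have "\<phi> A2 = 1" by (intro less.hyps psubset_card_mono d2) auto
    then have "\<phi> A1 = 1"
      using d1 det_single_row[OF bi] single_row_one[OF bi] by (simp add: A2_def mult)
    then show ?thesis
      using less.prems by (simp add: A1_def mult det_swap_mat)
  qed
qed

end

subsection \<open>The area formula\<close>

lemma norm_diag_mat_mult:
  fixes v :: "complex ^ 'n::finite"
  assumes "\<And>i. norm (u i) = 1"
  shows "norm ((\<chi> i j. if i = j then u i else 0) *v v) = norm v"
proof -
  have "((\<chi> i j. if i = j then u i else 0) *v v) $ i = u i * v $ i" for i
    by (simp add: matrix_vector_mult_def if_distrib[of "\<lambda>x. x * _"] cong: if_cong)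
  then show ?thesis by (simp add: norm_vec_def norm_mult assms)
qed

text \<open>The quotient of the two sides is a positive multiplicative function on invertible
  matrices. It is 1 on unitary diagonal matrices, which act as real isometries, and on scalars
  \<open>r\<close>, where both sides are \<open>r\<close> to the power \<open>2 * CARD('n)\<close>;
  so it is 1 throughout.\<close>

lemma abs_real_det_complex_matrix:
  fixes \<psi> :: "complex ^ 'n::finite \<Rightarrow> real ^ 'm::finite" and A :: "complex ^ 'n ^ 'n"
  assumes lin: "linear \<psi>" "linear \<psi>'" and inv: "\<And>x. \<psi>' (\<psi> x) = x" "\<And>y. \<psi> (\<psi>' y) = y"
    and nrm: "\<And>x. norm (\<psi> x) = norm x" and card: "CARD('m) = 2 * CARD('n)"
  shows "\<bar>det (matrix (\<lambda>y. \<psi> (A *v \<psi>' y)))\<bar> = (norm (det A))\<^sup>2"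
proof -
  define T where "T A = (\<lambda>y. \<psi> (A *v \<psi>' y))" for A
  have linA: "linear ((*v) A)" for A :: "complex ^ 'n ^ 'n"
    by (intro linearI) (simp_all add: vec_eq_iff matrix_vector_mult_def scaleR_sum_right distrib_left sum.distrib)
  have linT: "linear (T A)" for A
    using linear_compose[OF linear_compose[OF lin(2) linA[of A]] lin(1)] by (simp add: T_def o_def)
  define \<phi> where "\<phi> A = \<bar>det (matrix (T A))\<bar> / (norm (det A))\<^sup>2" for A
  have TT: "T (A ** B) = T A \<circ> T B" for A B
    by (auto simp: T_def inv matrix_vector_mul_assoc)
  have nrm': "norm (\<psi>' y) = norm y" for y using nrm[of "\<psi>' y"] inv by simp
  have inj_iff: "inj (T A) \<longleftrightarrow> (\<forall>x. A *v x = 0 \<longrightarrow> x = 0)" for A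
  proof -
    have "inj (T A) \<longleftrightarrow> (\<forall>y. T A y = 0 \<longrightarrow> y = 0)" by (rule linear_injective_0[OF linT])
    also have "\<dots> \<longleftrightarrow> (\<forall>x. A *v x = 0 \<longrightarrow> x = 0)"
      unfolding T_def by (metis inv lin linear_0)
    finally show ?thesis .
  qed
  have nz: "det (matrix (T A)) \<noteq> 0 \<longleftrightarrow> det A \<noteq> 0" for A
    unfolding det_nz_iff_inj[OF linT] inj_iff
    by (metis invertible_det_nz matrix_left_invertible_ker invertible_left_inverse)
  have ndet: "norm (det (\<chi> i j. if i = j then u i else 0 :: complex ^ 'n ^ 'n)) = (\<Prod>i\<in>UNIV. norm (u i))" for u
    by (subst det_diagonal) (auto simp: prod_norm)
  interpret det_multiplicative \<phi>
  proof
    fix A B :: "complex ^ 'n ^ 'n"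
    show "\<phi> (A ** B) = \<phi> A * \<phi> B"
      using linT by (simp add: \<phi>_def TT matrix_compose det_mul abs_mult norm_mult power_mult_distrib)
  next
    fix A :: "complex ^ 'n ^ 'n" assume "det A \<noteq> 0" then show "\<phi> A > 0"
      using nz by (simp add: \<phi>_def)
  next
    fix u :: "'n \<Rightarrow> complex" assume u: "\<And>i. norm (u i) = 1"
    have "orthogonal_transformation (T (\<chi> i j. if i = j then u i else 0))"
      unfolding orthogonal_transformation using linT by (auto simp: T_def nrm norm_diag_mat_mult[OF u] nrm')
    then show "\<phi> (\<chi> i j. if i = j then u i else 0) = 1"
      by (simp add: \<phi>_def ndet u)
  next
    fix r :: real assume r: "r > 0"
    have "(\<chi> i j. if i = j then complex_of_real r else 0) *v v = r *\<^sub>R v" for v :: "complex ^ 'n"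
      by (simp add: vec_eq_iff matrix_vector_mult_def if_distrib[of "\<lambda>x. x * _"] scaleR_conv_of_real[symmetric] cong: if_cong)
    then have "T (\<chi> i j. if i = j then complex_of_real r else 0) = (*\<^sub>R) r"
      using lin by (auto simp: T_def linear_scale inv)
    then show "\<phi> (\<chi> i j. if i = j then complex_of_real r else 0) = 1"
      using r by (simp add: \<phi>_def ndet card power_mult mult.commute)
  qed
  show ?thesis
  proof (cases "det A = 0")
    case True
    then show ?thesis using nz[of A] by (simp add: T_def)
  next
    case False
    then show ?thesis using eq_one[OF False] by (simp add: \<phi>_def T_def)
  qed
qed

text \<open>Change of variables for injective maps is applied on pieces where the point and the
  Jacobian are both bounded, so that the Jacobian is integrable; the pieces increase to
  \<open>S\<close>.\<close>

lemma emeasure_differentiable_image: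
  fixes F :: "real ^ 'm::{finite,wellorder} \<Rightarrow> real ^ 'm::_"
  assumes S: "S \<in> sets borel"
    and der: "\<And>x. (F has_derivative F' x) (at x)" and inj: "inj_on F S"
    and cont: "continuous_on UNIV (\<lambda>x. det (matrix (F' x)))"
  shows "F ` S \<in> sets lebesgue"
    and "emeasure lebesgue (F ` S) = (\<integral>\<^sup>+x\<in>S. ennreal \<bar>det (matrix (F' x))\<bar> \<partial>lborel)"
proof -
  let ?J = "\<lambda>x. \<bar>det (matrix (F' x))\<bar>"
  have J[measurable]: "?J \<in> borel_measurable borel"
    using cont by (intro borel_measurable_continuous_onI continuous_intros)
  define A where "A k = S \<inter> cball 0 (real k) \<inter> {x. ?J x \<le> real k}" for k
  have A[measurable]: "A k \<in> sets borel" for k using S unfolding A_def by measurable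
  have AS: "A k \<subseteq> S" for k by (auto simp: A_def)
  have incA: "incseq A" by (auto simp: incseq_def A_def intro: order_trans)
  have UA: "(\<Union>k. A k) = S"
  proof -
    have "\<exists>k. x \<in> A k" if "x \<in> S" for x
    proof -
      obtain k where "max (norm x) (?J x) \<le> real k" using real_arch_simple by blast
      then show ?thesis using that by (auto simp: A_def)
    qed
    then show ?thesis using AS by blast
  qed
  have fin: "F ` A k \<in> lmeasurable \<and> emeasure lebesgue (F ` A k) = (\<integral>\<^sup>+x\<in>A k. ennreal (?J x) \<partial>lborel)" for k
  proof -
    let ?g = "\<lambda>x. indicator (A k) x * ?J x"
    have bA: "emeasure lborel (A k) < \<infinity>"
    proof -
      have "emeasure lborel (A k) \<le> emeasure lborel (cball 0 (real k) :: (real ^ 'm::{finite,wellorder}) set)"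
        by (intro emeasure_mono) (auto simp: A_def)
      also have "\<dots> < \<infinity>" by (rule emeasure_lborel_cball_finite)
      finally show ?thesis .
    qed
    have int: "integrable lborel ?g"
    proof (rule Bochner_Integration.integrable_bound)
      show "integrable lborel (\<lambda>x. real k * indicator (A k) x)"
        using bA by (intro integrable_mult_right) (auto intro!: integrable_real_indicator)
      show "AE x in lborel. norm (?g x) \<le> norm (real k * indicat_real (A k) x)"
        by (auto simp: indicator_def A_def)
    qed simp
    define I where "I = (LINT x|lborel. ?g x)"
    have "(?g has_integral I) UNIV"
      using has_integral_integral_lborel[OF int] by (simp add: I_def)
    moreover have "?g = (\<lambda>x. if x \<in> A k then ?J x else 0)" by (auto simp: indicator_def)
    ultimately have hi: "(?J has_integral I) (A k)"
      by (simp only: has_integral_restrict_UNIV)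
    have "F ` A k \<in> lmeasurable \<and> measure lebesgue (F ` A k) = I"
      using hi has_measure_differentiable_image[of "A k" F F' I] der inj_on_subset[OF inj AS]
      by (auto intro: has_derivative_at_withinI)
    moreover have "ennreal I = (\<integral>\<^sup>+x. ennreal (?g x) \<partial>lborel)"
      unfolding I_def by (rule nn_integral_eq_integral[symmetric]) (use int in auto)
    moreover have "(\<integral>\<^sup>+x. ennreal (?g x) \<partial>lborel) = (\<integral>\<^sup>+x\<in>A k. ennreal (?J x) \<partial>lborel)"
      by (intro nn_integral_cong) (auto simp: indicator_def)
    ultimately show ?thesis
      by (simp add: emeasure_eq_measure2)
  qed
  have FU: "F ` S = (\<Union>k. F ` A k)" using UA by blast
  show "F ` S \<in> sets lebesgue" unfolding FU using fin by (auto intro!: sets.countable_UN)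
  have "emeasure lebesgue (F ` S) = (SUP k. emeasure lebesgue (F ` A k))"
    unfolding FU using fin incA
    by (intro SUP_emeasure_incseq[symmetric]) (auto simp: incseq_def intro!: image_mono)
  also have "\<dots> = (SUP k. \<integral>\<^sup>+x\<in>A k. ennreal (?J x) \<partial>lborel)" using fin by simp
  also have "\<dots> = (\<integral>\<^sup>+x. (SUP k. ennreal (?J x) * indicator (A k) x) \<partial>lborel)"
    using incA by (intro nn_integral_monotone_convergence_SUP[symmetric])
      (auto simp: incseq_def le_fun_def indicator_def)
  also have "\<dots> = (\<integral>\<^sup>+x\<in>S. ennreal (?J x) \<partial>lborel)"
  proof (intro nn_integral_cong)
    fix x
    have "(SUP k. indicator (A k) x :: ennreal) = indicator S x"
    proof (cases "x \<in> S")
      case True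
      then obtain k where "x \<in> A k" using UA by blast
      then have "(SUP k. indicator (A k) x :: ennreal) \<ge> 1" by (intro SUP_upper2[of k]) auto
      moreover have "(SUP k. indicator (A k) x :: ennreal) \<le> 1" by (intro SUP_least) (auto simp: indicator_def)
      ultimately show ?thesis using True by simp
    next
      case False
      then have "x \<notin> A k" for k using AS by blast
      then show ?thesis using False by simp
    qed
    then show "(SUP k. ennreal (?J x) * indicator (A k) x) = ennreal (?J x) * indicator S x"
      by (simp add: SUP_mult_left_ennreal[symmetric])
  qed
  finally show "emeasure lebesgue (F ` S) = (\<integral>\<^sup>+x\<in>S. ennreal (?J x) \<partial>lborel)" .
qed

text \<open>Local injectivity cuts \<open>U\<close> into countably many disjoint Borel pieces on
  which \<open>F\<close> is injective, and a fibre meets each piece at most once. The outer integral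
  is over \<open>lebesgue\<close> because the images of the pieces are obtained as Lebesgue
  measurable sets.\<close>

lemma area_formula_real:
  fixes F :: "real ^ 'm::{finite,wellorder} \<Rightarrow> real ^ 'm::_" and k :: "real ^ 'm::_ \<Rightarrow> ennreal"
  assumes der: "\<And>x. (F has_derivative F' x) (at x)"
    and cont: "continuous_on UNIV (\<lambda>x. det (matrix (F' x)))"
    and U: "open U" and loc: "\<And>x. x \<in> U \<Longrightarrow> \<exists>V. open V \<and> x \<in> V \<and> inj_on F V"
    and k: "k \<in> borel_measurable borel"
  shows "(\<lambda>a. \<integral>\<^sup>+x. k x \<partial>count_space {x \<in> U. F x = a}) \<in> borel_measurable lebesgue \<and>
    (\<integral>\<^sup>+a. (\<integral>\<^sup>+x. k x \<partial>count_space {x \<in> U. F x = a}) \<partial>lebesgue)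
      = (\<integral>\<^sup>+x\<in>U. k x * ennreal \<bar>det (matrix (F' x))\<bar> \<partial>lborel)"
proof -
  let ?J = "\<lambda>x. ennreal \<bar>det (matrix (F' x))\<bar>"
  have J[measurable]: "?J \<in> borel_measurable borel"
    using cont by (intro measurable_compose[OF _ measurable_ennreal] borel_measurable_continuous_onI continuous_intros)
  have U'[measurable]: "U \<in> sets borel" using U by auto
  obtain \<V> where \<V>: "countable \<V>" "\<And>V. V \<in> \<V> \<Longrightarrow> open V \<and> inj_on F V" "U \<subseteq> \<Union>\<V>"
  proof -
    obtain \<V> where "\<V> \<subseteq> {V. open V \<and> inj_on F V}" "countable \<V>" "\<Union>\<V> = \<Union>{V. open V \<and> inj_on F V}"
      using Lindelof[of "{V. open V \<and> inj_on F V}"] by blast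
    then show thesis using loc by (intro that[of \<V>]) (auto, blast)
  qed
  define A where "A = from_nat_into (insert {} \<V>)"
  have Aprop: "open (A n) \<and> inj_on F (A n)" for n
    using from_nat_into[of "insert {} \<V>" n] \<V> by (auto simp: A_def)
  have UA: "U \<subseteq> (\<Union>n. A n)"
    using \<V> range_from_nat_into[of "insert {} \<V>"] by (auto simp: A_def)
  define S where "S n = disjointed A n \<inter> U" for n
  have S[measurable]: "S n \<in> sets borel" for n
  proof -
    have "range (disjointed A) \<subseteq> sets borel"
      using Aprop by (intro sets.range_disjointed_sets) auto
    then show ?thesis unfolding S_def by auto
  qed
  have Sinj: "inj_on F (S n)" for n
    using Aprop[of n] disjointed_subset[of A n] by (auto simp: S_def intro: inj_on_subset)
  have US: "(\<Union>n. S n) = U" using UA UN_disjointed_eq[of A] by (auto simp: S_def)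
  have Sdisj: "disjoint_family S"
    using disjoint_family_disjointed[of A] by (auto simp: S_def disjoint_family_on_def)
  show ?thesis using k
  proof (induction rule: borel_measurable_induct)
    case (cong f g)
    then show ?case by (auto cong: nn_integral_cong)
  next
    case (set W)
    \<comment> \<open>The number of points of \<open>W\<close> in the fibre over \<open>a\<close> is
      the number of pieces whose image contains \<open>a\<close>.\<close>
    have cnt: "(\<integral>\<^sup>+x. indicator W x \<partial>count_space {x \<in> U. F x = a}) = (\<Sum>n. indicator (F ` (W \<inter> S n)) a)" for a
    proof -
      let ?C = "count_space {x \<in> U. F x = a}"
      have "(\<integral>\<^sup>+x. indicator W x \<partial>?C) = (\<integral>\<^sup>+x. indicator ({x \<in> U. F x = a} \<inter> W) x \<partial>?C)"
        by (intro nn_integral_cong) (auto simp: indicator_def)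
      also have "\<dots> = emeasure ?C ({x \<in> U. F x = a} \<inter> W)" by (rule nn_integral_indicator) auto
      also have "{x \<in> U. F x = a} \<inter> W = (\<Union>n. {x \<in> W \<inter> S n. F x = a})" using US by auto
      also have "emeasure ?C \<dots> = (\<Sum>n. emeasure ?C {x \<in> W \<inter> S n. F x = a})"
        using US Sdisj by (intro suminf_emeasure[symmetric]) (auto simp: disjoint_family_on_def)
      also have "(\<lambda>n. emeasure ?C {x \<in> W \<inter> S n. F x = a}) = (\<lambda>n. indicator (F ` (W \<inter> S n)) a)"
      proof
        fix n
        show "emeasure ?C {x \<in> W \<inter> S n. F x = a} = indicator (F ` (W \<inter> S n)) a"
      proof (cases "a \<in> F ` (W \<inter> S n)")
        case True
        then obtain x where x: "x \<in> W \<inter> S n" "F x = a" by auto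
        then have "{x \<in> W \<inter> S n. F x = a} = {x}" using Sinj[of n] by (auto simp: inj_on_def)
        moreover have "x \<in> U" using x US by blast
        ultimately have "emeasure ?C {x \<in> W \<inter> S n. F x = a} = 1"
          using x by simp
        then show ?thesis using True by simp
      next
        case False
        then have none: "{x \<in> W \<inter> S n. F x = a} = {}" by auto
        show ?thesis unfolding none using False by simp
      qed
      qed
      finally show ?thesis .
    qed
    have im: "F ` (W \<inter> S n) \<in> sets lebesgue"
      "emeasure lebesgue (F ` (W \<inter> S n)) = (\<integral>\<^sup>+x\<in>W \<inter> S n. ?J x \<partial>lborel)" for n
      using emeasure_differentiable_image[OF _ der _ cont, of "W \<inter> S n"] set inj_on_subset[OF Sinj[of n]]
      by auto
    have "(\<integral>\<^sup>+a. (\<Sum>n. indicator (F ` (W \<inter> S n)) a) \<partial>lebesgue) = (\<Sum>n. \<integral>\<^sup>+a. indicator (F ` (W \<inter> S n)) a \<partial>lebesgue)"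
      by (rule nn_integral_suminf) (use im in auto)
    also have "\<dots> = (\<Sum>n. \<integral>\<^sup>+x\<in>W \<inter> S n. ?J x \<partial>lborel)" using im by simp
    also have "\<dots> = (\<integral>\<^sup>+x. (\<Sum>n. ?J x * indicator (W \<inter> S n) x) \<partial>lborel)"
      using set by (intro nn_integral_suminf[symmetric]) auto
    also have "\<dots> = (\<integral>\<^sup>+x\<in>U. indicator W x * ?J x \<partial>lborel)"
    proof (intro nn_integral_cong)
      fix x
      have "(\<Sum>n. indicator (W \<inter> S n) x :: ennreal) = indicator (\<Union>n. W \<inter> S n) x"
        using Sdisj by (intro suminf_indicator) (auto simp: disjoint_family_on_def)
      also have "(\<Union>n. W \<inter> S n) = W \<inter> U" using US by auto
      finally have *: "(\<Sum>n. indicator (W \<inter> S n) x :: ennreal) = indicator (W \<inter> U) x" .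
      show "(\<Sum>n. ?J x * indicator (W \<inter> S n) x) = indicator W x * ?J x * indicator U x"
        by (subst ennreal_suminf_cmult, subst *) (auto simp: indicator_def)
    qed
    finally show ?case using im unfolding cnt by (auto intro!: borel_measurable_suminf)
  next
    case (mult u c)
    have "(\<integral>\<^sup>+x. c * u x \<partial>count_space {x \<in> U. F x = a}) = c * (\<integral>\<^sup>+x. u x \<partial>count_space {x \<in> U. F x = a})" for a
      by (rule nn_integral_cmult) simp
    moreover have "(\<integral>\<^sup>+x\<in>U. c * u x * ?J x \<partial>lborel) = c * (\<integral>\<^sup>+x\<in>U. u x * ?J x \<partial>lborel)"
      using mult by (subst nn_integral_cmult[symmetric]) (auto simp: mult.assoc)
    ultimately show ?case using mult by (auto simp: nn_integral_cmult)
  next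
    case (add u v)
    have "(\<integral>\<^sup>+x. v x + u x \<partial>count_space {x \<in> U. F x = a}) = (\<integral>\<^sup>+x. v x \<partial>count_space {x \<in> U. F x = a}) + (\<integral>\<^sup>+x. u x \<partial>count_space {x \<in> U. F x = a})" for a
      by (rule nn_integral_add) simp_all
    moreover have "(\<integral>\<^sup>+x\<in>U. (v x + u x) * ?J x \<partial>lborel) = (\<integral>\<^sup>+x\<in>U. v x * ?J x \<partial>lborel) + (\<integral>\<^sup>+x\<in>U. u x * ?J x \<partial>lborel)"
      using add by (subst nn_integral_add[symmetric]) (auto simp: distrib_right)
    ultimately show ?case using add by (auto simp: nn_integral_add)
  next
    case (seq Us)
    have *: "(SUP i. Us i) x = (SUP i. Us i x)" for x by (simp add: image_image)
    have c: "(\<integral>\<^sup>+x. (SUP i. Us i x) \<partial>count_space {x \<in> U. F x = a}) = (SUP i. \<integral>\<^sup>+x. Us i x \<partial>count_space {x \<in> U. F x = a})" for a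
      by (rule nn_integral_monotone_convergence_SUP) (use seq in auto)
    have "(\<integral>\<^sup>+x\<in>U. (SUP i. Us i x) * ?J x \<partial>lborel) = (\<integral>\<^sup>+x. (SUP i. Us i x * ?J x * indicator U x) \<partial>lborel)"
      by (intro nn_integral_cong) (simp add: SUP_mult_right_ennreal)
    also have "\<dots> = (SUP i. \<integral>\<^sup>+x\<in>U. Us i x * ?J x \<partial>lborel)"
      using seq by (intro nn_integral_monotone_convergence_SUP)
        (auto simp: incseq_def le_fun_def intro!: mult_right_mono)
    also have "\<dots> = (SUP i. \<integral>\<^sup>+a. (\<integral>\<^sup>+x. Us i x \<partial>count_space {x \<in> U. F x = a}) \<partial>lebesgue)"
      using seq by simp
    also have "\<dots> = (\<integral>\<^sup>+a. (SUP i. \<integral>\<^sup>+x. Us i x \<partial>count_space {x \<in> U. F x = a}) \<partial>lebesgue)"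
      using seq by (intro nn_integral_monotone_convergence_SUP[symmetric])
        (auto simp: incseq_def le_fun_def intro!: nn_integral_mono)
    finally show ?case using seq unfolding * c by (auto intro!: borel_measurable_SUP)
  qed
qed

text \<open>Continuity of the derivative is asked direction by direction. Since the operator norm is
  at most the sum over a basis, this already gives the continuity in operator norm on which local
  injectivity rests.\<close>

lemma C1_locally_injective:
  fixes f :: "'a::euclidean_space \<Rightarrow> 'a"
  assumes der: "\<And>x. (f has_derivative f' x) (at x)"
    and cont: "\<And>v. continuous_on UNIV (\<lambda>x. f' x v)" and inj: "inj (f' a)"
  shows "\<exists>r>0. inj_on f (ball a r)"
proof -
  have lin: "linear (f' x)" for x using der[of x] by (rule has_derivative_linear)
  have bl: "bounded_linear (f' x)" for x using der[of x] by (rule has_derivative_bounded_linear)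
  obtain g where g: "linear g" "g \<circ> f' a = id"
    using linear_injective_left_inverse[OF lin inj] by auto
  have on: "\<exists>d>0. \<forall>x. dist a x < d \<longrightarrow> onorm (\<lambda>v. f' x v - f' a v) < e" if "e > 0" for e
  proof -
    have "continuous_on UNIV (\<lambda>x. \<Sum>b\<in>Basis. norm (f' x b - f' a b))"
      by (intro continuous_intros cont)
    then have "isCont (\<lambda>x. \<Sum>b\<in>Basis. norm (f' x b - f' a b)) a"
      by (simp add: continuous_on_eq_continuous_at)
    then obtain d where d: "d > 0" "\<And>x. dist x a < d \<Longrightarrow> dist (\<Sum>b\<in>Basis. norm (f' x b - f' a b)) 0 < e"
      using \<open>e > 0\<close> unfolding continuous_at_eps_delta by auto
    have "onorm (\<lambda>v. f' x v - f' a v) < e" if "dist a x < d" for x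
    proof -
      have "onorm (\<lambda>v. f' x v - f' a v) \<le> (\<Sum>b\<in>Basis. norm (f' x b - f' a b))"
        by (intro onorm_componentwise bounded_linear_sub bl)
      then show ?thesis using d(2)[of x] that by (auto simp: dist_commute)
    qed
    then show ?thesis using d(1) by blast
  qed
  obtain r where "r > 0" "ball a r \<subseteq> UNIV" "inj_on f (ball a r)"
    using has_derivative_locally_injective[OF UNIV_I open_UNIV _ g(2) _ on] g(1) der
    by (metis linear_conv_bounded_linear)
  then show ?thesis by blast
qed

lemma continuous_on_det:
  fixes A :: "'a::topological_space \<Rightarrow> 'b::real_normed_field ^ 'n::finite ^ 'n"
  assumes c: "\<And>i j. continuous_on S (\<lambda>x. A x $ i $ j)"
  shows "continuous_on S (\<lambda>x. det (A x))"
proof -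
  have p: "continuous_on S (\<lambda>x. \<Prod>i\<in>UNIV. A x $ i $ p i)" for p
    by (rule continuous_on_prod, rule c)
  have q: "continuous_on S (\<lambda>x. of_int (sign p) * (\<Prod>i\<in>UNIV. A x $ i $ p i))" for p
    by (rule continuous_on_mult, rule continuous_on_const, rule p)
  show ?thesis unfolding det_def by (rule continuous_on_sum, rule q)
qed

lemma continuous_on_matrix_entry:
  fixes A :: "'a::topological_space \<Rightarrow> 'b::real_normed_field ^ 'n::finite ^ 'm::finite"
  assumes "continuous_on S A" shows "continuous_on S (\<lambda>x. A x $ i $ j)"
  by (rule continuous_on_component, rule continuous_on_component, rule assms)

lemma continuous_on_matrix_vector_mult:
  fixes A :: "'a::topological_space \<Rightarrow> complex ^ 'n::finite ^ 'm::finite"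
  assumes "continuous_on S A"
  shows "continuous_on S (\<lambda>x. A x *v v)"
proof -
  have "continuous_on S (\<lambda>x. A x $ i $ j * v $ j)" for i j
    by (rule continuous_on_mult, rule continuous_on_matrix_entry[OF assms], rule continuous_on_const)
  then show ?thesis
    unfolding matrix_vector_mult_def by (intro continuous_on_vec_lambda continuous_on_sum)
qed

lemma inj_matrix_vector_mult:
  fixes A :: "complex ^ 'n::finite ^ 'n"
  assumes "det A \<noteq> 0" shows "inj ((*v) A)"
proof -
  obtain A' where "A' ** A = mat 1"
    using assms invertible_det_nz[of A] by (auto simp: invertible_def)
  then have "A' *v (A *v x) = x" for x by (simp add: matrix_vector_mul_assoc)
  then show ?thesis by (metis injI)
qed

lemma nn_integral_lborel_isometry:
  assumes "distr lborel borel \<psi> = (lborel :: 'b::euclidean_space measure)" "\<psi> \<in> borel_measurable borel" "h \<in> borel_measurable borel"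
  shows "(\<integral>\<^sup>+y. h y \<partial>(lborel :: 'b measure)) = (\<integral>\<^sup>+x. h (\<psi> x) \<partial>(lborel :: 'a::euclidean_space measure))"
proof -
  have "(\<integral>\<^sup>+y. h y \<partial>distr lborel borel \<psi>) = (\<integral>\<^sup>+x. h (\<psi> x) \<partial>lborel)"
    by (rule nn_integral_distr) (use assms(2,3) in auto)
  then show ?thesis by (simp only: assms(1))
qed

text \<open>The real formula transported by an isometry; the Jacobian becomes the squared modulus of
  the complex determinant. The Borel measurability of the fibre sum permits the passage between
  \<open>lebesgue\<close> and \<open>lborel\<close> and is supplied by
  \<open>zero_sum_measurable\<close> in the application.\<close>

lemma area_formula_complex:
  fixes F :: "complex ^ 'n::finite \<Rightarrow> complex ^ 'n" and k :: "complex ^ 'n \<Rightarrow> ennreal"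
  assumes der: "\<And>z. (F has_derivative (\<lambda>w. G z *v w)) (at z)"
    and cont: "continuous_on UNIV G"
    and k[measurable]: "k \<in> borel_measurable borel"
    and N: "(\<lambda>a. \<integral>\<^sup>+z. k z \<partial>count_space {z. det (G z) \<noteq> 0 \<and> F z = a}) \<in> borel_measurable borel"
  shows "(\<integral>\<^sup>+a. (\<integral>\<^sup>+z. k z \<partial>count_space {z. det (G z) \<noteq> 0 \<and> F z = a}) \<partial>lborel)
    = (\<integral>\<^sup>+z. k z * ennreal ((norm (det (G z)))\<^sup>2) \<partial>lborel)"
proof -
  \<comment> \<open>The type \<open>'n bit0\<close> has twice as many elements as \<open>'n\<close>,
    which matches the real dimension.\<close>
  have dim: "DIM(complex ^ 'n) = DIM(real ^ 'n bit0)" by (simp add: mult.commute)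
  obtain \<psi> :: "complex ^ 'n \<Rightarrow> real ^ 'n bit0" and \<psi>' :: "real ^ 'n bit0 \<Rightarrow> complex ^ 'n" where
    lin: "linear \<psi>" "linear \<psi>'" and inv: "\<And>x. \<psi>' (\<psi> x) = x" "\<And>y. \<psi> (\<psi>' y) = y"
    and nrm: "\<And>x. norm (\<psi> x) = norm x" and leb: "distr lborel borel \<psi> = lborel"
    by (rule euclidean_isometry_lborel[OF dim]) (rule that)
  have c\<psi>: "continuous_on UNIV \<psi>" "continuous_on UNIV \<psi>'"
    using lin by (simp_all add: linear_continuous_on linear_conv_bounded_linear)
  have m\<psi>[measurable]: "\<psi> \<in> borel_measurable borel" "\<psi>' \<in> borel_measurable borel"
    using c\<psi> by (auto intro: borel_measurable_continuous_onI)
  have cont\<psi>: "continuous_on UNIV (\<lambda>y. G (\<psi>' y))"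
    using continuous_on_compose2[OF cont c\<psi>(2)] by simp
  let ?F = "\<lambda>y. \<psi> (F (\<psi>' y))" and ?F' = "\<lambda>y w. \<psi> (G (\<psi>' y) *v \<psi>' w)"
  let ?U = "{y. det (G (\<psi>' y)) \<noteq> 0}"
  have detF: "\<bar>det (matrix (?F' y))\<bar> = (norm (det (G (\<psi>' y))))\<^sup>2" for y
    by (rule abs_real_det_complex_matrix[OF lin inv nrm]) simp
  have bl: "bounded_linear \<psi>" "bounded_linear \<psi>'" using lin by (simp_all add: linear_conv_bounded_linear)
  have derF: "(?F has_derivative ?F' y) (at y)" for y
  proof -
    have "(F \<circ> \<psi>' has_derivative ((\<lambda>w. G (\<psi>' y) *v w) \<circ> \<psi>')) (at y)"
      by (intro diff_chain_at bounded_linear_imp_has_derivative bl der)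
    from bounded_linear.has_derivative[OF bl(1) this] show ?thesis by (simp add: o_def)
  qed
  have contv: "continuous_on UNIV (\<lambda>y. ?F' y v)" for v
    by (rule continuous_on_compose2[OF c\<psi>(1) continuous_on_matrix_vector_mult[OF cont\<psi>]]) simp
  have dmat: "continuous_on UNIV (\<lambda>y. det (matrix (?F' y)))"
    by (rule continuous_on_det) (simp add: matrix_def continuous_on_component contv)
  have U: "open ?U"
  proof -
    have "open {y. norm (det (G (\<psi>' y))) > 0}"
      by (intro open_Collect_less continuous_on_const continuous_on_norm continuous_on_det continuous_on_matrix_entry cont\<psi>)
    then show ?thesis by simp
  qed
  have loc: "\<exists>V. open V \<and> y \<in> V \<and> inj_on ?F V" if y: "y \<in> ?U" for y
  proof -
    have "inj (?F' y)"
      using inj_matrix_vector_mult[of "G (\<psi>' y)"] y inv by (auto simp: inj_def) metis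
    from C1_locally_injective[OF derF contv this] obtain r where "r > 0" "inj_on ?F (ball y r)" by auto
    then show ?thesis by (intro exI[of _ "ball y r"]) auto
  qed
  have fib: "(\<integral>\<^sup>+y. k (\<psi>' y) \<partial>count_space {y \<in> ?U. ?F y = b}) = (\<integral>\<^sup>+z. k z \<partial>count_space {z. det (G z) \<noteq> 0 \<and> F z = \<psi>' b})" for b
  proof (rule nn_integral_bij_count_space)
    show "bij_betw \<psi>' {y \<in> ?U. ?F y = b} {z. det (G z) \<noteq> 0 \<and> F z = \<psi>' b}"
      by (rule bij_betw_byWitness[where f' = \<psi>]) (use inv in auto)
  qed
  have kp: "(\<lambda>y. k (\<psi>' y)) \<in> borel_measurable borel" by measurable
  have "(\<integral>\<^sup>+a. (\<integral>\<^sup>+z. k z \<partial>count_space {z. det (G z) \<noteq> 0 \<and> F z = a}) \<partial>lborel)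
      = (\<integral>\<^sup>+a. (\<integral>\<^sup>+z. k z \<partial>count_space {z. det (G z) \<noteq> 0 \<and> F z = \<psi>' (\<psi> a)}) \<partial>lborel)"
    by (simp add: inv)
  also have "\<dots> = (\<integral>\<^sup>+b. (\<integral>\<^sup>+z. k z \<partial>count_space {z. det (G z) \<noteq> 0 \<and> F z = \<psi>' b}) \<partial>lborel)"
    by (rule nn_integral_lborel_isometry[OF leb, symmetric]) (use measurable_compose[OF m\<psi>(2) N] in auto)
  also have "\<dots> = (\<integral>\<^sup>+b. (\<integral>\<^sup>+y. k (\<psi>' y) \<partial>count_space {y \<in> ?U. ?F y = b}) \<partial>lborel)"
    by (simp only: fib)
  also have "\<dots> = (\<integral>\<^sup>+b. (\<integral>\<^sup>+y. k (\<psi>' y) \<partial>count_space {y \<in> ?U. ?F y = b}) \<partial>lebesgue)"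
    using measurable_compose[OF m\<psi>(2) N] by (subst nn_integral_completion) (auto simp: fib)
  also have "\<dots> = (\<integral>\<^sup>+y\<in>?U. k (\<psi>' y) * ennreal \<bar>det (matrix (?F' y))\<bar> \<partial>lborel)"
    using area_formula_real[OF derF dmat U loc kp] by blast
  also have "\<dots> = (\<integral>\<^sup>+y. k (\<psi>' y) * ennreal ((norm (det (G (\<psi>' y))))\<^sup>2) \<partial>lborel)"
    unfolding detF by (intro nn_integral_cong) (auto simp: indicator_def)
  also have "\<dots> = (\<integral>\<^sup>+z. k (\<psi>' (\<psi> z)) * ennreal ((norm (det (G (\<psi>' (\<psi> z)))))\<^sup>2) \<partial>lborel)"
  proof (rule nn_integral_lborel_isometry[OF leb])
    have [measurable]: "(\<lambda>y. norm (det (G (\<psi>' y)))) \<in> borel_measurable borel"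
      by (intro borel_measurable_continuous_onI continuous_on_norm continuous_on_det continuous_on_matrix_entry cont\<psi>)
    show "(\<lambda>y. k (\<psi>' y) * ennreal ((norm (det (G (\<psi>' y))))\<^sup>2)) \<in> borel_measurable borel" by measurable
  qed measurable
  finally show ?thesis by (simp add: inv)
qed

subsection \<open>Measurability of sums over zeros\<close>

text \<open>A nonnegative continuous function on a compact set has a zero iff it takes arbitrarily
  small values on a countable dense subset, since its infimum is attained. The uncountable
  existential thereby becomes a countable condition.\<close>

lemma sets_ex_zero_compact:
  fixes Q :: "'x \<Rightarrow> 'a::euclidean_space \<Rightarrow> real"
  assumes Qm[measurable]: "\<And>z. (\<lambda>x. Q x z) \<in> borel_measurable M"
    and cont: "\<And>x. x \<in> space M \<Longrightarrow> continuous_on UNIV (Q x)" and pos: "\<And>x z. Q x z \<ge> 0"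
    and K: "compact K"
  shows "{x \<in> space M. \<exists>z\<in>K. Q x z = 0} \<in> sets M"
proof -
  obtain T where T: "countable T" "T \<subseteq> K" "K \<subseteq> closure T" using separable[of K] by blast
  have "(\<exists>z\<in>K. Q x z = 0) \<longleftrightarrow> (\<forall>n. \<exists>t\<in>T. Q x t < 1 / Suc n)" if x: "x \<in> space M" for x
  proof
    assume "\<exists>z\<in>K. Q x z = 0"
    then obtain z where z: "z \<in> K" "Q x z = 0" by blast
    show "\<forall>n. \<exists>t\<in>T. Q x t < 1 / Suc n"
    proof
      fix n
      have "open {y. Q x y < 1 / Suc n}"
        by (intro open_Collect_less cont x continuous_on_const)
      moreover have "z \<in> {y. Q x y < 1 / Suc n}" using z by simp
      moreover have "z \<in> closure T" using z T by blast
      ultimately have "{y. Q x y < 1 / Suc n} \<inter> T \<noteq> {}"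
        using open_Int_closure_eq_empty by blast
      then show "\<exists>t\<in>T. Q x t < 1 / Suc n" by blast
    qed
  next
    assume r: "\<forall>n. \<exists>t\<in>T. Q x t < 1 / Suc n"
    then have "K \<noteq> {}" using T by blast
    then obtain z where z: "z \<in> K" "\<And>y. y \<in> K \<Longrightarrow> Q x z \<le> Q x y"
      using continuous_attains_inf[OF K, of "Q x"] continuous_on_subset[OF cont[OF x]] by blast
    have "Q x z < 1 / Suc n" for n using r z T by (meson le_less_trans subsetD)
    then have "\<not> Q x z > 0" using reals_Archimedean[of "Q x z"] by (metis inverse_eq_divide less_asym)
    then show "\<exists>z\<in>K. Q x z = 0" using z pos[of x z] by force
  qed
  then have "{x \<in> space M. \<exists>z\<in>K. Q x z = 0} = {x \<in> space M. \<forall>n. \<exists>t\<in>T. Q x t < 1 / Suc n}" by blast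
  also have "\<dots> \<in> sets M" using T(1) by measurable
  finally show ?thesis .
qed

lemma sets_ex_zero:
  fixes Q :: "'x \<Rightarrow> 'a::euclidean_space \<Rightarrow> real"
  assumes Qm: "\<And>z. (\<lambda>x. Q x z) \<in> borel_measurable M"
    and cont: "\<And>x. x \<in> space M \<Longrightarrow> continuous_on UNIV (Q x)" and pos: "\<And>x z. Q x z \<ge> 0"
    and C: "closed C"
  shows "{x \<in> space M. \<exists>z\<in>C. Q x z = 0} \<in> sets M"
proof -
  have "\<exists>n. z \<in> cball 0 (real n)" for z :: 'a using real_arch_simple[of "norm z"] by auto
  then have "{x \<in> space M. \<exists>z\<in>C. Q x z = 0} = (\<Union>n. {x \<in> space M. \<exists>z\<in>C \<inter> cball 0 (real n). Q x z = 0})"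
    by blast
  moreover have "{x \<in> space M. \<exists>z\<in>C \<inter> cball 0 (real n). Q x z = 0} \<in> sets M" for n
    by (rule sets_ex_zero_compact[OF Qm cont pos]) (use C in auto)
  ultimately show ?thesis by auto
qed

text \<open>
  The sum is the supremum over finer and finer partitions of the sums of the suprema over the
  cells; each cell is a countable union of closed sets, which makes these suprema measurable.
\<close>

lemma borel_measurable_sum_zeros:
  fixes F :: "'x \<Rightarrow> 'a::euclidean_space \<Rightarrow> 'b::euclidean_space" and J B :: "'x \<Rightarrow> 'a \<Rightarrow> real"
  assumes Fm[measurable]: "\<And>z. (\<lambda>x. F x z) \<in> borel_measurable M"
    and Jm[measurable]: "\<And>z. (\<lambda>x. J x z) \<in> borel_measurable M"
    and Bm[measurable]: "\<And>z. (\<lambda>x. B x z) \<in> borel_measurable M"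
    and Fc: "\<And>x. x \<in> space M \<Longrightarrow> continuous_on UNIV (F x)"
    and Jc: "\<And>x. x \<in> space M \<Longrightarrow> continuous_on UNIV (J x)"
    and Bc: "\<And>x. x \<in> space M \<Longrightarrow> continuous_on UNIV (B x)"
    and Jpos: "\<And>x z. J x z \<ge> 0" and Bpos: "\<And>x z. B x z \<ge> 0"
    and isol: "\<And>x z. x \<in> space M \<Longrightarrow> J x z \<noteq> 0 \<Longrightarrow> F x z = 0 \<Longrightarrow> \<exists>r>0. \<forall>y\<in>ball z r. F x y = 0 \<longrightarrow> y = z"
  shows "(\<lambda>x. \<integral>\<^sup>+z. ennreal (B x z / J x z) \<partial>count_space {z. J x z \<noteq> 0 \<and> F x z = 0}) \<in> borel_measurable M"
proof -
  obtain D :: "'a set" where D0: "countable D" "UNIV \<subseteq> closure D"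
    by (rule separable[of "UNIV :: 'a set"]) (rule that)
  then have D: "countable D" "closure D = UNIV" by auto
  then have "D \<noteq> {}" by auto
  define c where "c = from_nat_into D"
  have rc: "range c = D" unfolding c_def using D \<open>D \<noteq> {}\<close> by (simp add: range_from_nat_into)
  \<comment> \<open>Balls of radius \<open>1 / (k + 1)\<close> about a dense sequence cover the
    space; subtracting the earlier balls gives the cells \<open>P k m\<close> of the partition at
    level \<open>k\<close>.\<close>
  define A where "A k m = cball (c m) (1 / Suc k)" for k m :: nat
  define P where "P k m = A k m - (\<Union>l<m. A k l)" for k m :: nat
  have Pdisj: "z \<in> P k m \<Longrightarrow> z \<in> P k m' \<Longrightarrow> m = m'" for z k m m'
    unfolding P_def by (metis DiffE UN_I lessThan_iff linorder_neqE_nat)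
  have Pcover: "\<exists>m. z \<in> P k m" for z k
  proof -
    have "z \<in> closure D" using D by simp
    then obtain y where "y \<in> D" "dist y z < 1 / Suc k" using closure_approachable[of z D] by (metis of_nat_0_less_iff zero_less_Suc zero_less_divide_1_iff)
    then obtain m where "z \<in> A k m" using rc by (auto simp: A_def intro: less_imp_le)
    then have ex: "\<exists>m. z \<in> A k m" by blast
    have "z \<in> P k (LEAST m. z \<in> A k m)"
      unfolding P_def using LeastI_ex[OF ex] not_less_Least by blast
    then show ?thesis by blast
  qed
  have Pdist: "dist y z \<le> 2 / Suc k" if "y \<in> P k m" "z \<in> P k m" for y z k m
  proof -
    have "dist (c m) y \<le> 1 / Suc k" "dist (c m) z \<le> 1 / Suc k" using that by (auto simp: P_def A_def)
    then have "dist y z \<le> 1 / Suc k + 1 / Suc k"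
      using dist_triangle3[of y z "c m"] by linarith
    then show ?thesis by simp
  qed
  \<comment> \<open>Points of the ball that keep a margin \<open>1 / (s + 1)\<close> from all
    earlier balls: a closed set, and the union over \<open>s\<close> is the cell.\<close>
  define C where "C k m s = A k m \<inter> (\<Inter>l\<in>{..<m}. {z. 1 / Suc k + 1 / Suc s \<le> dist (c l) z})" for k m s :: nat
  have Cclosed: "closed (C k m s)" for k m s
    unfolding C_def A_def by (intro closed_Int closed_cball closed_INT ballI closed_Collect_le continuous_intros)
  have PC: "P k m = (\<Union>s. C k m s)" for k m
  proof (intro equalityI subsetI)
    fix z assume z: "z \<in> P k m"
    have "\<exists>s. \<forall>l<m. 1 / Suc k + 1 / Suc s \<le> dist (c l) z"
    proof -
      have "\<forall>l\<in>{..<m}. eventually (\<lambda>s. 1 / Suc k + 1 / Suc s \<le> dist (c l) z) sequentially"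
      proof
        fix l assume "l \<in> {..<m}"
        then have "z \<notin> A k l" using z by (auto simp: P_def)
        then have "dist (c l) z - 1 / Suc k > 0" by (simp add: A_def)
        moreover have "(\<lambda>s. 1 / Suc s) \<longlonglongrightarrow> (0::real)" by (rule LIMSEQ_Suc[OF lim_1_over_n])
        ultimately have "eventually (\<lambda>s. 1 / Suc s < dist (c l) z - 1 / Suc k) sequentially"
          using order_tendstoD(2) by blast
        then show "eventually (\<lambda>s. 1 / Suc k + 1 / Suc s \<le> dist (c l) z) sequentially"
          by eventually_elim simp
      qed
      then have "eventually (\<lambda>s. \<forall>l\<in>{..<m}. 1 / Suc k + 1 / Suc s \<le> dist (c l) z) sequentially"
        by (intro eventually_ball_finite) auto
      then show ?thesis unfolding eventually_sequentially by auto
    qed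
    then show "z \<in> (\<Union>s. C k m s)" using z by (auto simp: C_def P_def)
  next
    fix z assume "z \<in> (\<Union>s. C k m s)"
    then obtain s where s: "z \<in> C k m s" by blast
    have "z \<notin> A k l" if "l < m" for l
    proof -
      have "1 / Suc k + 1 / Suc s \<le> dist (c l) z" using s that by (auto simp: C_def)
      moreover have "1 / real (Suc s) > 0" by simp
      ultimately show ?thesis unfolding A_def mem_cball by linarith
    qed
    then show "z \<in> P k m" using s by (auto simp: P_def C_def)
  qed
  define Z where "Z x = {z. J x z \<noteq> 0 \<and> F x z = 0}" for x
  define q where "q x z = ennreal (B x z / J x z)" for x z
  define e where "e k m x = (SUP z\<in>Z x \<inter> P k m. q x z)" for k m x
  have emeas[measurable]: "e k m \<in> borel_measurable M" for k m
  proof (rule borel_measurableI_greater)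
    fix y :: ennreal
    show "{x \<in> space M. y < e k m x} \<in> sets M"
    proof (cases y)
      case top
      then show ?thesis by simp
    next
      case (real c')
      \<comment> \<open>All three summands are nonnegative, so a zero of \<open>?Q\<close> encodes
        \<open>F = 0\<close> together with two closed inequalities; the margin
        \<open>1 / (r + 1)\<close> in them makes the strict conditions \<open>J > 0\<close> and
        \<open>c' < B / J\<close> a countable union of closed ones.\<close>
      let ?Q = "\<lambda>r x z. norm (F x z) + max 0 (1 / Suc r - J x z) + max 0 ((c' + 1 / Suc r) * J x z - B x z)"
      have iff: "y < q x z \<longleftrightarrow> (\<exists>r :: nat. 1 / Suc r \<le> J x z \<and> (c' + 1 / Suc r) * J x z \<le> B x z)" if "J x z \<noteq> 0" for x z
      proof -
        have J: "J x z > 0" using that Jpos[of x z] by simp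
        have "y < q x z \<longleftrightarrow> c' < B x z / J x z"
          unfolding q_def real(2) using real(1) by (intro ennreal_less_iff)
        also have "\<dots> \<longleftrightarrow> (\<exists>r :: nat. 1 / Suc r \<le> J x z \<and> c' + 1 / Suc r \<le> B x z / J x z)"
        proof
          assume l: "c' < B x z / J x z"
          obtain r :: nat where "inverse (real (Suc r)) < min (J x z) (B x z / J x z - c')"
            using reals_Archimedean[of "min (J x z) (B x z / J x z - c')"] J l by auto
          then show "\<exists>r :: nat. 1 / Suc r \<le> J x z \<and> c' + 1 / Suc r \<le> B x z / J x z"
            by (intro exI[of _ r]) (simp add: inverse_eq_divide)
        next
          assume "\<exists>r :: nat. 1 / Suc r \<le> J x z \<and> c' + 1 / Suc r \<le> B x z / J x z"
          then obtain r :: nat where "c' + 1 / Suc r \<le> B x z / J x z" by blast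
          moreover have "1 / real (Suc r) > 0" by simp
          ultimately show "c' < B x z / J x z" by linarith
        qed
        also have "\<dots> \<longleftrightarrow> (\<exists>r :: nat. 1 / Suc r \<le> J x z \<and> (c' + 1 / Suc r) * J x z \<le> B x z)"
          using J by (simp add: pos_le_divide_eq)
        finally show ?thesis .
      qed
      have "y < e k m x \<longleftrightarrow> (\<exists>r s. \<exists>z\<in>C k m s. ?Q r x z = 0)" for x
      proof -
        have z0: "?Q r x z = 0 \<longleftrightarrow> F x z = 0 \<and> 1 / Suc r \<le> J x z \<and> (c' + 1 / Suc r) * J x z \<le> B x z" for r z
          by (auto simp: add_nonneg_eq_0_iff max_def)
        have Jnz: "1 / real (Suc r) \<le> J x z \<Longrightarrow> J x z \<noteq> 0" for r z
          by (metis divide_pos_pos leD of_nat_0_less_iff zero_less_Suc zero_less_one)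
        have "y < e k m x \<longleftrightarrow> (\<exists>z\<in>Z x \<inter> P k m. y < q x z)" unfolding e_def less_SUP_iff ..
        also have "\<dots> \<longleftrightarrow> (\<exists>z\<in>P k m. F x z = 0 \<and> (\<exists>r :: nat. 1 / Suc r \<le> J x z \<and> (c' + 1 / Suc r) * J x z \<le> B x z))"
          using iff Jnz unfolding Z_def by blast
        finally show ?thesis unfolding z0 PC by blast
      qed
      then have "{x \<in> space M. y < e k m x} = (\<Union>r. \<Union>s. {x \<in> space M. \<exists>z\<in>C k m s. ?Q r x z = 0})" by blast
      moreover have "{x \<in> space M. \<exists>z\<in>C k m s. ?Q r x z = 0} \<in> sets M" for r s
        by (rule sets_ex_zero[OF _ _ _ Cclosed])
           (measurable, auto intro!: continuous_on_add continuous_on_norm continuous_on_max continuous_on_diff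
             continuous_on_mult continuous_on_const Fc Jc Bc add_nonneg_nonneg)
      ultimately show ?thesis by auto
    qed
  qed
  have "(\<integral>\<^sup>+z. q x z \<partial>count_space (Z x)) = (SUP k. \<Sum>m. e k m x)" if x: "x \<in> space M" for x
  proof (rule antisym)
    have one: "(\<Sum>m. indicator (P k m) z :: ennreal) = 1" for k z
    proof -
      have "(\<Sum>m. indicator (P k m) z :: ennreal) = indicator (\<Union>m. P k m) z"
        by (rule suminf_indicator) (use Pdisj in \<open>auto simp: disjoint_family_on_def\<close>)
      then show ?thesis using Pcover[of z k] by (simp add: indicator_def)
    qed
    have cells: "(\<integral>\<^sup>+z. g z \<partial>count_space (Z x)) = (\<Sum>m. \<integral>\<^sup>+z. g z * indicator (P k m) z \<partial>count_space (Z x))" for g k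
      by (subst nn_integral_suminf[symmetric]) (simp_all add: ennreal_suminf_cmult one)
    show "(SUP k. \<Sum>m. e k m x) \<le> (\<integral>\<^sup>+z. q x z \<partial>count_space (Z x))"
    proof (rule SUP_least)
      fix k
      have "e k m x \<le> (\<integral>\<^sup>+z. q x z * indicator (P k m) z \<partial>count_space (Z x))" for m
        unfolding e_def
      proof (rule SUP_least)
        fix z assume "z \<in> Z x \<inter> P k m"
        then show "q x z \<le> (\<integral>\<^sup>+z. q x z * indicator (P k m) z \<partial>count_space (Z x))"
          using nn_integral_ge_point[of z "Z x" "\<lambda>z. q x z * indicator (P k m) z"] by simp
      qed
      then show "(\<Sum>m. e k m x) \<le> (\<integral>\<^sup>+z. q x z \<partial>count_space (Z x))"
        by (subst cells[of "q x" k]) (intro suminf_le, auto)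
    qed
    \<comment> \<open>Zeros that have no other zero within the diameter bound of the cells at level
      \<open>k\<close>, so that they are alone in their cell. By isolation every zero belongs to
      \<open>Z' k\<close> for large \<open>k\<close>, which gives the inequality from the sum to the
      supremum.\<close>
    define Z' where "Z' k = {z \<in> Z x. \<forall>y\<in>Z x. dist y z \<le> 2 / Suc k \<longrightarrow> y = z}" for k
    have mono: "Z' k \<subseteq> Z' l" if "k \<le> l" for k l
    proof -
      have "2 / Suc l \<le> 2 / real (Suc k)" using that by (intro divide_left_mono) auto
      then show ?thesis unfolding Z'_def by (auto dest: order_trans)
    qed
    have ex: "\<exists>k. z \<in> Z' k" if z: "z \<in> Z x" for z
    proof -
      obtain r where r: "r > 0" "\<forall>y\<in>ball z r. F x y = 0 \<longrightarrow> y = z"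
        using isol[OF x, of z] z by (auto simp: Z_def)
      obtain k :: nat where "inverse (real (Suc k)) < r / 2" using reals_Archimedean[of "r / 2"] r by auto
      then have "2 / real (Suc k) < r" by (simp add: inverse_eq_divide)
      then have "z \<in> Z' k" using z r by (auto simp: Z'_def Z_def dist_commute)
      then show ?thesis by blast
    qed
    have "(\<integral>\<^sup>+z. q x z \<partial>count_space (Z x)) = (\<integral>\<^sup>+z. (SUP k. q x z * indicator (Z' k) z) \<partial>count_space (Z x))"
    proof (rule nn_integral_cong)
      fix z assume "z \<in> space (count_space (Z x))"
      then obtain k where "z \<in> Z' k" using ex by auto
      then have "q x z \<le> (SUP k. q x z * indicator (Z' k) z)" by (intro SUP_upper2[of k]) auto
      moreover have "(SUP k. q x z * indicator (Z' k) z) \<le> q x z" by (intro SUP_least) (auto simp: indicator_def)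
      ultimately show "q x z = (SUP k. q x z * indicator (Z' k) z)" by simp
    qed
    also have "\<dots> = (SUP k. \<integral>\<^sup>+z. q x z * indicator (Z' k) z \<partial>count_space (Z x))"
      using mono by (intro nn_integral_monotone_convergence_SUP) (auto simp: incseq_def le_fun_def indicator_def)
    also have "\<dots> \<le> (SUP k. \<Sum>m. e k m x)"
    proof (rule SUP_mono, rule bexI)
      fix k
      have "(\<integral>\<^sup>+z. q x z * indicator (Z' k) z * indicator (P k m) z \<partial>count_space (Z x)) \<le> e k m x" for m
      proof (cases "Z' k \<inter> P k m = {}")
        case True
        then have "(\<integral>\<^sup>+z. q x z * indicator (Z' k) z * indicator (P k m) z \<partial>count_space (Z x)) = (\<integral>\<^sup>+z. 0 \<partial>count_space (Z x))"
          by (intro nn_integral_cong) (auto simp: indicator_def)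
        then show ?thesis by simp
      next
        case False
        then obtain z0 where z0: "z0 \<in> Z' k" "z0 \<in> P k m" by blast
        then have z0Z: "z0 \<in> Z x" by (auto simp: Z'_def)
        have "(\<integral>\<^sup>+z. q x z * indicator (Z' k) z * indicator (P k m) z \<partial>count_space (Z x)) = (\<integral>\<^sup>+z. q x z0 * indicator {z0} z \<partial>count_space (Z x))"
        proof (rule nn_integral_cong)
          fix z assume "z \<in> space (count_space (Z x))"
          then have zz: "z = z0" if "z \<in> P k m" using that z0 Pdist[of z k m z0] by (auto simp: Z'_def)
          show "q x z * indicator (Z' k) z * indicator (P k m) z = q x z0 * indicator {z0} z"
          proof (cases "z = z0")
            case True
            then show ?thesis using z0 by simp
          next
            case False
            then have "z \<notin> P k m" using zz by blast
            then show ?thesis using False by simp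
          qed
        qed
        also have "\<dots> = q x z0" using z0Z by (simp add: nn_integral_cmult_indicator)
        also have "\<dots> \<le> e k m x" unfolding e_def using z0 z0Z by (intro SUP_upper) auto
        finally show ?thesis .
      qed
      then show "(\<integral>\<^sup>+z. q x z * indicator (Z' k) z \<partial>count_space (Z x)) \<le> (\<Sum>m. e k m x)"
        by (subst cells[of "\<lambda>z. q x z * indicator (Z' k) z" k]) (intro suminf_le, auto)
    qed simp
    finally show "(\<integral>\<^sup>+z. q x z \<partial>count_space (Z x)) \<le> (SUP k. \<Sum>m. e k m x)" .
  qed
  moreover have "(\<lambda>x. SUP k. \<Sum>m. e k m x) \<in> borel_measurable M" by measurable
  ultimately show ?thesis
    unfolding q_def Z_def by (subst measurable_cong) auto
qed

subsection \<open>Cofactors\<close>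

text \<open>The cofactors along row \<open>j\<close>, that is, column \<open>j\<close> of the
  adjugate matrix.\<close>

definition cofvec :: "'n::finite \<Rightarrow> complex ^ 'n ^ 'n \<Rightarrow> complex ^ 'n" where
  "cofvec j A = (\<chi> k. det (\<chi> i. if i = j then axis k 1 else A $ i))"

lemma det_replace_row: "det (\<chi> i. if i = j then b else A $ i) = (\<Sum>k\<in>UNIV. b $ k * cofvec j A $ k)"
proof -
  have b: "b = (\<Sum>k\<in>UNIV. b $ k *s axis k 1)"
    by (simp add: vec_eq_iff axis_def if_distrib[of "\<lambda>x. _ * x"] cong: if_cong)
  have "det (\<chi> i. if i = j then b else A $ i) = det (\<chi> i. if i = j then (\<Sum>k\<in>UNIV. b $ k *s axis k 1) else A $ i)"
    by (simp only: b[symmetric])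
  also have "\<dots> = (\<Sum>k\<in>UNIV. det (\<chi> i. if i = j then b $ k *s axis k 1 else A $ i))"
    by (rule det_linear_row_sum) simp
  also have "\<dots> = (\<Sum>k\<in>UNIV. b $ k * cofvec j A $ k)"
    by (simp add: det_row_mul cofvec_def)
  finally show ?thesis .
qed

lemma det_cofvec: "det A = (\<Sum>k\<in>UNIV. A $ j $ k * cofvec j A $ k)"
proof -
  have "(\<chi> i. if i = j then A $ j else A $ i) = A" by (simp add: vec_eq_iff)
  then show ?thesis using det_replace_row[of j "A $ j" A] by simp
qed

text \<open>Expanding along row \<open>j\<close> after replacing it by row \<open>i\<close> gives a
  determinant with two equal rows unless \<open>i = j\<close>. For invertible \<open>A\<close> the
  columns of the inverse are therefore the cofactor vectors divided by the determinant.\<close>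

lemma mult_cofvec: "A *v cofvec j A = axis j (det A)"
proof -
  have "(\<Sum>k\<in>UNIV. A $ i $ k * cofvec j A $ k) = (if i = j then det A else 0)" for i
  proof (cases "i = j")
    case True
    then show ?thesis using det_cofvec[of A j] by simp
  next
    case False
    have "det (\<chi> l. if l = j then A $ i else A $ l) = 0"
      by (rule det_identical_rows[OF False]) (use False in \<open>auto simp: row_def vec_eq_iff\<close>)
    then show ?thesis using False det_replace_row[of j "A $ i" A] by simp
  qed
  then show ?thesis by (simp add: vec_eq_iff matrix_vector_mult_def axis_def)
qed

text \<open>Cofactors along row \<open>j\<close> do not see row \<open>j\<close>. This makes the
  Jacobian determinant a fixed linear functional of equation \<open>j\<close> once the other
  equations are held fixed.\<close>

lemma cofvec_cong:
  assumes "\<And>i. i \<noteq> j \<Longrightarrow> A $ i = A' $ i" shows "cofvec j A = cofvec j A'"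
proof -
  have "(\<chi> i. if i = j then axis k 1 else A $ i) = (\<chi> i. if i = j then axis k 1 else A' $ i)" for k
    using assms by (auto simp: vec_eq_iff)
  then show ?thesis by (simp add: cofvec_def)
qed

subsection \<open>Continuity and measurability of the chart quantities\<close>

lemma continuous_on_eval_hpoly:
  assumes "\<And>\<alpha>. continuous_on S (\<lambda>w. p w \<alpha>)" "\<And>v. continuous_on S (\<lambda>w. x w $ v)"
  shows "continuous_on S (\<lambda>w. eval_hpoly d (p w) (x w))"
  unfolding eval_hpoly_def
  by (intro continuous_on_sum continuous_on_mult continuous_on_prod continuous_on_power assms)

lemma continuous_on_deriv_hpoly:
  assumes "\<And>\<alpha>. continuous_on S (\<lambda>w. p w \<alpha>)" "\<And>v. continuous_on S (\<lambda>w. x w $ v)" "\<And>v. continuous_on S (\<lambda>w. u w $ v)"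
  shows "continuous_on S (\<lambda>w. deriv_hpoly d (p w) (x w) (u w))"
  unfolding deriv_hpoly_def dmon_def
  by (intro continuous_on_sum continuous_on_mult continuous_on_prod continuous_on_power continuous_on_const assms)

lemma continuous_on_pt: "continuous_on S z \<Longrightarrow> continuous_on S (\<lambda>w. pt (z w) $ v)"
  and continuous_on_emb: "continuous_on S z \<Longrightarrow> continuous_on S (\<lambda>w. emb (z w) $ v)"
  by (cases v; simp add: continuous_on_component)+

lemma continuous_on_vecI:
  fixes f :: "'a::topological_space \<Rightarrow> 'b::real_normed_vector ^ 'n::finite"
  assumes "\<And>v. continuous_on S (\<lambda>x. f x $ v)" shows "continuous_on S f"
  using continuous_on_vec_lambda[of S "\<lambda>v x. f x $ v"] assms by simp

lemma continuous_on_chart_map: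
  assumes "\<And>i \<alpha>. continuous_on S (\<lambda>w. f w i \<alpha>)" "continuous_on S z"
  shows "continuous_on S (\<lambda>w. chart_map d (f w) (z w))"
  unfolding chart_map_def eval_system_def
  by (intro continuous_on_vec_lambda continuous_on_eval_hpoly continuous_on_pt assms)

lemma continuous_on_chart_jac:
  assumes "\<And>i \<alpha>. continuous_on S (\<lambda>w. f w i \<alpha>)" "continuous_on S z"
  shows "continuous_on S (\<lambda>w. chart_jac d (f w) (z w))"
  unfolding chart_jac_def
  by (intro continuous_on_vec_lambda continuous_on_deriv_hpoly continuous_on_pt continuous_on_const assms)

lemma continuous_on_riesz_sq:
  assumes "continuous_on S z" "continuous_on S w"
  shows "continuous_on S (\<lambda>x. riesz_sq d (z x) (w x))"
proof -
  have pt: "continuous_on S (\<lambda>x. pt (z x))" and emb: "continuous_on S (\<lambda>x. emb (w x))"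
    by (intro continuous_on_vecI continuous_on_pt continuous_on_emb assms)+
  have cj: "continuous_on S (\<lambda>x. cnjv (pt (z x)) $ v)" for v
    unfolding cnjv_def by (simp, rule continuous_on_cnj, rule continuous_on_component, rule pt)
  have dt: "continuous_on S (\<lambda>x. dot (emb (w x)) (cnjv (pt (z x))))"
    unfolding dot_def
    by (rule continuous_on_sum, rule continuous_on_mult, rule continuous_on_component, rule emb, rule cj)
  have nr: "continuous_on S (\<lambda>x. norm (pt (z x)))" by (rule continuous_on_norm, rule pt)
  have quot: "continuous_on S (\<lambda>x. dot (emb (w x)) (cnjv (pt (z x))) / of_real ((norm (pt (z x)))\<^sup>2))"
    by (rule continuous_on_divide, rule dt, rule continuous_on_of_real, rule continuous_on_power, rule nr) simp
  have "continuous_on S (\<lambda>x. tangent (z x) (w x))"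
  proof (rule continuous_on_vecI)
    fix v
    have eq: "tangent (z x) (w x) $ v = emb (w x) $ v
        - (dot (emb (w x)) (cnjv (pt (z x))) / of_real ((norm (pt (z x)))\<^sup>2)) * pt (z x) $ v" for x
      by (simp only: tangent_def vector_minus_component vector_smult_component)
    show "continuous_on S (\<lambda>x. tangent (z x) (w x) $ v)"
      unfolding eq by (rule continuous_on_diff, rule continuous_on_component, rule emb, rule continuous_on_mult,
          rule quot, rule continuous_on_component, rule pt)
  qed
  then show ?thesis
    unfolding riesz_sq_def
    by - (rule continuous_on_mult, rule continuous_on_mult, rule continuous_on_const, rule continuous_on_power,
        rule nr, rule continuous_on_power, rule continuous_on_norm)
qed

lemma continuous_on_cofvec:
  assumes A: "continuous_on S A"
  shows "continuous_on S (\<lambda>x. cofvec j (A x))"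
  unfolding cofvec_def
proof (intro continuous_on_vec_lambda continuous_on_det)
  fix k i l
  show "continuous_on S (\<lambda>x. (\<chi> i. if i = j then axis k 1 else A x $ i) $ i $ l)"
    by (cases "i = j") (simp_all add: continuous_on_const continuous_on_matrix_entry[OF A])
qed

lemma borel_measurable_vec_nth: "h \<in> borel_measurable N \<Longrightarrow> (\<lambda>w. h w $ v) \<in> borel_measurable N"
  for h :: "'a \<Rightarrow> ('b::{second_countable_topology,real_normed_vector}) ^ 'n::finite"
  by (rule measurable_compose[of h N borel "\<lambda>x. x $ v"])
     (auto intro!: borel_measurable_continuous_onI linear_continuous_on bounded_linear_vec_nth)

lemma borel_measurable_vecI:
  fixes h :: "'a \<Rightarrow> complex ^ 'n::finite"
  assumes "\<And>i. (\<lambda>w. h w $ i) \<in> borel_measurable N"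
  shows "h \<in> borel_measurable N"
proof (rule borel_measurable_euclidean_space[THEN iffD2], rule ballI)
  fix b :: "complex ^ 'n" assume "b \<in> Basis"
  then obtain i c where b: "b = axis i c" by (auto simp: Basis_vec_def)
  note assms[of i, measurable]
  have "(\<lambda>w. h w $ i \<bullet> c) \<in> borel_measurable N" by measurable
  then show "(\<lambda>w. h w \<bullet> b) \<in> borel_measurable N" by (simp add: b inner_axis)
qed

lemma borel_measurable_pt_nth: "z \<in> borel_measurable N \<Longrightarrow> (\<lambda>w. pt (z w) $ v) \<in> borel_measurable N"
  by (cases v) (simp_all add: borel_measurable_vec_nth)

lemma borel_measurable_chart_map:
  fixes z :: "'a \<Rightarrow> complex ^ 'n::finite"
  assumes f: "f \<in> measurable N (system_lebesgue d)" and z: "z \<in> borel_measurable N"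
  shows "(\<lambda>w. chart_map d (f w) (z w)) \<in> borel_measurable N"
  unfolding chart_map_def eval_system_def
  by (rule borel_measurable_vecI)
     (simp, rule measurable_eval_hpoly[OF measurable_compose[OF f measurable_system_coef] borel_measurable_pt_nth[OF z]])

lemma borel_measurable_chart_jac:
  fixes z :: "'a \<Rightarrow> complex ^ 'n::finite"
  assumes f: "f \<in> measurable N (system_lebesgue d)" and z: "z \<in> borel_measurable N"
  shows "(\<lambda>w. chart_jac d (f w) (z w) $ i $ k) \<in> borel_measurable N"
  unfolding chart_jac_def
  by (simp, rule measurable_deriv_hpoly[OF measurable_compose[OF f measurable_system_coef] borel_measurable_pt_nth[OF z] borel_measurable_const])

lemma borel_measurable_det:
  fixes A :: "'a \<Rightarrow> complex ^ 'n::finite ^ 'n"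
  assumes A: "\<And>i k. (\<lambda>w. A w $ i $ k) \<in> borel_measurable N"
  shows "(\<lambda>w. det (A w)) \<in> borel_measurable N"
proof -
  note A[measurable]
  show ?thesis unfolding det_def by measurable
qed

lemma borel_measurable_cofvec:
  fixes A :: "'a \<Rightarrow> complex ^ 'n::finite ^ 'n"
  assumes A: "\<And>i k. (\<lambda>w. A w $ i $ k) \<in> borel_measurable N"
  shows "(\<lambda>w. cofvec j (A w)) \<in> borel_measurable N"
proof (rule borel_measurable_vecI)
  fix k
  have "(\<lambda>w. det (\<chi> i. if i = j then axis k 1 else A w $ i)) \<in> borel_measurable N"
  proof (rule borel_measurable_det)
    fix i l
    show "(\<lambda>w. (\<chi> i. if i = j then axis k 1 else A w $ i) $ i $ l) \<in> borel_measurable N"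
      by (cases "i = j") (simp_all add: A)
  qed
  then show "(\<lambda>w. cofvec j (A w) $ k) \<in> borel_measurable N" by (simp add: cofvec_def)
qed

lemma borel_measurable_riesz_sq:
  fixes z w :: "'a \<Rightarrow> complex ^ 'n::finite"
  assumes "z \<in> borel_measurable N" "w \<in> borel_measurable N"
  shows "(\<lambda>x. riesz_sq d (z x) (w x)) \<in> borel_measurable N"
proof -
  have "(\<lambda>x. (z x, w x)) \<in> measurable N (borel \<Otimes>\<^sub>M borel)" using assms by measurable
  moreover have "(\<lambda>(z, w). riesz_sq d z w) \<in> borel_measurable (borel \<Otimes>\<^sub>M borel)"
    unfolding borel_prod case_prod_beta
    by (intro borel_measurable_continuous_onI continuous_on_riesz_sq continuous_on_fst continuous_on_snd continuous_on_id)
  ultimately have "(\<lambda>x. (\<lambda>(z, w). riesz_sq d z w) (z x, w x)) \<in> borel_measurable N"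
    by (rule measurable_compose)
  then show ?thesis by simp
qed

subsection \<open>The Kac--Rice formula\<close>

definition const_shift :: "('n::finite \<Rightarrow> nat) \<Rightarrow> complex ^ 'n \<Rightarrow> 'n \<Rightarrow> 'n hpoly" where
  "const_shift d e = (\<lambda>i \<alpha>. if \<alpha> = const_index (d i) then e $ i else 0)"

definition const_coefs :: "('n::finite \<Rightarrow> nat) \<Rightarrow> ('n \<Rightarrow> 'n hpoly) \<Rightarrow> complex ^ 'n" where
  "const_coefs d f = (\<chi> i. f i (const_index (d i)))"

definition shift_const :: "('n::finite \<Rightarrow> nat) \<Rightarrow> ('n \<Rightarrow> 'n hpoly) \<Rightarrow> complex ^ 'n \<Rightarrow> 'n \<Rightarrow> 'n hpoly" where
  "shift_const d f e = sshift d f (const_shift d e)"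

lemma eval_hshift: "eval_hpoly d (hshift d p q) x = eval_hpoly d p x + eval_hpoly d q x"
  and deriv_hshift: "deriv_hpoly d (hshift d p q) x u = deriv_hpoly d p x u + deriv_hpoly d q x u"
  by (simp_all add: eval_hpoly_def deriv_hpoly_def hshift_def algebra_simps sum.distrib)

lemma chart_map_shift_const: "chart_map d (shift_const d f e) z = chart_map d f z + e"
  by (simp add: vec_eq_iff chart_map_def eval_system_def shift_const_def sshift_def eval_hshift const_shift_def eval_hpoly_single)

lemma chart_jac_shift_const: "chart_jac d (shift_const d f e) z = chart_jac d f z"
  by (simp add: vec_eq_iff chart_jac_def shift_const_def sshift_def deriv_hshift const_shift_def deriv_hpoly_single)

lemma measurable_shift_const:
  assumes f: "f \<in> measurable N (system_lebesgue d)" and e: "e \<in> borel_measurable N"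
  shows "(\<lambda>w. shift_const d (f w) (e w)) \<in> measurable N (system_lebesgue d)"
  unfolding shift_const_def const_shift_def
proof (rule measurable_sshift[OF f])
  fix i \<alpha>
  show "(\<lambda>w. if \<alpha> = const_index (d i) then e w $ i else 0) \<in> borel_measurable N"
    by (cases "\<alpha> = const_index (d i)") (simp_all add: borel_measurable_vec_nth e)
qed

lemma const_coefs_measurable: "const_coefs d \<in> borel_measurable (system_lebesgue d)"
  by (rule borel_measurable_vecI) (simp add: const_coefs_def measurable_system_coef)

text \<open>The weight is divided by the real Jacobian of the chart map, which the area formula
  multiplies back in. With \<open>B\<close> equal to that Jacobian it counts nondegenerate
  zeros.\<close>

definition zero_sum :: "('n::finite \<Rightarrow> nat) \<Rightarrow> (('n \<Rightarrow> 'n hpoly) \<Rightarrow> complex ^ 'n \<Rightarrow> real) \<Rightarrow> ('n \<Rightarrow> 'n hpoly) \<Rightarrow> ennreal" where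
  "zero_sum d B f = (\<integral>\<^sup>+z. ennreal (B f z / (norm (det (chart_jac d f z)))\<^sup>2)
     \<partial>count_space {z. det (chart_jac d f z) \<noteq> 0 \<and> chart_map d f z = 0})"

lemma chart_zeros_isolated:
  assumes "det (chart_jac d f z) \<noteq> 0" "chart_map d f z = 0"
  shows "\<exists>r>0. \<forall>y\<in>ball z r. chart_map d f y = 0 \<longrightarrow> y = z"
proof -
  have "\<exists>r>0. inj_on (chart_map d f) (ball z r)"
  proof (rule C1_locally_injective[OF has_derivative_chart_map])
    show "continuous_on UNIV (\<lambda>x. chart_jac d f x *v v)" for v
      by (intro continuous_on_matrix_vector_mult continuous_on_chart_jac continuous_on_const continuous_on_id)
    show "inj ((*v) (chart_jac d f z))" by (rule inj_matrix_vector_mult[OF assms(1)])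
  qed
  then obtain r where r: "r > 0" "inj_on (chart_map d f) (ball z r)" by blast
  have "y = z" if "y \<in> ball z r" "chart_map d f y = 0" for y
    using inj_onD[OF r(2), of y z] that r(1) assms(2) by auto
  then show ?thesis using r(1) by blast
qed

lemma zero_sum_measurable:
  assumes Bm: "\<And>z. (\<lambda>f. B f z) \<in> borel_measurable (system_lebesgue d)"
    and Bc: "\<And>f. continuous_on UNIV (B f)" and Bpos: "\<And>f z. B f z \<ge> 0"
  shows "zero_sum d B \<in> borel_measurable (system_lebesgue d)"
proof -
  have "(\<lambda>f. \<integral>\<^sup>+z. ennreal (B f z / (norm (det (chart_jac d f z)))\<^sup>2)
     \<partial>count_space {z. (norm (det (chart_jac d f z)))\<^sup>2 \<noteq> 0 \<and> chart_map d f z = 0}) \<in> borel_measurable (system_lebesgue d)"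
  proof (rule borel_measurable_sum_zeros)
    fix z
    show "(\<lambda>f. chart_map d f z) \<in> borel_measurable (system_lebesgue d)"
      by (rule borel_measurable_chart_map) auto
    have [measurable]: "(\<lambda>f. det (chart_jac d f z)) \<in> borel_measurable (system_lebesgue d)"
      by (rule borel_measurable_det, rule borel_measurable_chart_jac) auto
    show "(\<lambda>f. (norm (det (chart_jac d f z)))\<^sup>2) \<in> borel_measurable (system_lebesgue d)" by measurable
  next
    fix f
    show "continuous_on UNIV (chart_map d f)"
      by (intro continuous_on_chart_map continuous_on_const continuous_on_id)
    show "continuous_on UNIV (\<lambda>z. (norm (det (chart_jac d f z)))\<^sup>2)"
      by (intro continuous_on_power continuous_on_norm continuous_on_det continuous_on_matrix_entry continuous_on_chart_jac continuous_on_const continuous_on_id)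
    fix z assume "(norm (det (chart_jac d f z)))\<^sup>2 \<noteq> 0" "chart_map d f z = 0"
    then show "\<exists>r>0. \<forall>y\<in>ball z r. chart_map d f y = 0 \<longrightarrow> y = z"
      by (intro chart_zeros_isolated) auto
  qed (use Bm Bc Bpos in auto)
  then show ?thesis by (simp add: zero_sum_def[abs_def])
qed

text \<open>Averaging over constant shifts \<open>e\<close>: the zeros of the shifted system form
  the fibre of \<open>chart_map d f\<close> over \<open>- e\<close>, so integrating over
  \<open>e\<close> is the area formula for that one map. The weight has to be shift invariant, as
  the Jacobian is. On the right, \<open>f\<close> enters the density corrected so as to vanish at
  \<open>z\<close>.\<close>

theorem kac_rice:
  fixes d :: "'n::finite \<Rightarrow> nat" and B :: "('n \<Rightarrow> 'n hpoly) \<Rightarrow> complex ^ 'n \<Rightarrow> real"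
  assumes Bm: "(\<lambda>(f, z). B f z) \<in> borel_measurable (system_lebesgue d \<Otimes>\<^sub>M borel)"
    and Bc: "\<And>f. continuous_on UNIV (B f)" and Bpos: "\<And>f z. B f z \<ge> 0"
    and Bshift: "\<And>f e z. B (shift_const d f e) z = B f z"
    and \<rho>: "\<rho> \<in> borel_measurable (system_lebesgue d)"
  shows "(\<integral>\<^sup>+f. \<rho> f * zero_sum d B f \<partial>system_lebesgue d)
    = (\<integral>\<^sup>+z. (\<integral>\<^sup>+f. indicator (cbox 0 One) (const_coefs d f) * (\<rho> (shift_const d f (- chart_map d f z))
        * ennreal ((if det (chart_jac d f z) = 0 then 0 else 1) * B f z)) \<partial>system_lebesgue d) \<partial>lborel)"
proof -
  let ?L = "system_lebesgue d"
  interpret L: sigma_finite_measure ?L by (rule sigma_finite_system_lebesgue)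
  interpret P: pair_sigma_finite "lborel :: (complex ^ 'n) measure" ?L ..
  note \<rho>[measurable]
  have B1: "(\<lambda>f. B f z) \<in> borel_measurable ?L" for z
    using measurable_compose[OF _ Bm, of "\<lambda>f. (f, z)" ?L] by simp
  have zs[measurable]: "zero_sum d B \<in> borel_measurable ?L"
    by (rule zero_sum_measurable[OF B1 Bc Bpos])
  have inner: "(\<integral>\<^sup>+e. \<rho> (shift_const d f e) * zero_sum d B (shift_const d f e) \<partial>lborel)
     = (\<integral>\<^sup>+z. \<rho> (shift_const d f (- chart_map d f z)) * ennreal ((if det (chart_jac d f z) = 0 then 0 else 1) * B f z) \<partial>lborel)"
    if f: "f \<in> space ?L" for f
  proof -
    let ?H = "\<lambda>e. \<rho> (shift_const d f e) * zero_sum d B (shift_const d f e)"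
    let ?k = "\<lambda>z. \<rho> (shift_const d f (- chart_map d f z)) * ennreal (B f z / (norm (det (chart_jac d f z)))\<^sup>2)"
    have sm: "(\<lambda>e. shift_const d f e) \<in> measurable borel ?L"
      by (rule measurable_shift_const) (use f in auto)
    have Hm[measurable]: "?H \<in> borel_measurable borel"
      using measurable_compose[OF sm \<rho>] measurable_compose[OF sm zs] by measurable
    \<comment> \<open>On the fibre over \<open>a\<close> one has \<open>a = chart_map d f z\<close>,
      so the density, which depends on \<open>a\<close>, can be moved inside the sum as a function
      of \<open>z\<close>.\<close>
    have Hk: "?H (- a) = (\<integral>\<^sup>+z. ?k z \<partial>count_space {z. det (chart_jac d f z) \<noteq> 0 \<and> chart_map d f z = a})" for a
    proof -
      have "?H (- a) = (\<integral>\<^sup>+z. \<rho> (shift_const d f (- a)) * ennreal (B f z / (norm (det (chart_jac d f z)))\<^sup>2)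
         \<partial>count_space {z. det (chart_jac d f z) \<noteq> 0 \<and> chart_map d f z = a})"
        unfolding zero_sum_def by (simp add: nn_integral_cmult chart_map_shift_const chart_jac_shift_const Bshift)
      also have "\<dots> = (\<integral>\<^sup>+z. ?k z \<partial>count_space {z. det (chart_jac d f z) \<noteq> 0 \<and> chart_map d f z = a})"
        by (rule nn_integral_cong) auto
      finally show ?thesis .
    qed
    have cm: "chart_map d f \<in> borel_measurable borel"
      by (intro borel_measurable_continuous_onI continuous_on_chart_map continuous_on_const continuous_on_id)
    have jm: "(\<lambda>z. det (chart_jac d f z)) \<in> borel_measurable borel"
      by (intro borel_measurable_continuous_onI continuous_on_det continuous_on_matrix_entry continuous_on_chart_jac continuous_on_const continuous_on_id)
    have bm: "B f \<in> borel_measurable borel" by (rule borel_measurable_continuous_onI[OF Bc])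
    have pm: "(\<lambda>z. \<rho> (shift_const d f (- chart_map d f z))) \<in> borel_measurable borel"
      by (rule measurable_compose[OF _ measurable_compose[OF sm \<rho>]]) (use cm in simp)
    have km: "?k \<in> borel_measurable borel" using pm bm jm by measurable
    have Hm': "(\<lambda>a. ?H (- a)) \<in> borel_measurable borel" by (rule measurable_compose[OF _ Hm]) simp
    have "(\<integral>\<^sup>+e. ?H e \<partial>lborel) = (\<integral>\<^sup>+a. ?H (- a) \<partial>lborel)"
      by (rule nn_integral_lborel_uminus[symmetric]) (rule Hm)
    also have "\<dots> = (\<integral>\<^sup>+z. ?k z * ennreal ((norm (det (chart_jac d f z)))\<^sup>2) \<partial>lborel)"
      unfolding Hk
    proof (rule area_formula_complex[OF has_derivative_chart_map _ km])
      show "continuous_on UNIV (chart_jac d f)"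
        by (intro continuous_on_chart_jac continuous_on_const continuous_on_id)
      show "(\<lambda>a. \<integral>\<^sup>+z. ?k z \<partial>count_space {z. det (chart_jac d f z) \<noteq> 0 \<and> chart_map d f z = a}) \<in> borel_measurable borel"
        using Hm' unfolding Hk .
    qed
    \<comment> \<open>The Jacobian cancels the denominator of \<open>zero_sum\<close> except at
      critical points, where division by zero yields 0; hence the nonvanishing factor.\<close>
    also have "\<dots> = (\<integral>\<^sup>+z. \<rho> (shift_const d f (- chart_map d f z)) * ennreal ((if det (chart_jac d f z) = 0 then 0 else 1) * B f z) \<partial>lborel)"
    proof (rule nn_integral_cong)
      fix z
      have "ennreal (B f z / (norm (det (chart_jac d f z)))\<^sup>2) * ennreal ((norm (det (chart_jac d f z)))\<^sup>2)
         = ennreal ((if det (chart_jac d f z) = 0 then 0 else 1) * B f z)"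
        by (subst ennreal_mult[symmetric]) (auto simp: Bpos)
      then show "?k z * ennreal ((norm (det (chart_jac d f z)))\<^sup>2)
         = \<rho> (shift_const d f (- chart_map d f z)) * ennreal ((if det (chart_jac d f z) = 0 then 0 else 1) * B f z)"
        by (simp add: mult.assoc)
    qed
    finally show ?thesis .
  qed
  let ?I = "\<lambda>f z. indicator (cbox 0 One) (const_coefs d f) * (\<rho> (shift_const d f (- chart_map d f z))
        * ennreal ((if det (chart_jac d f z) = 0 then 0 else 1) * B f z)) :: ennreal"
  have Im: "(\<lambda>(z, f). ?I f z) \<in> borel_measurable (lborel \<Otimes>\<^sub>M ?L)"
  proof -
    have fm: "snd \<in> measurable (lborel \<Otimes>\<^sub>M ?L) ?L" and zm: "fst \<in> borel_measurable (lborel \<Otimes>\<^sub>M ?L)"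
      by auto
    have 1[measurable]: "(\<lambda>w. const_coefs d (snd w)) \<in> borel_measurable (lborel \<Otimes>\<^sub>M ?L)"
      by (rule measurable_compose[OF fm const_coefs_measurable])
    have 2[measurable]: "(\<lambda>w. \<rho> (shift_const d (snd w) (- chart_map d (snd w) (fst w)))) \<in> borel_measurable (lborel \<Otimes>\<^sub>M ?L)"
      by (rule measurable_compose[OF measurable_shift_const[OF fm] \<rho>])
         (intro borel_measurable_uminus borel_measurable_chart_map fm zm)
    have 3[measurable]: "(\<lambda>w. det (chart_jac d (snd w) (fst w))) \<in> borel_measurable (lborel \<Otimes>\<^sub>M ?L)"
      by (intro borel_measurable_det borel_measurable_chart_jac fm zm)
    have "(\<lambda>w. (snd w, fst w)) \<in> measurable (lborel \<Otimes>\<^sub>M ?L) (?L \<Otimes>\<^sub>M borel)" by measurable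
    from measurable_compose[OF this Bm]
    have 4[measurable]: "(\<lambda>w. B (snd w) (fst w)) \<in> borel_measurable (lborel \<Otimes>\<^sub>M ?L)" by simp
    show ?thesis unfolding case_prod_beta by measurable
  qed
  have "(\<integral>\<^sup>+f. \<rho> f * zero_sum d B f \<partial>?L)
    = (\<integral>\<^sup>+f. indicator (cbox 0 One) (const_coefs d f) * (\<integral>\<^sup>+e. \<rho> (sshift d f (const_shift d e)) * zero_sum d B (sshift d f (const_shift d e)) \<partial>lborel) \<partial>?L)"
  proof (rule nn_integral_system_slice)
    show "(\<lambda>e. const_shift d e i \<alpha>) \<in> borel_measurable borel" for i \<alpha>
      unfolding const_shift_def using borel_measurable_vec_nth[of "\<lambda>e :: complex ^ 'n. e" borel i] by auto
    show "const_coefs d (sshift d f (const_shift d e)) = const_coefs d f + e" for f e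
      by (simp add: vec_eq_iff const_coefs_def sshift_def hshift_def const_shift_def)
  qed (auto simp: const_shift_def const_coefs_measurable)
  also have "\<dots> = (\<integral>\<^sup>+f. (\<integral>\<^sup>+z. ?I f z \<partial>lborel) \<partial>?L)"
  proof (rule nn_integral_cong)
    fix f assume f: "f \<in> space ?L"
    have m: "(\<lambda>z. \<rho> (shift_const d f (- chart_map d f z)) * ennreal ((if det (chart_jac d f z) = 0 then 0 else 1) * B f z)) \<in> borel_measurable lborel"
    proof -
      have sm: "(\<lambda>e. shift_const d f e) \<in> measurable borel ?L"
        by (rule measurable_shift_const) (use f in auto)
      have cm: "chart_map d f \<in> borel_measurable borel"
        by (intro borel_measurable_continuous_onI continuous_on_chart_map continuous_on_const continuous_on_id)
      have [measurable]: "(\<lambda>z. det (chart_jac d f z)) \<in> borel_measurable borel"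
        by (intro borel_measurable_continuous_onI continuous_on_det continuous_on_matrix_entry continuous_on_chart_jac continuous_on_const continuous_on_id)
      have [measurable]: "B f \<in> borel_measurable borel" by (rule borel_measurable_continuous_onI[OF Bc])
      have [measurable]: "(\<lambda>z. \<rho> (shift_const d f (- chart_map d f z))) \<in> borel_measurable borel"
        by (rule measurable_compose[OF _ measurable_compose[OF sm \<rho>]]) (use cm in simp)
      show ?thesis by measurable
    qed
    show "indicator (cbox 0 One) (const_coefs d f) * (\<integral>\<^sup>+e. \<rho> (sshift d f (const_shift d e)) * zero_sum d B (sshift d f (const_shift d e)) \<partial>lborel)
      = (\<integral>\<^sup>+z. ?I f z \<partial>lborel)"
      unfolding shift_const_def[symmetric] inner[OF f] by (rule nn_integral_cmult[OF m, symmetric])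
  qed
  also have "\<dots> = (\<integral>\<^sup>+z. (\<integral>\<^sup>+f. ?I f z \<partial>?L) \<partial>lborel)"
    using P.Fubini'[OF Im] by simp
  finally show ?thesis .
qed

subsection \<open>Comparing the Jacobian with its cofactors\<close>

text \<open>The number \<open>\<nu>\<^sub>j\<close> of the overview, at the chart point
  \<open>z\<close>.\<close>

definition cof_weight :: "('n::finite \<Rightarrow> nat) \<Rightarrow> 'n \<Rightarrow> ('n \<Rightarrow> 'n hpoly) \<Rightarrow> complex ^ 'n \<Rightarrow> real" where
  "cof_weight d j f z = riesz_sq (d j) z (cofvec j (chart_jac d f z))"

definition jac_sq :: "('n::finite \<Rightarrow> nat) \<Rightarrow> ('n \<Rightarrow> 'n hpoly) \<Rightarrow> complex ^ 'n \<Rightarrow> real" where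
  "jac_sq d f z = (norm (det (chart_jac d f z)))\<^sup>2"

definition sys_sq :: "('n::finite \<Rightarrow> nat) \<Rightarrow> ('n \<Rightarrow> 'n hpoly) \<Rightarrow> real" where
  "sys_sq d f = (\<Sum>i\<in>UNIV. weyl_sq (d i) (f i))"

lemma cof_weight_nonneg: "cof_weight d j f z \<ge> 0" by (simp add: cof_weight_def riesz_sq_nonneg)

lemma jac_sq_nonneg: "jac_sq d f z \<ge> 0" by (simp add: jac_sq_def)

lemma measurable_cof_weight:
  assumes "f \<in> measurable N (system_lebesgue d)" "z \<in> borel_measurable N"
  shows "(\<lambda>w. cof_weight d j (f w) (z w)) \<in> borel_measurable N"
  unfolding cof_weight_def
  by (intro borel_measurable_riesz_sq borel_measurable_cofvec borel_measurable_chart_jac assms)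

lemma measurable_jac_sq:
  assumes "f \<in> measurable N (system_lebesgue d)" "z \<in> borel_measurable N"
  shows "(\<lambda>w. jac_sq d (f w) (z w)) \<in> borel_measurable N"
proof -
  have [measurable]: "(\<lambda>w. det (chart_jac d (f w) (z w))) \<in> borel_measurable N"
    by (intro borel_measurable_det borel_measurable_chart_jac assms)
  show ?thesis unfolding jac_sq_def by measurable
qed

lemma continuous_on_cof_weight: "continuous_on UNIV (cof_weight d j f)"
  unfolding cof_weight_def[abs_def]
  by (intro continuous_on_riesz_sq continuous_on_id continuous_on_cofvec continuous_on_chart_jac continuous_on_const)

lemma continuous_on_jac_sq: "continuous_on UNIV (jac_sq d f)"
  unfolding jac_sq_def[abs_def]
  by (intro continuous_on_power continuous_on_norm continuous_on_det continuous_on_matrix_entry continuous_on_chart_jac continuous_on_const continuous_on_id)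

lemma measurable_sys_sq:
  assumes "f \<in> measurable N (system_lebesgue d)"
  shows "(\<lambda>w. sys_sq d (\<lambda>i \<alpha>. f w i \<alpha> - g i \<alpha>)) \<in> borel_measurable N"
  unfolding sys_sq_def
  by (intro borel_measurable_sum measurable_weyl_sq borel_measurable_diff borel_measurable_const)
     (rule measurable_compose[OF assms measurable_system_coef])

text \<open>For fixed \<open>z\<close> the integral over equation \<open>j\<close> is taken first.
  The cofactor vector is then constant and \<open>det G\<close> is the derivative of equation
  \<open>j\<close> along it, so \<open>row_second_moment\<close> applies. The squared mean
  \<open>y\<close> is what the inequality discards; it is zero when component \<open>j\<close> of
  the mean vanishes.\<close>

lemma slice_inequality:
  fixes d :: "'n::finite \<Rightarrow> nat" and fhat :: "'n \<Rightarrow> 'n hpoly" and z :: "complex ^ 'n"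
  assumes d: "\<And>i. d i > 0" and \<sigma>: "\<sigma> > 0" and c: "c \<ge> 0"
  defines "\<rho> \<equiv> \<lambda>f. ennreal (c * exp (- (sys_sq d (\<lambda>i \<alpha>. f i \<alpha> - fhat i \<alpha>) / \<sigma>\<^sup>2)))"
  defines "W \<equiv> \<lambda>B :: ('n \<Rightarrow> 'n hpoly) \<Rightarrow> complex ^ 'n \<Rightarrow> real.
     \<integral>\<^sup>+f. indicator (cbox 0 One) (const_coefs d f) * (\<rho> (shift_const d f (- chart_map d f z))
        * ennreal ((if det (chart_jac d f z) = 0 then 0 else 1) * B f z)) \<partial>system_lebesgue d"
  shows "ennreal (\<sigma>\<^sup>2) * W (cof_weight d j) \<le> W (jac_sq d)"
    and "(\<And>\<alpha>. \<alpha> \<in> multi_indices (d j) \<Longrightarrow> fhat j \<alpha> = 0) \<Longrightarrow> ennreal (\<sigma>\<^sup>2) * W (cof_weight d j) = W (jac_sq d)"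
proof -
  let ?L = "system_lebesgue d"
  let ?M = "\<lambda>i. hpoly_lebesgue (d i) :: 'n hpoly measure"
  let ?I = "UNIV - {j}"
  define \<Phi> where "\<Phi> B f = (indicator (cbox 0 One) (const_coefs d f) * (\<rho> (shift_const d f (- chart_map d f z))
        * ennreal ((if det (chart_jac d f z) = 0 then 0 else 1) * B f z)) :: ennreal)" for B :: "('n \<Rightarrow> 'n hpoly) \<Rightarrow> complex ^ 'n \<Rightarrow> real" and f
  have idm: "(\<lambda>f. f) \<in> measurable ?L ?L" by simp
  have \<Phi>m: "\<Phi> B \<in> borel_measurable ?L" if [measurable]: "(\<lambda>f. B f z) \<in> borel_measurable ?L" for B
  proof -
    note const_coefs_measurable[measurable]
    have [measurable]: "\<rho> \<in> borel_measurable ?L"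
    proof -
      note measurable_sys_sq[OF idm, of fhat, measurable]
      show ?thesis unfolding \<rho>_def by measurable
    qed
    have [measurable]: "(\<lambda>f. det (chart_jac d f z)) \<in> borel_measurable ?L"
      by (intro borel_measurable_det borel_measurable_chart_jac idm) simp
    have [measurable]: "(\<lambda>f. \<rho> (shift_const d f (- chart_map d f z))) \<in> borel_measurable ?L"
      by (rule measurable_compose[OF measurable_shift_const[OF idm] \<open>\<rho> \<in> borel_measurable ?L\<close>])
         (intro borel_measurable_uminus borel_measurable_chart_map idm borel_measurable_const)
    show ?thesis unfolding \<Phi>_def by measurable
  qed
  have Bm: "(\<lambda>f. cof_weight d j f z) \<in> borel_measurable ?L" "(\<lambda>f. jac_sq d f z) \<in> borel_measurable ?L"
    by (intro measurable_cof_weight measurable_jac_sq idm borel_measurable_const)+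
  have ins: "insert j ?I = UNIV" by auto
  have fub: "(\<integral>\<^sup>+f. \<Psi> f \<partial>?L) = (\<integral>\<^sup>+x. (\<integral>\<^sup>+p. \<Psi> (x(j := p)) \<partial>?M j) \<partial>Pi\<^sub>M ?I ?M)" if "\<Psi> \<in> borel_measurable ?L" for \<Psi>
    using hpoly.product_nn_integral_insert[of ?I j \<Psi> d] that by (simp add: ins system_lebesgue_def)
  \<comment> \<open>Both inner integrals are expressed through the same factor \<open>X\<close>, so
    comparing them comes down to comparing \<open>\<sigma>\<^sup>2 * r + y\<close> with
    \<open>\<sigma>\<^sup>2 * r\<close>. The value of \<open>x\<close> at \<open>j\<close> is
    irrelevant on the right because cofactors ignore that row.\<close>
  have inner: "(\<integral>\<^sup>+p. \<Phi> (jac_sq d) (x(j := p)) \<partial>?M j)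
      = ennreal (\<sigma>\<^sup>2 * r + y) * X \<and> (\<integral>\<^sup>+p. ennreal (\<sigma>\<^sup>2) * \<Phi> (cof_weight d j) (x(j := p)) \<partial>?M j) = ennreal (\<sigma>\<^sup>2 * r) * X"
    if "r = riesz_sq (d j) z (cofvec j (chart_jac d x z))"
      "y = (norm (deriv_hpoly (d j) (fhat j) (pt z) (tangent z (cofvec j (chart_jac d x z)))))\<^sup>2"
      "X = (\<integral>\<^sup>+p. indicator (cbox 0 One) (\<chi> i. if i = j then p (const_index (d j)) else x i (const_index (d i)))
         * ennreal (c * (\<Prod>i\<in>?I. exp (- (weyl_sq (d i) (\<lambda>\<alpha>. adjust (d i) z (x i) \<alpha> - fhat i \<alpha>) / \<sigma>\<^sup>2))))
         * ennreal ((if deriv_hpoly (d j) p (pt z) (emb (cofvec j (chart_jac d x z))) = 0 then 0 else 1)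
             * exp (- (weyl_sq (d j) (\<lambda>\<alpha>. adjust (d j) z p \<alpha> - fhat j \<alpha>) / \<sigma>\<^sup>2))) \<partial>?M j)" for x r y X
  proof -
    define w where "w = cofvec j (chart_jac d x z)"
    define Y where "Y p = deriv_hpoly (d j) p (pt z) (emb w)" for p
    define Q where "Q p = exp (- (weyl_sq (d j) (\<lambda>\<alpha>. adjust (d j) z p \<alpha> - fhat j \<alpha>) / \<sigma>\<^sup>2))" for p
    define P where "P = c * (\<Prod>i\<in>?I. exp (- (weyl_sq (d i) (\<lambda>\<alpha>. adjust (d i) z (x i) \<alpha> - fhat i \<alpha>) / \<sigma>\<^sup>2)))"
    define h where "h c' = (indicator (cbox 0 One) (\<chi> i. if i = j then c' else x i (const_index (d i))) * ennreal P :: ennreal)" for c'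
    have P0: "P \<ge> 0" unfolding P_def using c by (intro mult_nonneg_nonneg prod_nonneg) auto
    have hm: "h \<in> borel_measurable borel"
    proof -
      have [measurable]: "(\<lambda>c'. \<chi> i. if i = j then c' else x i (const_index (d i))) \<in> borel_measurable borel"
      proof (rule borel_measurable_vecI)
        fix i show "(\<lambda>c'. (\<chi> i. if i = j then c' else x i (const_index (d i))) $ i) \<in> borel_measurable borel"
          by (cases "i = j") simp_all
      qed
      show ?thesis unfolding h_def by measurable
    qed
    have cof: "cofvec j (chart_jac d (x(j := p)) z) = w" for p
      unfolding w_def by (rule cofvec_cong) (simp add: chart_jac_def vec_eq_iff)
    have det: "det (chart_jac d (x(j := p)) z) = Y p" for p
    proof -
      have "det (chart_jac d (x(j := p)) z) = (chart_jac d (x(j := p)) z *v w) $ j"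
        by (subst det_cofvec[of _ j]) (simp only: cof matrix_vector_mult_def vec_lambda_beta)
      then show ?thesis by (simp add: chart_jac_mult Y_def)
    qed
    have kc: "const_coefs d (x(j := p)) = (\<chi> i. if i = j then p (const_index (d j)) else x i (const_index (d i)))" for p
      by (simp add: const_coefs_def vec_eq_iff)
    \<comment> \<open>The correction that makes the system vanish at \<open>z\<close> acts on each
      equation separately, as \<open>adjust\<close>, so the density factors over the
      equations.\<close>
    have rho: "\<rho> (shift_const d (x(j := p)) (- chart_map d (x(j := p)) z)) = ennreal (P * Q p)" for p
    proof -
      let ?f = "x(j := p)"
      have "sys_sq d (\<lambda>i \<alpha>. shift_const d ?f (- chart_map d ?f z) i \<alpha> - fhat i \<alpha>)
          = (\<Sum>i\<in>UNIV. weyl_sq (d i) (\<lambda>\<alpha>. adjust (d i) z (?f i) \<alpha> - fhat i \<alpha>))"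
        unfolding sys_sq_def
        by (intro sum.cong refl weyl_sq_cong)
           (simp add: shift_const_def sshift_def hshift_def const_shift_def adjust_def chart_map_def eval_system_def)
      also have "\<dots> = weyl_sq (d j) (\<lambda>\<alpha>. adjust (d j) z p \<alpha> - fhat j \<alpha>)
          + (\<Sum>i\<in>?I. weyl_sq (d i) (\<lambda>\<alpha>. adjust (d i) z (x i) \<alpha> - fhat i \<alpha>))"
        by (subst sum.remove[of _ j]) (auto intro!: sum.cong)
      finally have "exp (- (sys_sq d (\<lambda>i \<alpha>. shift_const d ?f (- chart_map d ?f z) i \<alpha> - fhat i \<alpha>) / \<sigma>\<^sup>2))
          = Q p * (\<Prod>i\<in>?I. exp (- (weyl_sq (d i) (\<lambda>\<alpha>. adjust (d i) z (x i) \<alpha> - fhat i \<alpha>) / \<sigma>\<^sup>2)))"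
        by (simp add: Q_def exp_add[symmetric] exp_sum[symmetric] sum_negf sum_divide_distrib[symmetric] add_divide_distrib)
      then show ?thesis by (simp add: \<rho>_def P_def mult_ac)
    qed
    have Q0: "Q p \<ge> 0" for p by (simp add: Q_def)
    have phi1: "\<Phi> (jac_sq d) (x(j := p)) = h (p (const_index (d j))) * ennreal ((norm (Y p))\<^sup>2 * Q p)" for p
    proof -
      have "(if Y p = 0 then 0 else 1) * (norm (Y p))\<^sup>2 = (norm (Y p))\<^sup>2" by simp
      then show ?thesis
        unfolding \<Phi>_def h_def kc rho det jac_sq_def using P0 Q0 by (simp add: ennreal_mult mult_ac)
    qed
    have phi2: "ennreal (\<sigma>\<^sup>2) * \<Phi> (cof_weight d j) (x(j := p))
       = ennreal (\<sigma>\<^sup>2 * r) * (h (p (const_index (d j))) * ennreal ((if Y p = 0 then 0 else 1) * Q p))" for p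
      unfolding \<Phi>_def h_def kc rho det cof_weight_def cof that(1) w_def[symmetric]
      using P0 Q0 riesz_sq_nonneg[of "d j" z w] by (simp add: ennreal_mult mult_ac)
    have X: "X = (\<integral>\<^sup>+p. h (p (const_index (d j))) * ennreal ((if Y p = 0 then 0 else 1) * Q p) \<partial>?M j)"
      unfolding that(3) h_def Y_def Q_def P_def w_def ..
    have "(\<integral>\<^sup>+p. \<Phi> (jac_sq d) (x(j := p)) \<partial>?M j) = ennreal (\<sigma>\<^sup>2 * r + y) * X"
      unfolding phi1 X that(1,2) Y_def Q_def w_def[symmetric]
      by (rule row_second_moment[OF \<sigma> d hm])
    moreover have "(\<integral>\<^sup>+p. ennreal (\<sigma>\<^sup>2) * \<Phi> (cof_weight d j) (x(j := p)) \<partial>?M j) = ennreal (\<sigma>\<^sup>2 * r) * X"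
      unfolding phi2 X
    proof (rule nn_integral_cmult)
      have [measurable]: "Y \<in> borel_measurable (?M j)"
        unfolding Y_def by (rule measurable_deriv_hpoly) (auto intro: measurable_hpoly_coef)
      have [measurable]: "(\<lambda>p :: 'n hpoly. h (p (const_index (d j)))) \<in> borel_measurable (?M j)"
        by (rule measurable_compose[OF measurable_hpoly_coef[OF const_index_multi] hm])
      have adj: "(\<lambda>p. adjust (d j) z p \<alpha>) \<in> borel_measurable (?M j)" if "\<alpha> \<in> multi_indices (d j)" for \<alpha>
        unfolding adjust_def using that
        by (cases "\<alpha> = const_index (d j)") (auto intro!: borel_measurable_diff measurable_eval_hpoly measurable_hpoly_coef)
      have [measurable]: "(\<lambda>p. weyl_sq (d j) (\<lambda>\<alpha>. adjust (d j) z p \<alpha> - fhat j \<alpha>)) \<in> borel_measurable (?M j)"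
        by (rule measurable_weyl_sq, rule borel_measurable_diff[OF adj borel_measurable_const])
      have [measurable]: "Q \<in> borel_measurable (?M j)" unfolding Q_def by measurable
      show "(\<lambda>p. h (p (const_index (d j))) * ennreal ((if Y p = 0 then 0 else 1) * Q p)) \<in> borel_measurable (?M j)"
        by measurable
    qed
    ultimately show ?thesis by blast
  qed
  have lhs: "ennreal (\<sigma>\<^sup>2) * W (cof_weight d j) = (\<integral>\<^sup>+x. (\<integral>\<^sup>+p. ennreal (\<sigma>\<^sup>2) * \<Phi> (cof_weight d j) (x(j := p)) \<partial>?M j) \<partial>Pi\<^sub>M ?I ?M)"
  proof -
    have "ennreal (\<sigma>\<^sup>2) * W (cof_weight d j) = (\<integral>\<^sup>+f. ennreal (\<sigma>\<^sup>2) * \<Phi> (cof_weight d j) f \<partial>?L)"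
      unfolding W_def \<Phi>_def[symmetric] by (rule nn_integral_cmult[OF \<Phi>m[of "cof_weight d j", OF Bm(1)], symmetric])
    also have "\<dots> = (\<integral>\<^sup>+x. (\<integral>\<^sup>+p. ennreal (\<sigma>\<^sup>2) * \<Phi> (cof_weight d j) (x(j := p)) \<partial>?M j) \<partial>Pi\<^sub>M ?I ?M)"
      by (rule fub) (intro borel_measurable_times_ennreal borel_measurable_const \<Phi>m[of "cof_weight d j", OF Bm(1)])
    finally show ?thesis .
  qed
  have rhs: "W (jac_sq d) = (\<integral>\<^sup>+x. (\<integral>\<^sup>+p. \<Phi> (jac_sq d) (x(j := p)) \<partial>?M j) \<partial>Pi\<^sub>M ?I ?M)"
    unfolding W_def \<Phi>_def[symmetric] by (rule fub[OF \<Phi>m[of "jac_sq d", OF Bm(2)]])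
  show "ennreal (\<sigma>\<^sup>2) * W (cof_weight d j) \<le> W (jac_sq d)"
    unfolding lhs rhs
  proof (rule nn_integral_mono)
    fix x
    show "(\<integral>\<^sup>+p. ennreal (\<sigma>\<^sup>2) * \<Phi> (cof_weight d j) (x(j := p)) \<partial>?M j) \<le> (\<integral>\<^sup>+p. \<Phi> (jac_sq d) (x(j := p)) \<partial>?M j)"
      unfolding inner[OF refl refl refl, of x, THEN conjunct1] inner[OF refl refl refl, of x, THEN conjunct2]
      by (intro mult_right_mono ennreal_leI) auto
  qed
  assume "\<And>\<alpha>. \<alpha> \<in> multi_indices (d j) \<Longrightarrow> fhat j \<alpha> = 0"
  then have y0: "deriv_hpoly (d j) (fhat j) x u = 0" for x u by (simp add: deriv_hpoly_def)
  show "ennreal (\<sigma>\<^sup>2) * W (cof_weight d j) = W (jac_sq d)"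
    unfolding lhs rhs
  proof (rule nn_integral_cong)
    fix x
    show "(\<integral>\<^sup>+p. ennreal (\<sigma>\<^sup>2) * \<Phi> (cof_weight d j) (x(j := p)) \<partial>?M j) = (\<integral>\<^sup>+p. \<Phi> (jac_sq d) (x(j := p)) \<partial>?M j)"
      unfolding inner[OF refl refl refl, of x, THEN conjunct1] inner[OF refl refl refl, of x, THEN conjunct2]
      by (simp add: y0)
  qed
qed

lemma zero_sum_inequality:
  fixes d :: "'n::finite \<Rightarrow> nat" and fhat :: "'n \<Rightarrow> 'n hpoly"
  assumes d: "\<And>i. d i > 0" and \<sigma>: "\<sigma> > 0" and c: "c \<ge> 0"
  defines "\<rho> \<equiv> \<lambda>f. ennreal (c * exp (- (sys_sq d (\<lambda>i \<alpha>. f i \<alpha> - fhat i \<alpha>) / \<sigma>\<^sup>2)))"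
  shows "ennreal (\<sigma>\<^sup>2) * (\<integral>\<^sup>+f. \<rho> f * zero_sum d (cof_weight d j) f \<partial>system_lebesgue d)
      \<le> (\<integral>\<^sup>+f. \<rho> f * zero_sum d (jac_sq d) f \<partial>system_lebesgue d)"
    and "(\<And>\<alpha>. \<alpha> \<in> multi_indices (d j) \<Longrightarrow> fhat j \<alpha> = 0) \<Longrightarrow>
      ennreal (\<sigma>\<^sup>2) * (\<integral>\<^sup>+f. \<rho> f * zero_sum d (cof_weight d j) f \<partial>system_lebesgue d)
      = (\<integral>\<^sup>+f. \<rho> f * zero_sum d (jac_sq d) f \<partial>system_lebesgue d)"
proof -
  let ?L = "system_lebesgue d"
  have \<rho>m: "\<rho> \<in> borel_measurable ?L"
  proof -
    note measurable_sys_sq[of "\<lambda>f. f" ?L d fhat, measurable]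
    show ?thesis unfolding \<rho>_def by measurable
  qed
  define W where "W B z = (\<integral>\<^sup>+f. indicator (cbox 0 One) (const_coefs d f) * (\<rho> (shift_const d f (- chart_map d f z))
        * ennreal ((if det (chart_jac d f z) = 0 then 0 else 1) * B f z)) \<partial>?L)"
    for B :: "('n \<Rightarrow> 'n hpoly) \<Rightarrow> complex ^ 'n \<Rightarrow> real" and z
  have mc: "(\<lambda>(f, z). cof_weight d j f z) \<in> borel_measurable (?L \<Otimes>\<^sub>M borel)"
    unfolding case_prod_beta by (intro measurable_cof_weight) auto
  have mj: "(\<lambda>(f, z). jac_sq d f z) \<in> borel_measurable (?L \<Otimes>\<^sub>M borel)"
    unfolding case_prod_beta by (intro measurable_jac_sq) auto
  have k1: "(\<integral>\<^sup>+f. \<rho> f * zero_sum d (cof_weight d j) f \<partial>?L) = (\<integral>\<^sup>+z. W (cof_weight d j) z \<partial>lborel)"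
    unfolding W_def
    by (rule kac_rice[OF mc continuous_on_cof_weight cof_weight_nonneg _ \<rho>m]) (simp add: cof_weight_def chart_jac_shift_const)
  have k2: "(\<integral>\<^sup>+f. \<rho> f * zero_sum d (jac_sq d) f \<partial>?L) = (\<integral>\<^sup>+z. W (jac_sq d) z \<partial>lborel)"
    unfolding W_def
    by (rule kac_rice[OF mj continuous_on_jac_sq jac_sq_nonneg _ \<rho>m]) (simp add: jac_sq_def chart_jac_shift_const)
  have Wm: "(\<lambda>z. W (cof_weight d j) z) \<in> borel_measurable lborel"
  proof -
    interpret L: sigma_finite_measure ?L by (rule sigma_finite_system_lebesgue)
    have fm: "snd \<in> measurable (lborel \<Otimes>\<^sub>M ?L) ?L" and zm: "fst \<in> borel_measurable (lborel \<Otimes>\<^sub>M ?L)"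
      by auto
    have [measurable]: "(\<lambda>w. const_coefs d (snd w)) \<in> borel_measurable (lborel \<Otimes>\<^sub>M ?L)"
      by (rule measurable_compose[OF fm const_coefs_measurable])
    have [measurable]: "(\<lambda>w. \<rho> (shift_const d (snd w) (- chart_map d (snd w) (fst w)))) \<in> borel_measurable (lborel \<Otimes>\<^sub>M ?L)"
      by (rule measurable_compose[OF measurable_shift_const[OF fm] \<rho>m])
         (intro borel_measurable_uminus borel_measurable_chart_map fm zm)
    have [measurable]: "(\<lambda>w. det (chart_jac d (snd w) (fst w))) \<in> borel_measurable (lborel \<Otimes>\<^sub>M ?L)"
      by (intro borel_measurable_det borel_measurable_chart_jac fm zm)
    have [measurable]: "(\<lambda>w. cof_weight d j (snd w) (fst w)) \<in> borel_measurable (lborel \<Otimes>\<^sub>M ?L)"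
      by (intro measurable_cof_weight fm zm)
    show ?thesis unfolding W_def by (rule L.borel_measurable_nn_integral) (unfold case_prod_beta, measurable)
  qed
  show "ennreal (\<sigma>\<^sup>2) * (\<integral>\<^sup>+f. \<rho> f * zero_sum d (cof_weight d j) f \<partial>?L)
      \<le> (\<integral>\<^sup>+f. \<rho> f * zero_sum d (jac_sq d) f \<partial>?L)"
    unfolding k1 k2 nn_integral_cmult[OF Wm, symmetric]
    by (rule nn_integral_mono) (unfold W_def \<rho>_def, rule slice_inequality(1)[OF d \<sigma> c])
  assume z: "\<And>\<alpha>. \<alpha> \<in> multi_indices (d j) \<Longrightarrow> fhat j \<alpha> = 0"
  show "ennreal (\<sigma>\<^sup>2) * (\<integral>\<^sup>+f. \<rho> f * zero_sum d (cof_weight d j) f \<partial>?L)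
      = (\<integral>\<^sup>+f. \<rho> f * zero_sum d (jac_sq d) f \<partial>?L)"
    unfolding k1 k2 nn_integral_cmult[OF Wm, symmetric]
    by (rule nn_integral_cong) (unfold W_def \<rho>_def, rule slice_inequality(2)[OF d \<sigma> c], rule z)
qed

subsection \<open>Continuation of zeros along a segment\<close>

text \<open>The number of zeros is locally constant in \<open>t\<close>, and the interval is
  connected. Nondegeneracy continues each zero uniquely to nearby parameters; the bound
  \<open>R\<close> gives the compactness that keeps further zeros from appearing.\<close>

lemma zero_count_invariant:
  fixes F0 F1 :: "complex ^ 'n::finite \<Rightarrow> complex ^ 'n"
  assumes der0: "\<And>z. (F0 has_derivative (\<lambda>w. J0 z *v w)) (at z)"
    and der1: "\<And>z. (F1 has_derivative (\<lambda>w. J1 z *v w)) (at z)"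
    and c0: "continuous_on UNIV J0" and c1: "continuous_on UNIV J1"
  defines "H \<equiv> \<lambda>t z. (1 - t) *\<^sub>R F0 z + t *\<^sub>R F1 z"
  assumes nondeg: "\<And>t z. t \<in> {0..1} \<Longrightarrow> H t z = 0 \<Longrightarrow> det ((1 - t) *\<^sub>R J0 z + t *\<^sub>R J1 z) \<noteq> 0"
    and bdd: "\<And>t z. t \<in> {0..1} \<Longrightarrow> H t z = 0 \<Longrightarrow> norm z \<le> R"
  shows "finite {z. H 0 z = 0}" and "finite {z. H 1 z = 0}" and "card {z. H 0 z = 0} = card {z. H 1 z = 0}"
proof -
  define Z where "Z t = {z. H t z = 0}" for t
  \<comment> \<open>Carrying \<open>t\<close> along as a coordinate gives a map between spaces of
    equal dimension. Its local injectivity yields uniqueness of the continued zeros and its openness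
    yields their existence, uniformly in \<open>t\<close>.\<close>
  define \<Phi> where "\<Phi> = (\<lambda>p :: real \<times> (complex ^ 'n). (fst p, H (fst p) (snd p)))"
  define \<Phi>' where "\<Phi>' p = (\<lambda>v :: real \<times> (complex ^ 'n). (fst v, fst v *\<^sub>R (F1 (snd p) - F0 (snd p))
      + ((1 - fst p) *\<^sub>R J0 (snd p) + fst p *\<^sub>R J1 (snd p)) *v snd v))" for p :: "real \<times> (complex ^ 'n)"
  have cF: "continuous_on UNIV F0" "continuous_on UNIV F1"
    using der0 der1 by (auto intro!: has_derivative_continuous_on intro: has_derivative_at_withinI)
  have mv: "(a *\<^sub>R A + b *\<^sub>R B) *v w = a *\<^sub>R (A *v w) + b *\<^sub>R (B *v w)" for a b and A B :: "complex ^ 'n ^ 'n" and w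
    by (simp add: vec_eq_iff matrix_vector_mult_def scaleR_sum_right sum.distrib distrib_right)
  have mvs: "(a *\<^sub>R A) *v w = a *\<^sub>R (A *v w)" for a and A :: "complex ^ 'n ^ 'n" and w
    by (simp add: vec_eq_iff matrix_vector_mult_def scaleR_sum_right)
  have der: "(\<Phi> has_derivative \<Phi>' p) (at p)" for p
  proof -
    have fs: "(fst has_derivative fst) (at p)" "(snd has_derivative snd) (at p)"
      by (auto intro!: derivative_eq_intros)
    have d0: "((\<lambda>p. F0 (snd p)) has_derivative (\<lambda>v. J0 (snd p) *v snd v)) (at p)"
      using diff_chain_at[OF fs(2) der0[of "snd p"]] by (simp add: o_def)
    have d1: "((\<lambda>p. F1 (snd p)) has_derivative (\<lambda>v. J1 (snd p) *v snd v)) (at p)"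
      using diff_chain_at[OF fs(2) der1[of "snd p"]] by (simp add: o_def)
    have "((\<lambda>p. (fst p, (1 - fst p) *\<^sub>R F0 (snd p) + fst p *\<^sub>R F1 (snd p))) has_derivative
       (\<lambda>v. (fst v, ((1 - fst p) *\<^sub>R (J0 (snd p) *v snd v) + (0 - fst v) *\<^sub>R F0 (snd p))
          + (fst p *\<^sub>R (J1 (snd p) *v snd v) + fst v *\<^sub>R F1 (snd p))))) (at p)"
      by (intro has_derivative_Pair has_derivative_add has_derivative_scaleR has_derivative_diff has_derivative_const fs d0 d1)
    then show ?thesis
      by (simp add: \<Phi>_def H_def \<Phi>'_def mv mvs scaleR_diff_right algebra_simps)
  qed
  have c\<Phi>': "continuous_on UNIV (\<lambda>p. \<Phi>' p v)" for v
  proof -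
    have s: "continuous_on UNIV (\<lambda>p :: real \<times> (complex ^ 'n). F0 (snd p))" "continuous_on UNIV (\<lambda>p :: real \<times> (complex ^ 'n). F1 (snd p))"
      by (auto intro!: continuous_on_compose2[OF cF(1)] continuous_on_compose2[OF cF(2)] continuous_on_snd continuous_on_id)
    have j: "continuous_on UNIV (\<lambda>p :: real \<times> (complex ^ 'n). J0 (snd p))" "continuous_on UNIV (\<lambda>p :: real \<times> (complex ^ 'n). J1 (snd p))"
      by (auto intro!: continuous_on_compose2[OF c0] continuous_on_compose2[OF c1] continuous_on_snd continuous_on_id)
    show ?thesis
      unfolding \<Phi>'_def
      by (intro continuous_on_Pair continuous_on_add continuous_on_scaleR continuous_on_diff continuous_on_const
          continuous_on_matrix_vector_mult continuous_on_fst continuous_on_id s j)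
  qed
  have c\<Phi>: "continuous_on UNIV \<Phi>"
    using der by (auto intro!: has_derivative_continuous_on intro: has_derivative_at_withinI)
  have cH: "continuous_on UNIV (\<lambda>p. H (fst p) (snd p))"
    using continuous_on_snd[OF c\<Phi>] by (simp add: \<Phi>_def)
  have inj\<Phi>: "\<exists>r>0. inj_on \<Phi> (ball (t, z) r)" if "t \<in> {0..1}" "z \<in> Z t" for t z
  proof (rule C1_locally_injective[OF der c\<Phi>'])
    have "inj ((*v) ((1 - t) *\<^sub>R J0 z + t *\<^sub>R J1 z))"
      using nondeg that by (intro inj_matrix_vector_mult) (auto simp: Z_def)
    then show "inj (\<Phi>' (t, z))"
      unfolding \<Phi>'_def inj_def by auto
  qed
  have iso: "\<exists>r>0. \<forall>y\<in>ball z r. y \<in> Z t \<longrightarrow> y = z" if tz: "t \<in> {0..1}" "z \<in> Z t" for t z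
  proof -
    obtain r where r: "r > 0" "inj_on \<Phi> (ball (t, z) r)" using inj\<Phi>[OF tz] by blast
    have "y = z" if "y \<in> ball z r" "y \<in> Z t" for y
      using inj_onD[OF r(2), of "(t, y)" "(t, z)"] that tz r(1) by (simp add: \<Phi>_def Z_def dist_Pair_Pair)
    then show ?thesis using r(1) by blast
  qed
  have Zclosed: "closed (Z t)" for t
  proof -
    have "continuous_on UNIV (H t)"
      unfolding H_def by (intro continuous_on_add continuous_on_scaleR continuous_on_const cF)
    then show ?thesis
      unfolding Z_def by (rule closed_Collect_eq[OF _ continuous_on_const])
  qed
  have Zfin: "finite (Z t)" if t: "t \<in> {0..1}" for t
  proof -
    have "bounded (Z t)" unfolding bounded_iff using bdd[OF t] by (auto simp: Z_def)
    then have "compact (Z t)" using Zclosed by (simp add: compact_eq_bounded_closed)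
    moreover have "\<not> z islimpt Z t" if "z \<in> Z t" for z
    proof -
      obtain r where r: "r > 0" "\<forall>y\<in>ball z r. y \<in> Z t \<longrightarrow> y = z" using iso[OF t \<open>z \<in> Z t\<close>] by blast
      then show ?thesis unfolding islimpt_approachable by (metis dist_commute mem_ball)
    qed
    ultimately have "finite (Z t \<inter> Z t)" by (rule finite_not_islimpt_in_compact)
    then show ?thesis by simp
  qed
  have loc: "\<exists>\<delta>>0. \<forall>t\<in>{0..1}. dist t t0 < \<delta> \<longrightarrow> card (Z t) = card (Z t0)" if t0: "t0 \<in> {0..1}" for t0
  proof -
    have "\<forall>z\<in>Z t0. \<exists>r>0. inj_on \<Phi> (ball (t0, z) r)" using inj\<Phi>[OF t0] by blast
    then obtain r where r: "\<And>z. z \<in> Z t0 \<Longrightarrow> r z > 0 \<and> inj_on \<Phi> (ball (t0, z) (r z))" by metis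
    have "\<exists>\<epsilon>>0. (\<forall>z\<in>Z t0. \<epsilon> \<le> r z) \<and> (\<forall>z\<in>Z t0. \<forall>y\<in>Z t0. z \<noteq> y \<longrightarrow> 2 * \<epsilon> \<le> dist z y)"
    proof -
      \<comment> \<open>Injectivity radii and half the mutual distances; the 1 keeps the set
        nonempty when there are no zeros.\<close>
      let ?A = "insert 1 (r ` Z t0 \<union> (\<lambda>(z, y). dist z y / 2) ` {(z, y) \<in> Z t0 \<times> Z t0. z \<noteq> y})"
      have f: "finite ?A"
      proof -
        have "finite {(z, y) \<in> Z t0 \<times> Z t0. z \<noteq> y}"
          by (rule finite_subset[of _ "Z t0 \<times> Z t0"]) (use Zfin[OF t0] in auto)
        then show ?thesis using Zfin[OF t0] by (intro finite.insertI finite_UnI finite_imageI)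
      qed
      have p: "\<forall>a\<in>?A. a > 0" using r by auto
      define \<epsilon> where "\<epsilon> = Min ?A"
      have m: "\<And>a. a \<in> ?A \<Longrightarrow> \<epsilon> \<le> a" using f by (simp add: \<epsilon>_def)
      have "\<epsilon> \<in> ?A" unfolding \<epsilon>_def using f by (intro Min_in) auto
      then have "\<epsilon> > 0" using p by blast
      moreover have "\<epsilon> \<le> r z" if "z \<in> Z t0" for z using that by (intro m) auto
      moreover have "2 * \<epsilon> \<le> dist z y" if "z \<in> Z t0" "y \<in> Z t0" "z \<noteq> y" for z y
      proof -
        have "dist z y / 2 \<in> ?A" using that by force
        then have "\<epsilon> \<le> dist z y / 2" by (rule m)
        then show ?thesis by simp
      qed
      ultimately show ?thesis by blast
    qed
    then obtain \<epsilon> where \<epsilon>: "\<epsilon> > 0" "\<And>z. z \<in> Z t0 \<Longrightarrow> \<epsilon> \<le> r z" "\<And>z y. z \<in> Z t0 \<Longrightarrow> y \<in> Z t0 \<Longrightarrow> z \<noteq> y \<Longrightarrow> 2 * \<epsilon> \<le> dist z y"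
      by blast
    define U where "U z = ball (t0, z) \<epsilon>" for z :: "complex ^ 'n"
    have Uinj: "inj_on \<Phi> (U z)" if "z \<in> Z t0" for z
      using r[OF that] \<epsilon>(2)[OF that] unfolding U_def by (auto intro: inj_on_subset subset_ball)
    have Uopen: "open (\<Phi> ` U z)" if "z \<in> Z t0" for z
      by (rule invariance_of_domain[OF continuous_on_subset[OF c\<Phi>] _ Uinj[OF that]]) (auto simp: U_def)
    \<comment> \<open>The images of the balls are open by invariance of domain and contain
      \<open>(t0, 0)\<close>, so they contain \<open>(t, 0)\<close> for \<open>t\<close> near
      \<open>t0\<close>: every ball keeps a zero.\<close>
    have "eventually (\<lambda>t. \<forall>z\<in>Z t0. (t, 0) \<in> \<Phi> ` U z) (nhds t0)"
    proof (rule eventually_ball_finite[OF Zfin[OF t0]], rule ballI)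
      fix z assume z: "z \<in> Z t0"
      have "(t0, 0) \<in> \<Phi> ` U z"
        using z \<epsilon>(1) by (intro image_eqI[of _ _ "(t0, z)"]) (auto simp: \<Phi>_def Z_def U_def)
      moreover have "open ((\<lambda>t. (t, 0 :: complex ^ 'n)) -` (\<Phi> ` U z))"
        by (intro open_vimage Uopen[OF z] continuous_on_Pair continuous_on_id continuous_on_const)
      ultimately show "eventually (\<lambda>t. (t, 0) \<in> \<Phi> ` U z) (nhds t0)"
        unfolding eventually_nhds by (intro exI[of _ "(\<lambda>t. (t, 0)) -` (\<Phi> ` U z)"]) auto
    qed
    then obtain \<delta>1 where \<delta>1: "\<delta>1 > 0" "\<And>t z. dist t t0 < \<delta>1 \<Longrightarrow> z \<in> Z t0 \<Longrightarrow> (t, 0) \<in> \<Phi> ` U z"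
      unfolding eventually_nhds_metric by blast
    \<comment> \<open>The zeros outside all balls form a compact set, whose projection to the
      parameter is closed and misses \<open>t0\<close>; for \<open>t\<close> near \<open>t0\<close>
      all zeros therefore lie in the balls.\<close>
    define K where "K = ({0..1} \<times> cball 0 R) \<inter> {p. H (fst p) (snd p) = 0} - (\<Union>z\<in>Z t0. U z)"
    have "compact K"
    proof -
      have "closed {p. H (fst p) (snd p) = 0}" by (rule closed_Collect_eq[OF cH continuous_on_const])
      moreover have "compact (({0..1 :: real}) \<times> (cball 0 R :: (complex ^ 'n) set))"
        by (intro compact_Times) auto
      moreover have "open (\<Union>z\<in>Z t0. U z)" by (auto simp: U_def)
      ultimately show ?thesis unfolding K_def by (intro compact_diff compact_Int_closed)
    qed
    then have "closed (fst ` K)"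
      by (intro compact_imp_closed compact_continuous_image continuous_on_fst continuous_on_id)
    moreover have "t0 \<notin> fst ` K"
    proof
      assume "t0 \<in> fst ` K"
      then obtain z where "(t0, z) \<in> K" by auto
      then have "z \<in> Z t0" "(t0, z) \<notin> U z" by (auto simp: K_def Z_def)
      then show False using \<epsilon>(1) by (simp add: U_def)
    qed
    ultimately have "open (- fst ` K)" "t0 \<in> - fst ` K" by (auto simp: open_Compl)
    then obtain \<delta>2 where \<delta>2: "\<delta>2 > 0" "\<And>t. dist t t0 < \<delta>2 \<Longrightarrow> t \<notin> fst ` K"
      unfolding open_dist by blast
    have "card (Z t) = card (Z t0)" if t: "t \<in> {0..1}" "dist t t0 < min \<delta>1 \<delta>2" for t
    proof -
      have "\<forall>z\<in>Z t0. \<exists>y. (t, y) \<in> U z \<and> y \<in> Z t"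
      proof
        fix z assume "z \<in> Z t0"
        then have "(t, 0) \<in> \<Phi> ` U z" using \<delta>1(2) t by auto
        then show "\<exists>y. (t, y) \<in> U z \<and> y \<in> Z t" by (auto simp: \<Phi>_def Z_def)
      qed
      then obtain g where g: "\<And>z. z \<in> Z t0 \<Longrightarrow> (t, g z) \<in> U z \<and> g z \<in> Z t" by metis
      have Ud: "dist z y < \<epsilon>" if "(t, y) \<in> U z" for z y
      proof -
        have "dist z y \<le> dist (t0, z) (t, y)" using dist_snd_le[of "(t0, z)" "(t, y)"] by simp
        then show ?thesis using that by (simp add: U_def)
      qed
      have "bij_betw g (Z t0) (Z t)"
        unfolding bij_betw_def
      proof
        show "inj_on g (Z t0)"
        proof (rule inj_onI, rule ccontr)
          fix y z assume yz: "y \<in> Z t0" "z \<in> Z t0" "g y = g z" "y \<noteq> z"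
          have "dist y (g y) < \<epsilon>" "dist z (g y) < \<epsilon>" using g yz Ud by metis+
          then have "dist y z < 2 * \<epsilon>" using dist_triangle2[of y z "g y"] by linarith
          then show False using \<epsilon>(3)[OF yz(1,2,4)] by simp
        qed
        show "g ` Z t0 = Z t"
        proof
          show "g ` Z t0 \<subseteq> Z t" using g by blast
          show "Z t \<subseteq> g ` Z t0"
          proof
            fix y assume y: "y \<in> Z t"
            have "t \<notin> fst ` K" using \<delta>2 t by simp
            then have "(t, y) \<notin> K" by force
            then obtain z where z: "z \<in> Z t0" "(t, y) \<in> U z"
              using y t bdd[OF t(1), of y] by (auto simp: K_def Z_def)
            have "\<Phi> (t, y) = \<Phi> (t, g z)" using y g[OF z(1)] by (simp add: \<Phi>_def Z_def)
            then have "(t, y) = (t, g z)" using inj_onD[OF Uinj[OF z(1)]] z g[OF z(1)] by blast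
            then show "y \<in> g ` Z t0" using z by auto
          qed
        qed
      qed
      then show ?thesis by (simp add: bij_betw_same_card)
    qed
    then show ?thesis using \<delta>1(1) \<delta>2(1) by (intro exI[of _ "min \<delta>1 \<delta>2"]) auto
  qed
  have "(\<lambda>t. card (Z t)) constant_on {0..1}"
  proof (rule locally_constant_imp_constant)
    fix a :: real assume a: "a \<in> {0..1}"
    obtain \<delta> where \<delta>: "\<delta> > 0" "\<forall>t\<in>{0..1}. dist t a < \<delta> \<longrightarrow> card (Z t) = card (Z a)" using loc[OF a] by blast
    show "\<exists>T. openin (top_of_set {0..1}) T \<and> a \<in> T \<and> (\<forall>x\<in>T. card (Z x) = card (Z a))"
    proof (intro exI conjI ballI)
      show "openin (top_of_set {0..1}) ({0..1} \<inter> ball a \<delta>)" by (rule openin_open_Int) simp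
      show "a \<in> {0..1} \<inter> ball a \<delta>" using a \<delta>(1) by simp
      fix x assume "x \<in> {0..1} \<inter> ball a \<delta>"
      then have "x \<in> {0..1}" "dist x a < \<delta>" by (simp_all add: dist_commute)
      then show "card (Z x) = card (Z a)" using \<delta>(2) by blast
    qed
  qed simp
  then have "card (Z 0) = card (Z 1)" unfolding constant_on_def by (metis atLeastAtMost_iff order_refl zero_le_one)
  then show "card {z. H 0 z = 0} = card {z. H 1 z = 0}" by (simp add: Z_def)
  show "finite {z. H 0 z = 0}" "finite {z. H 1 z = 0}" using Zfin[of 0] Zfin[of 1] by (simp_all add: Z_def)
qed

subsection \<open>Generic segments avoid the discriminant\<close>

lemma has_derivative_imp_differentiable: "(f has_derivative D) F \<Longrightarrow> f differentiable F"
  unfolding differentiable_def by blast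

lemma differentiable_prod:
  fixes f :: "'i \<Rightarrow> 'a::real_normed_vector \<Rightarrow> 'b::real_normed_field"
  assumes "\<And>i. i \<in> A \<Longrightarrow> f i differentiable (at x)"
  shows "(\<lambda>x. \<Prod>i\<in>A. f i x) differentiable (at x)"
proof -
  obtain f' where f': "\<And>i. i \<in> A \<Longrightarrow> (f i has_derivative f' i) (at x)"
    using assms unfolding differentiable_def by metis
  show ?thesis by (rule has_derivative_imp_differentiable, rule has_derivative_prod, rule f')
qed

lemma differentiable_vecI:
  fixes f :: "'a::real_normed_vector \<Rightarrow> 'b::euclidean_space ^ 'n::finite"
  assumes "\<And>i. (\<lambda>x. f x $ i) differentiable F"
  shows "f differentiable F"
proof -
  obtain f' where "\<And>i. ((\<lambda>x. f x $ i) has_derivative f' i) F"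
    using assms unfolding differentiable_def by metis
  then have "(f has_derivative (\<lambda>w. \<chi> i. f' i w)) F" by (intro has_derivative_vecI) simp
  then show ?thesis by (rule has_derivative_imp_differentiable)
qed

lemma differentiable_vec_nth:
  assumes "f differentiable F" shows "(\<lambda>x. f x $ i) differentiable F"
proof -
  obtain f' where "(f has_derivative f') F" using assms unfolding differentiable_def ..
  from bounded_linear.has_derivative[OF bounded_linear_vec_nth[of i] this]
  show ?thesis by (rule has_derivative_imp_differentiable)
qed

lemma differentiable_PairI:
  assumes "f differentiable (at a)" "g differentiable (at a)" shows "(\<lambda>x. (f x, g x)) differentiable (at a)"
proof -
  obtain f' g' where "(f has_derivative f') (at a)" "(g has_derivative g') (at a)"
    using assms unfolding differentiable_def by auto
  from has_derivative_Pair[OF this] show ?thesis by (rule has_derivative_imp_differentiable)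
qed

lemma differentiable_eval_hpoly:
  assumes "\<And>v. (\<lambda>w. x w $ v) differentiable (at a)"
  shows "(\<lambda>w. eval_hpoly d p (x w)) differentiable (at a)"
  unfolding eval_hpoly_def
  by (intro differentiable_sum ballI differentiable_mult differentiable_const differentiable_prod differentiable_power assms) simp

lemma differentiable_deriv_hpoly:
  assumes "\<And>v. (\<lambda>w. x w $ v) differentiable (at a)"
  shows "(\<lambda>w. deriv_hpoly d p (x w) u) differentiable (at a)"
  unfolding deriv_hpoly_def dmon_def
  by (intro differentiable_sum ballI differentiable_mult differentiable_const differentiable_prod differentiable_power assms) simp_all

lemma differentiable_pt: "z differentiable F \<Longrightarrow> (\<lambda>w. pt (z w) $ v) differentiable F"
  and differentiable_emb: "z differentiable F \<Longrightarrow> (\<lambda>w. emb (z w) $ v) differentiable F"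
  by (cases v; simp add: differentiable_vec_nth)+

lemma differentiable_chart_map: "z differentiable (at a) \<Longrightarrow> (\<lambda>w. chart_map d f (z w) $ i) differentiable (at a)"
  unfolding chart_map_def eval_system_def by (simp, intro differentiable_eval_hpoly differentiable_pt)

lemma differentiable_chart_jac: "z differentiable (at a) \<Longrightarrow> (\<lambda>w. chart_jac d f (z w) $ i $ k) differentiable (at a)"
  unfolding chart_jac_def by (simp, intro differentiable_deriv_hpoly differentiable_pt)

text \<open>A singular matrix is determined by all rows but one and the coefficients of a
  dependency. This describes the singular matrices by one complex parameter fewer than the number of
  entries, which is the saving behind the null set below.\<close>

lemma singular_matrix_row:
  fixes S :: "complex ^ 'n::finite ^ 'n"
  assumes "det S = 0"
  obtains i c where "S $ i = (\<Sum>k\<in>UNIV - {i}. c k *s S $ k)"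
proof -
  have "\<not> (\<exists>B. B ** transpose S = mat 1)"
  proof
    assume "\<exists>B. B ** transpose S = mat 1"
    then obtain B where "B ** transpose S = mat 1" by blast
    then have "det B * det S = 1" by (metis det_I det_mul det_transpose)
    then show False using assms by simp
  qed
  then obtain y where y: "transpose S *v y = 0" "y \<noteq> 0"
    unfolding matrix_left_invertible_ker by blast
  obtain i where i: "y $ i \<noteq> 0" using y(2) by (auto simp: vec_eq_iff)
  have s: "(\<Sum>k\<in>UNIV. y $ k * S $ k $ j) = 0" for j
    using y(1) by (simp add: vec_eq_iff matrix_vector_mult_def transpose_def mult.commute)
  have "S $ i = (\<Sum>k\<in>UNIV - {i}. (- (y $ k / y $ i)) *s S $ k)"
  proof -
    have "S $ i $ j = (\<Sum>k\<in>UNIV - {i}. (- (y $ k / y $ i)) * S $ k $ j)" for j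
    proof -
      have "y $ i * S $ i $ j + (\<Sum>k\<in>UNIV - {i}. y $ k * S $ k $ j) = 0"
        using s[of j] by (simp add: sum.remove[of UNIV i])
      then have "y $ i * S $ i $ j = - (\<Sum>k\<in>UNIV - {i}. y $ k * S $ k $ j)"
        by (simp add: eq_neg_iff_add_eq_0)
      then have "S $ i $ j = - (\<Sum>k\<in>UNIV - {i}. y $ k * S $ k $ j) / y $ i"
        using i by (simp add: field_simps)
      then show ?thesis by (simp add: sum_divide_distrib sum_negf)
    qed
    then show ?thesis by (simp add: vec_eq_iff)
  qed
  then show thesis by (rule that)
qed

text \<open>The second condition says that there are no zeros at infinity, so that the chart sees
  all projective zeros.\<close>

definition generic_system :: "('n::finite \<Rightarrow> nat) \<Rightarrow> ('n \<Rightarrow> 'n hpoly) \<Rightarrow> bool" where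
  "generic_system d f \<longleftrightarrow> (\<forall>z. chart_map d f z = 0 \<longrightarrow> det (chart_jac d f z) \<noteq> 0) \<and>
     (\<forall>u. eval_system d f (emb u) = 0 \<longrightarrow> u = 0)"

definition segment_system :: "('n::finite \<Rightarrow> 'n hpoly) \<Rightarrow> ('n \<Rightarrow> 'n hpoly) \<Rightarrow> real \<Rightarrow> 'n \<Rightarrow> 'n hpoly" where
  "segment_system f0 f t = (\<lambda>i \<alpha>. of_real (1 - t) * f0 i \<alpha> + of_real t * f i \<alpha>)"

lemma eval_system_seg: "eval_system d (segment_system f0 f t) x = (1 - t) *\<^sub>R eval_system d f0 x + t *\<^sub>R eval_system d f x"
  by (simp only: vec_eq_iff eval_system_def segment_system_def eval_hpoly_add eval_hpoly_scale vec_lambda_beta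
      vector_add_component vector_scaleR_component scaleR_conv_of_real[where 'a = complex]) simp

lemma chart_map_seg: "chart_map d (segment_system f0 f t) z = (1 - t) *\<^sub>R chart_map d f0 z + t *\<^sub>R chart_map d f z"
  by (simp add: chart_map_def eval_system_seg)

lemma chart_jac_seg: "chart_jac d (segment_system f0 f t) z = (1 - t) *\<^sub>R chart_jac d f0 z + t *\<^sub>R chart_jac d f z"
  by (simp only: vec_eq_iff chart_jac_def segment_system_def deriv_hpoly_add_poly deriv_hpoly_scale_poly vec_lambda_beta
      vector_add_component vector_scaleR_component scaleR_conv_of_real[where 'a = complex]) simp

section \<open>Perturbation by affine maps of the chart\<close>

definition linear_index :: "nat \<Rightarrow> 'n::finite \<Rightarrow> 'n option \<Rightarrow> nat" where
  "linear_index d k = (\<lambda>v. if v = None then d - 1 else if v = Some k then 1 else 0)"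

lemma sum_option: "(\<Sum>v\<in>UNIV. h v) = h None + (\<Sum>k\<in>UNIV. h (Some k))" for h :: "'n::finite option \<Rightarrow> 'a::comm_monoid_add"
proof -
  have "(\<Sum>v\<in>insert None (Some ` UNIV). h v) = h None + (\<Sum>k\<in>UNIV. h (Some k))"
    by (subst sum.insert) (auto simp: sum.reindex)
  then show ?thesis by (simp add: UNIV_option_conv)
qed

lemma prod_option: "(\<Prod>v\<in>UNIV. h v) = h None * (\<Prod>k\<in>UNIV. h (Some k))" for h :: "'n::finite option \<Rightarrow> 'a::comm_monoid_mult"
proof -
  have "(\<Prod>v\<in>insert None (Some ` UNIV). h v) = h None * (\<Prod>k\<in>UNIV. h (Some k))"
    by (subst prod.insert) (auto simp: prod.reindex)
  then show ?thesis by (simp add: UNIV_option_conv)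
qed

lemma linear_index_multi: "d > 0 \<Longrightarrow> linear_index d k \<in> multi_indices d"
  by (simp add: multi_indices_def sum_option linear_index_def)

lemma mon_linear_index: "mon (linear_index d k) (pt z) = z $ k"
  by (simp add: mon_def prod_option linear_index_def if_distrib[of "\<lambda>m. _ ^ m"] cong: if_cong)

lemma linear_index_inj: "linear_index d k = linear_index d l \<longleftrightarrow> k = l"
proof
  assume "linear_index d k = linear_index d l"
  then have "linear_index d k (Some k) = linear_index d l (Some k)" by simp
  then show "k = l" by (simp add: linear_index_def split: if_splits)
qed simp

lemma linear_index_neq_const_index: "linear_index d k \<noteq> const_index d"
proof
  assume "linear_index d k = const_index d"
  then have "linear_index d k (Some k) = const_index d (Some k)" by simp
  then show False by (simp add: linear_index_def const_index_def)
qed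

text \<open>The perturbation that adds \<open>a + B *v z\<close> to the chart map. Its two
  components move the value and the Jacobian at a point freely, which makes the set of bad
  parameters explicit.\<close>

definition aff_shift :: "('n::finite \<Rightarrow> nat) \<Rightarrow> (complex ^ 'n) \<times> (complex ^ 'n ^ 'n) \<Rightarrow> 'n \<Rightarrow> 'n hpoly" where
  "aff_shift d e = (\<lambda>i \<alpha>. (if \<alpha> = const_index (d i) then fst e $ i else 0) + (\<Sum>k\<in>UNIV. if \<alpha> = linear_index (d i) k then snd e $ i $ k else 0))"

definition aff_coefs :: "('n::finite \<Rightarrow> nat) \<Rightarrow> ('n \<Rightarrow> 'n hpoly) \<Rightarrow> (complex ^ 'n) \<times> (complex ^ 'n ^ 'n)" where
  "aff_coefs d f = (\<chi> i. f i (const_index (d i)), \<chi> i k. f i (linear_index (d i) k))"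

lemma eval_hpoly_linear_index_sum:
  assumes "d > 0"
  shows "eval_hpoly d (\<lambda>\<alpha>. \<Sum>k\<in>UNIV. if \<alpha> = linear_index d k then b k else 0) (pt z) = (\<Sum>k\<in>UNIV. b k * z $ k)"
proof -
  have "eval_hpoly d (\<lambda>\<alpha>. \<Sum>k\<in>UNIV. if \<alpha> = linear_index d k then b k else 0) (pt z)
     = (\<Sum>k\<in>UNIV. \<Sum>\<alpha>\<in>multi_indices d. if \<alpha> = linear_index d k then b k * mon (linear_index d k) (pt z) else 0)"
    unfolding eval_hpoly_mon sum_distrib_right by (subst sum.swap) (auto intro!: sum.cong)
  also have "\<dots> = (\<Sum>k\<in>UNIV. b k * z $ k)"
    by (simp add: linear_index_multi[OF assms] mon_linear_index)
  finally show ?thesis .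
qed

lemma chart_map_aff_shift:
  assumes "\<And>i. d i > 0"
  shows "chart_map d (sshift d f (aff_shift d (a, B))) z = chart_map d f z + a + B *v z"
  by (simp add: vec_eq_iff chart_map_def eval_system_def sshift_def eval_hshift aff_shift_def eval_hpoly_add
      eval_hpoly_single eval_hpoly_linear_index_sum[OF assms] matrix_vector_mult_def)

lemma chart_jac_aff_shift:
  assumes d: "\<And>i. d i > 0"
  shows "chart_jac d (sshift d f (aff_shift d (a, B))) z = chart_jac d f z + B"
proof -
  have bl: "bounded_linear ((*v) B)"
    by (rule linear_conv_bounded_linear[THEN iffD1], rule linearI)
       (simp_all add: vec_eq_iff matrix_vector_mult_def scaleR_sum_right distrib_left sum.distrib)
  have "((\<lambda>z. chart_map d f z + a + B *v z) has_derivative (\<lambda>w. chart_jac d f z *v w + 0 + B *v w)) (at z)"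
    by (intro has_derivative_add has_derivative_chart_map has_derivative_const bounded_linear_imp_has_derivative bl)
  then have "(chart_map d (sshift d f (aff_shift d (a, B))) has_derivative (\<lambda>w. (chart_jac d f z + B) *v w)) (at z)"
    by (simp add: chart_map_aff_shift[OF d, abs_def] matrix_vector_mult_add_rdistrib)
  from has_derivative_unique[OF has_derivative_chart_map this] show ?thesis
    by (metis matrix_eq)
qed

text \<open>Being bad for some \<open>(t, z)\<close> is a projection, which need not preserve Borel
  sets. Here the parameters range over a closed set and \<open>Q\<close> is continuous in them, so
  \<open>sets_ex_zero\<close> applies.\<close>

lemma measurable_seg_sets:
  fixes Q :: "('n::finite \<Rightarrow> 'n hpoly) \<Rightarrow> complex ^ 'n \<Rightarrow> real"
  assumes Qm: "\<And>t z. (\<lambda>f. Q (segment_system f0 f t) z) \<in> borel_measurable (system_lebesgue d)"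
    and Qc: "\<And>f. continuous_on UNIV (\<lambda>p. Q (segment_system f0 f (fst p)) (snd p))" and Qpos: "\<And>f z. Q f z \<ge> 0"
    and C: "closed C"
  shows "{f \<in> hsystems d. \<exists>t\<in>{0..1}. \<exists>z\<in>C. Q (segment_system f0 f t) z = 0} \<in> sets (system_lebesgue d)"
proof -
  have "{f \<in> space (system_lebesgue d). \<exists>p\<in>{0..1} \<times> C. Q (segment_system f0 f (fst p)) (snd p) = 0} \<in> sets (system_lebesgue d)"
    by (rule sets_ex_zero) (auto intro!: closed_Times C Qm Qc Qpos)
  then show ?thesis by (simp add: space_system_lebesgue)
qed

lemma continuous_on_seg: "continuous_on UNIV (\<lambda>p :: real \<times> 'a::topological_space. segment_system f0 f (fst p) i \<alpha>)"
  unfolding segment_system_def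
  by (intro continuous_on_add continuous_on_mult continuous_on_of_real continuous_on_diff continuous_on_const continuous_on_fst continuous_on_id)

text \<open>A dimension count with \<open>n = CARD('n)\<close>: bad perturbations are described by
  \<open>z\<close>, a singular matrix and the real number \<open>t\<close>, that is by
  \<open>2 * n + (2 * n\<^sup>2 - 2) + 1\<close> real parameters, one fewer than there are for
  \<open>(a, B)\<close>.\<close>

lemma AE_segment_nondegenerate:
  fixes d :: "'n::finite \<Rightarrow> nat"
  assumes d: "\<And>i. d i > 0" and f0: "generic_system d f0"
  shows "AE f in system_lebesgue d. \<forall>t\<in>{0..1}. \<forall>z. chart_map d (segment_system f0 f t) z = 0 \<longrightarrow> det (chart_jac d (segment_system f0 f t) z) \<noteq> 0"
proof -
  let ?Q = "\<lambda>f z. norm (chart_map d f z) + norm (det (chart_jac d f z))"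
  define A where "A = {f \<in> hsystems d. \<exists>t\<in>{0..1}. \<exists>z\<in>UNIV. ?Q (segment_system f0 f t) z = 0}"
  have A: "A \<in> sets (system_lebesgue d)"
    unfolding A_def
  proof (rule measurable_seg_sets)
    fix t z
    have [measurable]: "(\<lambda>f. chart_map d (segment_system f0 f t) z) \<in> borel_measurable (system_lebesgue d)"
      unfolding chart_map_seg by (intro borel_measurable_add borel_measurable_scaleR borel_measurable_const borel_measurable_chart_map) auto
    have [measurable]: "(\<lambda>f. det (chart_jac d (segment_system f0 f t) z)) \<in> borel_measurable (system_lebesgue d)"
    proof (rule borel_measurable_det)
      fix i k
      have "(\<lambda>f. chart_jac d f z $ i $ k) \<in> borel_measurable (system_lebesgue d)"
        by (rule borel_measurable_chart_jac) auto
      then show "(\<lambda>f. chart_jac d (segment_system f0 f t) z $ i $ k) \<in> borel_measurable (system_lebesgue d)"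
        unfolding chart_jac_seg by simp
    qed
    show "(\<lambda>f. ?Q (segment_system f0 f t) z) \<in> borel_measurable (system_lebesgue d)" by measurable
  next
    fix f
    show "continuous_on UNIV (\<lambda>p. ?Q (segment_system f0 f (fst p)) (snd p))"
      by (intro continuous_on_add continuous_on_norm continuous_on_det continuous_on_matrix_entry
          continuous_on_chart_map continuous_on_chart_jac continuous_on_seg continuous_on_snd continuous_on_id)
  qed auto
  have "A \<in> null_sets (system_lebesgue d)"
  proof (rule null_sets_system_slice[where T = "aff_shift d" and K = "aff_coefs d"])
    show "(\<lambda>e. aff_shift d e i \<alpha>) \<in> borel_measurable borel" for i \<alpha>
    proof -
      have "continuous_on UNIV (\<lambda>e :: (complex ^ 'n) \<times> (complex ^ 'n ^ 'n). if \<alpha> = \<beta> then fst e $ i else 0)"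
        "continuous_on UNIV (\<lambda>e :: (complex ^ 'n) \<times> (complex ^ 'n ^ 'n). if \<alpha> = \<beta> then snd e $ i $ k else 0)" for \<beta> k
        by (cases "\<alpha> = \<beta>"; simp add: continuous_on_component continuous_on_fst continuous_on_snd continuous_on_id continuous_on_const)+
      then show ?thesis
        unfolding aff_shift_def by (intro borel_measurable_continuous_onI continuous_on_add continuous_on_sum)
    qed
    show "aff_shift d (- e) i \<alpha> = - aff_shift d e i \<alpha>" for e i \<alpha>
      by (simp add: aff_shift_def sum_negf[symmetric] if_distrib[of uminus] cong: if_cong)
    show "aff_coefs d \<in> borel_measurable (system_lebesgue d)"
      unfolding aff_coefs_def
    proof (rule borel_measurable_Pair)
      show "(\<lambda>f. \<chi> i. f i (const_index (d i))) \<in> borel_measurable (system_lebesgue d)"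
        by (rule borel_measurable_vecI) (simp add: measurable_system_coef)
      have "(\<lambda>f. f i (linear_index (d i) k)) \<in> borel_measurable (system_lebesgue d)" for i k
        by (intro measurable_system_coef linear_index_multi d)
      then have c: "(\<lambda>f. f i (linear_index (d i) k) \<bullet> c) \<in> borel_measurable (system_lebesgue d)" for i k c
        by (intro borel_measurable_inner borel_measurable_const)
      have cb: "(\<lambda>f. (\<chi> i k. f i (linear_index (d i) k)) \<bullet> b) \<in> borel_measurable (system_lebesgue d)" if b: "b \<in> Basis" for b :: "complex ^ 'n ^ 'n"
      proof -
        obtain i k c where "b = axis i (axis k c)" using b by (auto simp: Basis_vec_def)
        then show ?thesis using c[of i k c] by (simp add: inner_axis)
      qed
      show "(\<lambda>f. \<chi> i k. f i (linear_index (d i) k)) \<in> borel_measurable (system_lebesgue d)"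
        by (rule borel_measurable_euclidean_space[THEN iffD2], rule ballI, rule cb)
    qed
    show "aff_coefs d (sshift d f (aff_shift d e)) = aff_coefs d f + e" for f e
      by (simp add: prod_eq_iff vec_eq_iff aff_coefs_def sshift_def hshift_def aff_shift_def linear_index_multi[OF d]
          linear_index_inj linear_index_neq_const_index linear_index_neq_const_index[symmetric])
    show "A \<in> sets (system_lebesgue d)" by (rule A)
    fix f assume "f \<in> hsystems d"
    text \<open>
      A bad pair \<open>(a, B)\<close> is recovered from a zero \<open>z\<close> and a matrix \<open>C\<close>: the rows \<open>k \<noteq> i\<close> of \<open>C\<close> are
      those of the singular Jacobian, and row \<open>i\<close> stores the coefficients of the dependency, with the
      segment parameter \<open>(1 - t) / t\<close> in the otherwise unused diagonal entry.  That entry being real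
      is what makes the parameter set negligible.
    \<close>
    define S where "S i C = (\<chi> l m. if l = i then (\<Sum>k\<in>UNIV - {i}. C $ i $ k * C $ k $ m) else C $ l $ m)" for i and C :: "complex ^ 'n ^ 'n"
    define MB where "MB i p = (\<chi> l m. S i (snd p) $ l $ m - of_real (Re (snd p $ i $ i)) * chart_jac d f0 (fst p) $ l $ m - chart_jac d f (fst p) $ l $ m)"
      for i and p :: "(complex ^ 'n) \<times> (complex ^ 'n ^ 'n)"
    define \<Psi> where "\<Psi> i p = (\<chi> l. - (of_real (Re (snd p $ i $ i)) * chart_map d f0 (fst p) $ l + chart_map d f (fst p) $ l
        + (\<Sum>m\<in>UNIV. MB i p $ l $ m * fst p $ m)), MB i p)" for i and p :: "(complex ^ 'n) \<times> (complex ^ 'n ^ 'n)"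
    define N where "N i = {p :: (complex ^ 'n) \<times> (complex ^ 'n ^ 'n). Im (snd p $ i $ i) = 0}" for i
    have Nneg: "negligible (N i)" for i
    proof -
      have "N i = {p. (0, axis i (axis i \<i>)) \<bullet> p = 0}"
        by (auto simp: N_def inner_prod_def inner_axis' inner_complex_def)
      moreover have "(0 :: complex ^ 'n, axis i (axis i \<i>)) \<noteq> 0"
        by (simp add: zero_prod_def axis_eq_0_iff)
      ultimately show ?thesis using negligible_hyperplane by metis
    qed
    have fs: "fst differentiable (at p)" "snd differentiable (at p)" for p :: "(complex ^ 'n) \<times> (complex ^ 'n ^ 'n)"
      by (auto intro!: bounded_linear_imp_differentiable bounded_linear_fst bounded_linear_snd)
    have cnt: "(\<lambda>p. snd p $ l $ m) differentiable (at p)" for l m and p :: "(complex ^ 'n) \<times> (complex ^ 'n ^ 'n)"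
      by (intro differentiable_vec_nth fs)
    have re: "(\<lambda>p. complex_of_real (Re (snd p $ l $ m))) differentiable (at p)" for l m and p :: "(complex ^ 'n) \<times> (complex ^ 'n ^ 'n)"
    proof -
      have "bounded_linear (\<lambda>c. complex_of_real (Re c))"
        by (intro bounded_linear_compose[OF bounded_linear_of_real bounded_linear_Re])
      moreover obtain D where "((\<lambda>p. snd p $ l $ m) has_derivative D) (at p)"
        using cnt[of l m p] unfolding differentiable_def ..
      ultimately have "((\<lambda>p. complex_of_real (Re (snd p $ l $ m))) has_derivative (\<lambda>x. complex_of_real (Re (D x)))) (at p)"
        by (rule bounded_linear.has_derivative)
      then show ?thesis by (rule has_derivative_imp_differentiable)
    qed
    have MBd: "(\<lambda>p. MB i p $ l $ m) differentiable (at p)" for i l m p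
    proof -
      have "(\<lambda>p. S i (snd p) $ l $ m) differentiable (at p)"
      proof (cases "l = i")
        case True
        then show ?thesis unfolding S_def
          by (simp, intro differentiable_sum ballI differentiable_mult cnt) simp
      next
        case False
        then show ?thesis unfolding S_def by (simp add: cnt)
      qed
      then show ?thesis unfolding MB_def
        by (simp, intro differentiable_diff differentiable_mult re differentiable_chart_jac fs)
    qed
    have "\<Psi> i differentiable (at p)" for i p
      unfolding \<Psi>_def
    proof (rule differentiable_PairI)
      show "(\<lambda>p. MB i p) differentiable (at p)"
        by (intro differentiable_vecI MBd)
      show "(\<lambda>p. \<chi> l. - (of_real (Re (snd p $ i $ i)) * chart_map d f0 (fst p) $ l + chart_map d f (fst p) $ l
        + (\<Sum>m\<in>UNIV. MB i p $ l $ m * fst p $ m))) differentiable (at p)"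
        by (rule differentiable_vecI, simp only: vec_lambda_beta,
            intro differentiable_minus differentiable_add differentiable_mult differentiable_sum ballI re
              differentiable_chart_map fs MBd differentiable_vec_nth) simp
    qed
    then have "\<Psi> i differentiable_on N i" for i
      unfolding differentiable_on_def by (blast intro: differentiable_at_withinI)
    then have neg: "negligible (\<Psi> i ` N i)" for i
      using negligible_differentiable_image_negligible[OF order_refl Nneg] by blast
    have "{e. sshift d f (aff_shift d e) \<in> A} \<subseteq> (\<Union>i. \<Psi> i ` N i)"
    proof
      fix e assume "e \<in> {e. sshift d f (aff_shift d e) \<in> A}"
      then obtain a B where e: "e = (a, B)" and "sshift d f (aff_shift d (a, B)) \<in> A" by (cases e) auto
      then obtain t z where t: "t \<in> {0..1}"
        and z0: "chart_map d (segment_system f0 (sshift d f (aff_shift d (a, B))) t) z = 0"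
        and det0: "det (chart_jac d (segment_system f0 (sshift d f (aff_shift d (a, B))) t) z) = 0"
        by (auto simp: A_def add_nonneg_eq_0_iff)
      \<comment> \<open>At \<open>t = 0\<close> the perturbation has no effect, so this end has to
        be excluded by the genericity of \<open>f0\<close>. Afterwards one may divide by
        \<open>t\<close>, which leaves the single real parameter \<open>s\<close>.\<close>
      have tnz: "t \<noteq> 0"
      proof
        assume "t = 0"
        then have "chart_map d f0 z = 0" "det (chart_jac d f0 z) = 0"
          using z0 det0 by (simp_all add: chart_map_seg chart_jac_seg)
        then show False using f0 by (simp add: generic_system_def)
      qed
      define s where "s = (1 - t) / t"
      have st: "1 - t = t * s" using tnz by (simp add: s_def)
      have "t *\<^sub>R (s *\<^sub>R chart_map d f0 z + (chart_map d f z + a + B *v z)) = 0"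
        using z0 by (simp add: chart_map_seg chart_map_aff_shift[OF d] st scaleR_add_right)
      then have z1: "s *\<^sub>R chart_map d f0 z + (chart_map d f z + a + B *v z) = 0" using tnz by simp
      define M where "M = s *\<^sub>R chart_jac d f0 z + (chart_jac d f z + B)"
      have "chart_jac d (segment_system f0 (sshift d f (aff_shift d (a, B))) t) z = (\<chi> i. of_real t *s M $ i)"
        by (simp add: M_def chart_jac_seg chart_jac_aff_shift[OF d] st vec_eq_iff)
           (simp add: scaleR_conv_of_real algebra_simps)
      then have "det (\<chi> i. of_real t *s M $ i) = 0" using det0 by simp
      then have "(\<Prod>i\<in>(UNIV :: 'n set). complex_of_real t) * det M = 0"
        by (subst (asm) det_rows_mul) (simp add: vec_lambda_eta)
      then have "det M = 0" using tnz by simp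
      then obtain i c where row: "M $ i = (\<Sum>k\<in>UNIV - {i}. c k *s M $ k)" by (rule singular_matrix_row)
      define C where "C = (\<chi> l m. if l = i then (if m = i then of_real s else c m) else M $ l $ m)"
      have SC: "S i C = M"
      proof -
        have "(\<Sum>k\<in>UNIV - {i}. C $ i $ k * C $ k $ m) = M $ i $ m" for m
          unfolding row by (auto intro!: sum.cong simp: C_def)
        then show ?thesis by (simp add: vec_eq_iff S_def) (auto simp: C_def)
      qed
      have Cii: "C $ i $ i = of_real s" by (simp add: C_def)
      have MB: "MB i (z, C) = B"
        by (simp add: vec_eq_iff MB_def SC Cii M_def scaleR_conv_of_real[where 'a = complex])
      have "a = - (s *\<^sub>R chart_map d f0 z + chart_map d f z + B *v z)"
        using z1 by (simp add: eq_neg_iff_add_eq_0 algebra_simps)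
      then have "\<Psi> i (z, C) = (a, B)"
        by (simp add: \<Psi>_def MB Cii vec_eq_iff matrix_vector_mult_def scaleR_conv_of_real[where 'a = complex])
      moreover have "(z, C) \<in> N i" by (simp add: N_def Cii)
      ultimately have "e \<in> \<Psi> i ` N i" unfolding e by (metis imageI)
      then show "e \<in> (\<Union>i. \<Psi> i ` N i)" by (rule UN_I[OF UNIV_I])
    qed
    moreover have "negligible (\<Union>i. \<Psi> i ` N i)"
      by (rule negligible_Union) (auto simp: neg)
    ultimately show "negligible {e. sshift d f (aff_shift d e) \<in> A}" by (rule negligible_subset[rotated])
  qed
  then have "AE f in system_lebesgue d. f \<notin> A" by (rule AE_not_in)
  moreover have "AE f in system_lebesgue d. f \<in> hsystems d"
    unfolding space_system_lebesgue[symmetric] by (rule AE_space)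
  ultimately show ?thesis
  proof eventually_elim
    case (elim f)
    show ?case
    proof (intro ballI allI impI notI)
      fix t :: real and z
      assume t: "t \<in> {0..1}" and "chart_map d (segment_system f0 f t) z = 0" "det (chart_jac d (segment_system f0 f t) z) = 0"
      then have "?Q (segment_system f0 f t) z = 0" by simp
      then have "f \<in> A" unfolding A_def using t elim(2) by blast
      then show False using elim(1) by blast
    qed
  qed
qed

subsection \<open>The number of zeros of a generic system\<close>

definition power_index :: "'n::finite \<Rightarrow> nat \<Rightarrow> 'n option \<Rightarrow> nat" where
  "power_index k d = (\<lambda>v. if v = Some k then d else 0)"

lemma power_index_multi [simp]: "power_index k d \<in> multi_indices d"
  by (simp add: multi_indices_def power_index_def)

lemma mon_power_index: "mon (power_index k d) x = x $ Some k ^ d"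
  by (simp add: mon_def power_index_def if_distrib[of "\<lambda>m. _ ^ m"] cong: if_cong)

lemma eval_hpoly_power_index: "eval_hpoly d (\<lambda>\<alpha>. if \<alpha> = power_index k d then c else 0) x = c * x $ Some k ^ d"
  by (simp add: eval_hpoly_mon mon_power_index if_distrib[of "\<lambda>k. k * _"] cong: if_cong)

lemma eval_hpoly_const_index: "eval_hpoly d (\<lambda>\<alpha>. if \<alpha> = const_index d then c else 0) x = c * x $ None ^ d"
  by (simp add: eval_hpoly_mon mon_const_index if_distrib[of "\<lambda>k. k * _"] cong: if_cong)

lemma eval_system_scale_zero: "eval_system d f x = 0 \<Longrightarrow> eval_system d f (c *s x) = 0"
  by (simp add: vec_eq_iff eval_system_def eval_hpoly_homogeneous)

text \<open>The dimension count at infinity: \<open>u\<close> with one coordinate normalised and the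
  real number \<open>t\<close> make \<open>2 * n - 1\<close> real parameters, where
  \<open>n = CARD('n)\<close>, against \<open>n\<close> complex equations.\<close>

lemma AE_segment_infinity:
  fixes d :: "'n::finite \<Rightarrow> nat"
  assumes f0: "generic_system d f0"
  shows "AE f in system_lebesgue d. \<forall>t\<in>{0..1}. \<forall>u. eval_system d (segment_system f0 f t) (emb u) = 0 \<longrightarrow> u = 0"
proof -
  let ?Q = "\<lambda>f u. norm (eval_system d f (emb u))"
  \<comment> \<open>A nonzero \<open>u\<close> can be scaled to have some coordinate equal to 1, so
    the zeros at infinity are covered by finitely many closed slices.\<close>
  define A where "A k = {f \<in> hsystems d. \<exists>t\<in>{0..1}. \<exists>u\<in>{u. u $ k = 1}. ?Q (segment_system f0 f t) u = 0}" for k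
  have ev: "(\<lambda>f. eval_system d f x) \<in> borel_measurable (system_lebesgue d)" for x
    unfolding eval_system_def
    by (rule borel_measurable_vecI, simp only: vec_lambda_beta, rule measurable_eval_hpoly[OF measurable_system_coef borel_measurable_const])
  have A: "A k \<in> sets (system_lebesgue d)" for k
    unfolding A_def
  proof (rule measurable_seg_sets)
    fix t u
    have [measurable]: "(\<lambda>f. eval_system d (segment_system f0 f t) (emb u)) \<in> borel_measurable (system_lebesgue d)"
      unfolding eval_system_seg by (intro borel_measurable_add borel_measurable_scaleR borel_measurable_const ev)
    show "(\<lambda>f. ?Q (segment_system f0 f t) u) \<in> borel_measurable (system_lebesgue d)" by measurable
  next
    fix f
    show "continuous_on UNIV (\<lambda>p. ?Q (segment_system f0 f (fst p)) (snd p))"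
      unfolding eval_system_def
      by (intro continuous_on_norm continuous_on_vec_lambda continuous_on_eval_hpoly continuous_on_seg
          continuous_on_emb continuous_on_snd continuous_on_id)
    show "closed {u :: complex ^ 'n. u $ k = 1}"
      by (rule closed_Collect_eq[OF continuous_on_component[OF continuous_on_id] continuous_on_const])
  qed auto
  \<comment> \<open>On the slice \<open>u $ k = 1\<close> the monomials \<open>z_k ^ d_i\<close>
    have value 1, so this shift adds exactly \<open>b\<close> to the values of the system.\<close>
  define T where "T k = (\<lambda>(b :: complex ^ 'n) i \<alpha>. if \<alpha> = power_index k (d i) then b $ i else 0)" for k :: 'n
  have "A k \<in> null_sets (system_lebesgue d)" for k
  proof (rule null_sets_system_slice[where T = "T k" and K = "\<lambda>f. \<chi> i. f i (power_index k (d i))"])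
    show "(\<lambda>e. T k e i \<alpha>) \<in> borel_measurable borel" for i \<alpha>
      unfolding T_def by (cases "\<alpha> = power_index k (d i)") (simp_all add: borel_measurable_vec_nth)
    show "T k (- e) i \<alpha> = - T k e i \<alpha>" for e i \<alpha> by (simp add: T_def)
    show "(\<lambda>f. \<chi> i. f i (power_index k (d i))) \<in> borel_measurable (system_lebesgue d)"
      by (rule borel_measurable_vecI) (simp add: measurable_system_coef)
    show "(\<chi> i. sshift d f (T k e) i (power_index k (d i))) = (\<chi> i. f i (power_index k (d i))) + e" for f e
      by (simp add: vec_eq_iff sshift_def hshift_def T_def)
    show "A k \<in> sets (system_lebesgue d)" by (rule A)
    fix f assume "f \<in> hsystems d"
    text \<open>The entry \<open>k\<close> of \<open>u\<close> is normalised to 1, so its slot can carry the real number \<open>(1 - t) / t\<close>.\<close>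
    define U where "U y = (\<chi> l. if l = k then 1 else y $ l)" for y :: "complex ^ 'n"
    define \<Psi> where "\<Psi> y = (\<chi> i. - (of_real (Re (y $ k)) * eval_hpoly (d i) (f0 i) (emb (U y)) + eval_hpoly (d i) (f i) (emb (U y))))" for y
    define N where "N = {y :: complex ^ 'n. Im (y $ k) = 0}"
    have Nneg: "negligible N"
    proof -
      have "N = {y. axis k \<i> \<bullet> y = 0}"
        by (auto simp: N_def inner_axis' inner_complex_def)
      moreover have "axis k \<i> \<noteq> 0" by (simp add: axis_eq_0_iff)
      ultimately show ?thesis using negligible_hyperplane[of "axis k \<i>" 0] by simp
    qed
    have nth: "(\<lambda>y. y $ l) differentiable (at y)" for l and y :: "complex ^ 'n"
      by (rule has_derivative_imp_differentiable, rule has_derivative_vec_nth')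
    have Ud: "(\<lambda>y. emb (U y) $ v) differentiable (at y)" for v y
    proof (rule differentiable_emb, rule differentiable_vecI)
      fix l show "(\<lambda>y. U y $ l) differentiable (at y)"
        unfolding U_def by (cases "l = k") (simp_all add: nth)
    qed
    have re: "(\<lambda>y. complex_of_real (Re (y $ k))) differentiable (at y)" for y
      by (rule has_derivative_imp_differentiable, rule bounded_linear.has_derivative[OF bounded_linear_of_real],
          rule bounded_linear.has_derivative[OF bounded_linear_Re], rule has_derivative_vec_nth')
    have "\<Psi> differentiable (at y)" for y
      unfolding \<Psi>_def
      by (rule differentiable_vecI, simp only: vec_lambda_beta,
          intro differentiable_minus differentiable_add differentiable_mult re differentiable_eval_hpoly Ud)
    then have "\<Psi> differentiable_on N"
      unfolding differentiable_on_def by (blast intro: differentiable_at_withinI)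
    then have neg: "negligible (\<Psi> ` N)"
      using negligible_differentiable_image_negligible[OF order_refl Nneg] by blast
    have "{e. sshift d f (T k e) \<in> A k} \<subseteq> \<Psi> ` N"
    proof
      fix e assume "e \<in> {e. sshift d f (T k e) \<in> A k}"
      then obtain t u where t: "t \<in> {0..1}" and u: "u $ k = 1"
        and z0: "eval_system d (segment_system f0 (sshift d f (T k e)) t) (emb u) = 0"
        by (auto simp: A_def)
      have tnz: "t \<noteq> 0"
      proof
        assume "t = 0"
        then have "eval_system d f0 (emb u) = 0" using z0 by (simp add: eval_system_seg)
        then have "u = 0" using f0 by (simp add: generic_system_def)
        then show False using u by simp
      qed
      define s where "s = (1 - t) / t"
      have st: "1 - t = t * s" using tnz by (simp add: s_def)
      have sh: "eval_system d (sshift d f (T k e)) (emb u) = eval_system d f (emb u) + e"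
        by (simp add: vec_eq_iff eval_system_def sshift_def eval_hshift T_def eval_hpoly_power_index u)
      have "t *\<^sub>R (s *\<^sub>R eval_system d f0 (emb u) + (eval_system d f (emb u) + e)) = 0"
        using z0 by (simp add: eval_system_seg sh st scaleR_add_right)
      then have "s *\<^sub>R eval_system d f0 (emb u) + (eval_system d f (emb u) + e) = 0" using tnz by simp
      then have e: "e = - (s *\<^sub>R eval_system d f0 (emb u) + eval_system d f (emb u))"
        by (simp add: eq_neg_iff_add_eq_0 algebra_simps)
      define y where "y = (\<chi> l. if l = k then of_real s else u $ l)"
      have Uy: "U y = u" using u by (auto simp: U_def y_def vec_eq_iff)
      have "\<Psi> y = e"
        by (simp add: \<Psi>_def Uy e vec_eq_iff eval_system_def scaleR_conv_of_real[where 'a = complex]) (simp add: y_def)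
      moreover have "y \<in> N" by (simp add: N_def y_def)
      ultimately show "e \<in> \<Psi> ` N" by blast
    qed
    then show "negligible {e. sshift d f (T k e) \<in> A k}" by (rule negligible_subset[OF neg])
  qed
  then have "AE f in system_lebesgue d. f \<notin> A k" for k by (rule AE_not_in)
  then have "AE f in system_lebesgue d. \<forall>k\<in>UNIV. f \<notin> A k" by (subst AE_finite_all) auto
  moreover have "AE f in system_lebesgue d. f \<in> hsystems d"
    unfolding space_system_lebesgue[symmetric] by (rule AE_space)
  ultimately show ?thesis
  proof eventually_elim
    case (elim f)
    show ?case
    proof (intro ballI allI impI, rule ccontr)
      fix t :: real and u :: "complex ^ 'n"
      assume t: "t \<in> {0..1}" and z: "eval_system d (segment_system f0 f t) (emb u) = 0" and "u \<noteq> 0"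
      then obtain k where k: "u $ k \<noteq> 0" by (auto simp: vec_eq_iff)
      have "emb ((1 / u $ k) *s u) = (1 / u $ k) *s emb u" by (simp add: vec_option_eq_iff)
      then have "?Q (segment_system f0 f t) ((1 / u $ k) *s u) = 0"
        using eval_system_scale_zero[OF z] by simp
      moreover have "(1 / u $ k) *s u \<in> {u. u $ k = 1}" using k by simp
      ultimately have "f \<in> A k" unfolding A_def using t elim(2) by blast
      then show False using elim(1) by blast
    qed
  qed
qed

text \<open>Unbounded zeros along the segment would accumulate at a zero at infinity. In homogeneous
  coordinates \<open>(s, u)\<close> with \<open>u\<close> on the unit sphere, the set of large zeros
  lies in a compact set on which \<open>s = 1 / norm z\<close> attains a positive minimum.\<close>

lemma segment_zeros_bounded:
  fixes d :: "'n::finite \<Rightarrow> nat"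
  assumes "\<And>t u. t \<in> {0..1} \<Longrightarrow> eval_system d (segment_system f0 f t) (emb u) = 0 \<Longrightarrow> u = 0"
  obtains R where "\<And>t z. t \<in> {0..1} \<Longrightarrow> chart_map d (segment_system f0 f t) z = 0 \<Longrightarrow> norm z \<le> R"
proof -
  define hom where "hom s u = (\<chi> v. case v of None \<Rightarrow> of_real s | Some k \<Rightarrow> u $ k)" for s :: real and u :: "complex ^ 'n"
  have hom: "hom s u $ None = of_real s" "hom s u $ Some k = u $ k" for s u k by (simp_all add: hom_def)
  let ?g = "\<lambda>p. eval_system d (segment_system f0 f (fst p)) (hom (fst (snd p)) (snd (snd p)))"
  define X where "X = ({0..1} \<times> ({0..1} \<times> sphere 0 1)) \<inter> {p. ?g p = 0}"
  have ch: "continuous_on UNIV (\<lambda>p :: real \<times> real \<times> (complex ^ 'n). hom (fst (snd p)) (snd (snd p)) $ v)" for v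
    by (cases v) (auto simp: hom intro!: continuous_on_component continuous_on_of_real continuous_on_fst continuous_on_snd continuous_on_id)
  have cs: "continuous_on UNIV (\<lambda>p :: real \<times> real \<times> (complex ^ 'n). segment_system f0 f (fst p) i \<alpha>)" for i \<alpha>
    by (rule continuous_on_seg)
  have "continuous_on UNIV ?g"
    unfolding eval_system_def by (intro continuous_on_vec_lambda continuous_on_eval_hpoly cs ch)
  then have "closed {p. ?g p = 0}" by (rule closed_Collect_eq[OF _ continuous_on_const])
  then have X: "compact X"
    unfolding X_def by (intro compact_Int_closed compact_Times) auto
  have inX: "(t, 1 / norm z, (1 / norm z) *\<^sub>R z) \<in> X" if t: "t \<in> {0..1}" "chart_map d (segment_system f0 f t) z = 0" "norm z > 1" for t z
  proof -
    have "hom (1 / norm z) ((1 / norm z) *\<^sub>R z) = of_real (1 / norm z) *s pt z"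
      by (simp add: vec_option_eq_iff hom scaleR_conv_of_real[where 'a = complex])
    then have "eval_system d (segment_system f0 f t) (hom (1 / norm z) ((1 / norm z) *\<^sub>R z)) = 0"
      using eval_system_scale_zero[of d "segment_system f0 f t" "pt z"] t(2) by (simp add: chart_map_def)
    then show ?thesis using t by (auto simp: X_def)
  qed
  show thesis
  proof (cases "X = {}")
    case True
    then show ?thesis using inX by (intro that[of 1]) (metis empty_iff linorder_not_less)
  next
    case False
    have "continuous_on X (\<lambda>p. fst (snd p))"
      by (intro continuous_on_fst continuous_on_snd continuous_on_id)
    from continuous_attains_inf[OF X False this]
    obtain q where q: "q \<in> X" "\<And>p. p \<in> X \<Longrightarrow> fst (snd q) \<le> fst (snd p)"
      by blast
    obtain t s u where qe: "q = (t, s, u)" by (cases q) auto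
    \<comment> \<open>A minimiser with \<open>s = 0\<close> would be a zero at infinity with
      \<open>norm u = 1\<close>.\<close>
    have "s \<noteq> 0"
    proof
      assume "s = 0"
      then have "hom s u = emb u" by (simp add: vec_option_eq_iff hom)
      then have "u = 0" using q(1) assms[of t u] by (auto simp: X_def qe)
      then show False using q(1) by (auto simp: X_def qe)
    qed
    then have s: "s > 0" using q(1) by (auto simp: X_def qe)
    have "norm z \<le> max 1 (1 / s)" if "t \<in> {0..1}" "chart_map d (segment_system f0 f t) z = 0" for t z
    proof (cases "norm z > 1")
      case True
      have "s \<le> 1 / norm z" using q(2)[OF inX[OF that True]] by (simp add: qe)
      moreover have "norm z > 0" using True by linarith
      ultimately have "norm z \<le> 1 / s" using s by (simp add: pos_le_divide_eq mult.commute)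
      then show ?thesis by simp
    qed simp
    then show ?thesis by (rule that)
  qed
qed

section \<open>The starting system and its zeros\<close>

definition fermat :: "('n::finite \<Rightarrow> nat) \<Rightarrow> 'n \<Rightarrow> 'n hpoly" where
  "fermat d = (\<lambda>i \<alpha>. (if \<alpha> = power_index i (d i) then 1 else 0) + (if \<alpha> = const_index (d i) then - 1 else 0))"

lemma eval_system_fermat: "eval_system d (fermat d) x $ i = x $ Some i ^ d i - x $ None ^ d i"
  by (simp add: eval_system_def fermat_def eval_hpoly_add eval_hpoly_power_index eval_hpoly_const_index)

lemma chart_map_fermat: "chart_map d (fermat d) z $ i = z $ i ^ d i - 1"
  by (simp add: chart_map_def eval_system_fermat)

lemma chart_jac_fermat: "chart_jac d (fermat d) z = (\<chi> i j. if i = j then of_nat (d i) * z $ i ^ (d i - 1) else 0)"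
proof -
  have "(chart_map d (fermat d) has_derivative (\<lambda>w. (\<chi> i j. if i = j then of_nat (d i) * z $ i ^ (d i - 1) else 0) *v w)) (at z)"
  proof (rule has_derivative_vecI)
    fix i
    have "((\<lambda>z. z $ i ^ d i - 1) has_derivative (\<lambda>w. of_nat (d i) * w $ i * z $ i ^ (d i - 1) - 0)) (at z)"
      by (rule has_derivative_diff[OF has_derivative_power[OF has_derivative_vec_nth'] has_derivative_const])
    moreover have "((\<chi> i j. if i = j then of_nat (d i) * z $ i ^ (d i - 1) else 0) *v w) $ i = of_nat (d i) * w $ i * z $ i ^ (d i - 1) - 0" for w
      by (simp add: matrix_vector_mult_def if_distrib[of "\<lambda>x. x * _"] cong: if_cong)
    ultimately show "((\<lambda>x. chart_map d (fermat d) x $ i) has_derivative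
        (\<lambda>w. ((\<chi> i j. if i = j then of_nat (d i) * z $ i ^ (d i - 1) else 0) *v w) $ i)) (at z)"
      by (simp only: chart_map_fermat)
  qed
  from fun_cong[OF has_derivative_unique[OF has_derivative_chart_map this]] show ?thesis
    unfolding matrix_eq by (rule allI)
qed

lemma generic_system_fermat:
  assumes d: "\<And>i. d i > 0" shows "generic_system d (fermat d)"
  unfolding generic_system_def
proof (intro conjI allI impI)
  fix z assume "chart_map d (fermat d) z = 0"
  then have "z $ i ^ d i = 1" for i using chart_map_fermat[of d z i] by simp
  then have "z $ i \<noteq> 0" for i using d[of i] by (metis power_0_left zero_neq_one not_gr_zero)
  then show "det (chart_jac d (fermat d) z) \<noteq> 0"
    unfolding chart_jac_fermat using d by (subst det_diagonal) (auto simp: prod_zero_iff)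
next
  fix u assume "eval_system d (fermat d) (emb u) = 0"
  then have "u $ i ^ d i = 0" for i using eval_system_fermat[of d "emb u" i] d[of i] by (simp add: power_0_left)
  then show "u = 0" by (simp add: vec_eq_iff)
qed

lemma card_zeros_fermat:
  fixes d :: "'n::finite \<Rightarrow> nat"
  assumes d: "\<And>i. d i > 0" shows "card {z. chart_map d (fermat d) z = 0} = (\<Prod>i\<in>UNIV. d i)"
proof -
  let ?P = "Pi\<^sub>E (UNIV :: 'n set) (\<lambda>i. {c :: complex. c ^ d i = 1})"
  have "{z. chart_map d (fermat d) z = 0} = vec_lambda ` ?P"
  proof (intro equalityI subsetI)
    fix z assume "z \<in> {z. chart_map d (fermat d) z = 0}"
    then have "z $ i ^ d i = 1" for i using chart_map_fermat[of d z i] by simp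
    then have "vec_nth z \<in> ?P" by (intro PiE_I) simp_all
    then have "vec_lambda (vec_nth z) \<in> vec_lambda ` ?P" by (rule imageI)
    then show "z \<in> vec_lambda ` ?P" by (simp only: vec_lambda_eta)
  next
    fix z assume "z \<in> vec_lambda ` ?P"
    then obtain g where g: "g \<in> ?P" "z = vec_lambda g" by blast
    have "g i ^ d i = 1" for i using PiE_mem[OF g(1), of i] by simp
    then have "chart_map d (fermat d) z = 0"
      unfolding vec_eq_iff chart_map_fermat g(2) by simp
    then show "z \<in> {z. chart_map d (fermat d) z = 0}" by simp
  qed
  moreover have "inj_on vec_lambda ?P" by (auto simp: inj_on_def vec_lambda_inject)
  ultimately have "card {z. chart_map d (fermat d) z = 0} = card ?P" by (simp add: card_image)
  also have "\<dots> = (\<Prod>i\<in>UNIV. d i)" using d by (simp add: card_PiE card_roots_unity_eq)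
  finally show ?thesis .
qed

text \<open>The end \<open>t = 1\<close> of the two segment lemmas gives genericity of
  \<open>f\<close>; the whole segment, with its bound on the zeros, transports the count from the
  starting system, whose zeros are tuples of roots of unity.\<close>

theorem AE_zero_count:
  fixes d :: "'n::finite \<Rightarrow> nat"
  assumes d: "\<And>i. d i > 0"
  shows "AE f in system_lebesgue d. generic_system d f \<and> finite {z. chart_map d f z = 0} \<and>
    card {z. chart_map d f z = 0} = (\<Prod>i\<in>UNIV. d i)"
  using AE_segment_nondegenerate[OF d generic_system_fermat[OF d]] AE_segment_infinity[OF generic_system_fermat[OF d]]
proof eventually_elim
  case (elim f)
  have seg1: "chart_map d (segment_system (fermat d) f 1) z = chart_map d f z" "chart_jac d (segment_system (fermat d) f 1) z = chart_jac d f z"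
    "eval_system d (segment_system (fermat d) f 1) x = eval_system d f x" for z x
    by (simp_all add: chart_map_seg chart_jac_seg eval_system_seg)
  have one: "(1 :: real) \<in> {0..1}" by simp
  have nondeg: "det (chart_jac d (segment_system (fermat d) f t) z) \<noteq> 0"
    if "t \<in> {0..1}" "chart_map d (segment_system (fermat d) f t) z = 0" for t z
    using elim(1) that by blast
  have infty: "u = 0" if "t \<in> {0..1}" "eval_system d (segment_system (fermat d) f t) (emb u) = 0" for t u
    using elim(2) that by blast
  have "generic_system d f"
    unfolding generic_system_def
    using nondeg[OF one, unfolded seg1] infty[OF one, unfolded seg1] by blast
  obtain R where R: "\<And>t z. t \<in> {0..1} \<Longrightarrow> chart_map d (segment_system (fermat d) f t) z = 0 \<Longrightarrow> norm z \<le> R"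
    using segment_zeros_bounded[of d "fermat d" f] infty by blast
  have J: "continuous_on UNIV (chart_jac d g)" for g
    by (intro continuous_on_chart_jac continuous_on_const continuous_on_id)
  have nd: "det ((1 - t) *\<^sub>R chart_jac d (fermat d) z + t *\<^sub>R chart_jac d f z) \<noteq> 0"
    if "t \<in> {0..1}" "(1 - t) *\<^sub>R chart_map d (fermat d) z + t *\<^sub>R chart_map d f z = 0" for t z
    by (rule nondeg[unfolded chart_map_seg chart_jac_seg, OF that])
  have bd: "norm z \<le> R" if "t \<in> {0..1}" "(1 - t) *\<^sub>R chart_map d (fermat d) z + t *\<^sub>R chart_map d f z = 0" for t z
    by (rule R[unfolded chart_map_seg, OF that])
  note zc = zero_count_invariant[OF has_derivative_chart_map has_derivative_chart_map J J nd bd]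
  have "finite {z. chart_map d f z = 0}" using zc(2) by simp
  moreover have "card {z. chart_map d f z = 0} = (\<Prod>i\<in>UNIV. d i)"
  proof -
    have "card {z. chart_map d (fermat d) z = 0} = card {z. chart_map d f z = 0}"
      using zc(3) by simp
    then show ?thesis by (simp only: card_zeros_fermat[OF d])
  qed
  ultimately show ?case using \<open>generic_system d f\<close> by blast
qed

subsection \<open>Total mass of the Gaussian\<close>

text \<open>Stars and bars, after listing the variables. It ties the number of coordinates in the
  product measure to the exponent \<open>system_dim\<close> in the normalising constant.\<close>

lemma card_multi_indices: "card (multi_indices d :: ('n::finite option \<Rightarrow> nat) set) = (CARD('n) + d) choose CARD('n)"
proof -
  obtain xs :: "'n option list" where xs: "set xs = UNIV" "distinct xs"
    using finite_distinct_list[of "UNIV :: 'n option set"] by auto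
  have len: "length xs = Suc (CARD('n))"
    using distinct_card[OF xs(2)] xs(1) by simp
  let ?S = "{l :: nat list. length l = length xs \<and> sum_list l = d}"
  have sl: "sum_list (map \<alpha> xs) = (\<Sum>v\<in>UNIV. \<alpha> v)" for \<alpha> :: "'n option \<Rightarrow> nat"
    using sum_list_distinct_conv_sum_set[OF xs(2), of \<alpha>] xs(1) by simp
  have "bij_betw (\<lambda>\<alpha>. map \<alpha> xs) (multi_indices d) ?S"
    unfolding bij_betw_def
  proof
    show "inj_on (\<lambda>\<alpha>. map \<alpha> xs) (multi_indices d)"
      using xs(1) by (auto simp: inj_on_def fun_eq_iff)
    show "(\<lambda>\<alpha>. map \<alpha> xs) ` multi_indices d = ?S"
    proof (intro equalityI subsetI)
      fix l assume l: "l \<in> ?S"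
      define \<alpha> where "\<alpha> v = the (map_of (zip xs l) v)" for v
      have "map \<alpha> xs = l"
        using l xs(2) by (intro nth_equalityI) (auto simp: \<alpha>_def map_of_zip_nth)
      moreover from this have "\<alpha> \<in> multi_indices d" using l sl[of \<alpha>] by (simp add: multi_indices_def)
      ultimately show "l \<in> (\<lambda>\<alpha>. map \<alpha> xs) ` multi_indices d" by blast
    qed (auto simp: sl multi_indices_def)
  qed
  then have "card (multi_indices d :: ('n option \<Rightarrow> nat) set) = card ?S" by (rule bij_betw_same_card)
  also have "\<dots> = (d + CARD('n)) choose d" by (simp add: card_length_sum_list len)
  also have "\<dots> = (CARD('n) + d) choose CARD('n)"
    by (subst binomial_symmetric) (simp_all add: add.commute)
  finally show ?thesis .
qed

text \<open>Passing to the orthonormal coordinate cancels the multinomial weight, so every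
  coefficient contributes the same mass.\<close>

lemma coef_gaussian_mass:
  assumes \<sigma>: "\<sigma> > 0"
  shows "(\<integral>\<^sup>+x. ennreal (exp (- ((norm (x - c))\<^sup>2 / multinom d \<alpha> / \<sigma>\<^sup>2))) \<partial>coef_measure d \<alpha>) = ennreal (pi * \<sigma>\<^sup>2)"
proof -
  define s where "s = sqrt (multinom d \<alpha>)"
  have s: "s > 0" "multinom d \<alpha> = s\<^sup>2" using multinom_pos[of d \<alpha>] by (auto simp: s_def less_imp_le)
  have e: "(norm (of_real s * (c / of_real s + u) - c))\<^sup>2 / multinom d \<alpha> = (norm u)\<^sup>2" for u
  proof -
    have "of_real s * (c / of_real s + u) - c = of_real s * u" using s(1) by (simp add: algebra_simps)
    then show ?thesis using s by (simp add: norm_mult power_mult_distrib)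
  qed
  have "(\<integral>\<^sup>+x. ennreal (exp (- ((norm (x - c))\<^sup>2 / multinom d \<alpha> / \<sigma>\<^sup>2))) \<partial>coef_measure d \<alpha>)
      = (\<integral>\<^sup>+u. ennreal (exp (- ((norm (of_real s * u - c))\<^sup>2 / multinom d \<alpha> / \<sigma>\<^sup>2))) \<partial>lborel)"
    unfolding coef_measure_def s_def by (subst nn_integral_distr) auto
  also have "\<dots> = (\<integral>\<^sup>+u. ennreal (exp (- ((norm (of_real s * (c / of_real s + u) - c))\<^sup>2 / multinom d \<alpha> / \<sigma>\<^sup>2))) \<partial>lborel)"
    by (rule nn_integral_lborel_shift[symmetric]) measurable
  also have "\<dots> = ennreal (pi * \<sigma>\<^sup>2)"
    unfolding e by (rule complex_gaussian_moments(1)[OF \<sigma>])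
  finally show ?thesis .
qed

lemma hpoly_gaussian_mass:
  fixes q :: "'n::finite hpoly"
  assumes \<sigma>: "\<sigma> > 0"
  shows "(\<integral>\<^sup>+p. ennreal (exp (- (weyl_sq d (\<lambda>\<alpha>. p \<alpha> - q \<alpha>) / \<sigma>\<^sup>2))) \<partial>hpoly_lebesgue d)
    = ennreal (pi * \<sigma>\<^sup>2) ^ card (multi_indices d :: ('n option \<Rightarrow> nat) set)"
proof -
  let ?e = "\<lambda>\<alpha> x. ennreal (exp (- ((norm (x - q \<alpha>))\<^sup>2 / multinom d \<alpha> / \<sigma>\<^sup>2)))"
  have "ennreal (exp (- (weyl_sq d (\<lambda>\<alpha>. p \<alpha> - q \<alpha>) / \<sigma>\<^sup>2))) = (\<Prod>\<alpha>\<in>multi_indices d. ?e \<alpha> (p \<alpha>))" for p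
    by (simp add: weyl_sq_def sum_divide_distrib sum_negf[symmetric] exp_sum prod_ennreal)
  then have "(\<integral>\<^sup>+p. ennreal (exp (- (weyl_sq d (\<lambda>\<alpha>. p \<alpha> - q \<alpha>) / \<sigma>\<^sup>2))) \<partial>hpoly_lebesgue d)
     = (\<integral>\<^sup>+p. (\<Prod>\<alpha>\<in>multi_indices d. ?e \<alpha> (p \<alpha>)) \<partial>Pi\<^sub>M (multi_indices d) (coef_measure d))"
    by (simp only: hpoly_lebesgue_eq)
  also have "\<dots> = (\<Prod>\<alpha>\<in>multi_indices d. \<integral>\<^sup>+x. ?e \<alpha> x \<partial>coef_measure d \<alpha>)"
    by (rule coef.product_nn_integral_prod) (simp, measurable)
  also have "\<dots> = ennreal (pi * \<sigma>\<^sup>2) ^ card (multi_indices d :: ('n option \<Rightarrow> nat) set)"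
    unfolding coef_gaussian_mass[OF \<sigma>] by simp
  finally show ?thesis .
qed

text \<open>The Gaussian is a probability measure, so a zero count that is almost surely constant
  equals its expectation.\<close>

lemma system_gaussian_mass:
  fixes d :: "'n::finite \<Rightarrow> nat"
  assumes \<sigma>: "\<sigma> > 0"
  shows "(\<integral>\<^sup>+f. ennreal (1 / (\<sigma> ^ (2 * system_dim d) * pi ^ system_dim d)
      * exp (- (sys_sq d (\<lambda>i \<alpha>. f i \<alpha> - g i \<alpha>) / \<sigma>\<^sup>2))) \<partial>system_lebesgue d) = 1"
proof -
  let ?e = "\<lambda>i p. ennreal (exp (- (weyl_sq (d i) (\<lambda>\<alpha>. p \<alpha> - g i \<alpha>) / \<sigma>\<^sup>2)))"
  let ?c = "1 / (\<sigma> ^ (2 * system_dim d) * pi ^ system_dim d)"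
  have c: "?c \<ge> 0" using \<sigma> by simp
  have em: "?e i \<in> borel_measurable (hpoly_lebesgue (d i))" for i
  proof -
    have [measurable]: "(\<lambda>p. weyl_sq (d i) (\<lambda>\<alpha>. p \<alpha> - g i \<alpha>)) \<in> borel_measurable (hpoly_lebesgue (d i))"
      by (rule measurable_weyl_sq, rule borel_measurable_diff[OF measurable_hpoly_coef borel_measurable_const])
    show ?thesis by measurable
  qed
  have prod: "ennreal (exp (- (sys_sq d (\<lambda>i \<alpha>. f i \<alpha> - g i \<alpha>) / \<sigma>\<^sup>2))) = (\<Prod>i\<in>UNIV. ?e i (f i))" for f
    by (simp add: sys_sq_def sum_divide_distrib sum_negf[symmetric] exp_sum prod_ennreal)
  have "(\<integral>\<^sup>+f. ennreal (exp (- (sys_sq d (\<lambda>i \<alpha>. f i \<alpha> - g i \<alpha>) / \<sigma>\<^sup>2))) \<partial>system_lebesgue d)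
      = (\<Prod>i\<in>UNIV. \<integral>\<^sup>+p. ?e i p \<partial>hpoly_lebesgue (d i))"
    unfolding prod system_lebesgue_def by (rule hpoly.product_nn_integral_prod) (simp_all add: em)
  also have "\<dots> = (\<Prod>i\<in>UNIV. ennreal (pi * \<sigma>\<^sup>2) ^ ((CARD('n) + d i) choose CARD('n)))"
    unfolding hpoly_gaussian_mass[OF \<sigma>] card_multi_indices ..
  also have "\<dots> = ennreal (pi * \<sigma>\<^sup>2) ^ system_dim d"
    unfolding system_dim_def by (rule power_sum[symmetric])
  also have "\<dots> = ennreal ((pi * \<sigma>\<^sup>2) ^ system_dim d)"
    by (rule ennreal_power) simp
  finally have m: "(\<integral>\<^sup>+f. ennreal (exp (- (sys_sq d (\<lambda>i \<alpha>. f i \<alpha> - g i \<alpha>) / \<sigma>\<^sup>2))) \<partial>system_lebesgue d)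
      = ennreal ((pi * \<sigma>\<^sup>2) ^ system_dim d)" .
  have "(\<integral>\<^sup>+f. ennreal (?c * exp (- (sys_sq d (\<lambda>i \<alpha>. f i \<alpha> - g i \<alpha>) / \<sigma>\<^sup>2))) \<partial>system_lebesgue d)
      = ennreal ?c * (\<integral>\<^sup>+f. ennreal (exp (- (sys_sq d (\<lambda>i \<alpha>. f i \<alpha> - g i \<alpha>) / \<sigma>\<^sup>2))) \<partial>system_lebesgue d)"
  proof -
    have [measurable]: "(\<lambda>f. sys_sq d (\<lambda>i \<alpha>. f i \<alpha> - g i \<alpha>)) \<in> borel_measurable (system_lebesgue d)"
      by (rule measurable_sys_sq) simp
    show ?thesis
      by (subst nn_integral_cmult[symmetric]) (measurable, simp only: ennreal_mult[OF c exp_ge_zero])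
  qed
  also have "\<dots> = ennreal (?c * (pi * \<sigma>\<^sup>2) ^ system_dim d)"
    unfolding m by (rule ennreal_mult[symmetric]) (use \<sigma> in auto)
  also have "?c * (pi * \<sigma>\<^sup>2) ^ system_dim d = 1"
    using \<sigma> by (simp add: power_mult_distrib power_mult[symmetric])
  finally show ?thesis by simp
qed

subsection \<open>The condition number in the chart\<close>

lemma system_norm_sq: "(system_norm d f)\<^sup>2 = sys_sq d f"
proof -
  have "Re (system_inner d f f) = sys_sq d f"
    by (simp add: system_inner_def sys_sq_def weyl_inner_self)
  moreover have "sys_sq d f \<ge> 0"
    unfolding sys_sq_def weyl_sq_def by (intro sum_nonneg divide_nonneg_nonneg) (simp_all add: less_imp_le)
  ultimately show ?thesis by (simp add: system_norm_def)
qed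

lemma hermitian_complement_scale:
  assumes "c \<noteq> 0" shows "w \<in> hermitian_complement (c *s \<zeta>) \<longleftrightarrow> dot w (cnjv \<zeta>) = 0"
proof -
  have "(\<Sum>v\<in>UNIV. w $ v * cnj ((c *s \<zeta>) $ v)) = cnj c * dot w (cnjv \<zeta>)"
    by (simp add: dot_def cnjv_def sum_distrib_left mult_ac)
  then show ?thesis using assms by (simp add: hermitian_complement_def)
qed

lemma tangent_scale: "tangent z (a *s w) = a *s tangent z w"
proof -
  have e: "emb (a *s w) = a *s emb w" by (simp add: vec_option_eq_iff)
  show ?thesis
    unfolding tangent_def e dot_scale_left by (simp add: vec_eq_iff algebra_simps)
qed

lemma norm_scale_vec: "norm (a *s (w :: complex ^ 'n::finite)) = norm a * norm w"
proof -
  have "norm (a *s w) = sqrt ((norm a)\<^sup>2 * (\<Sum>v\<in>UNIV. (norm (w $ v))\<^sup>2))"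
    by (simp add: norm_vec_def L2_set_def norm_mult power_mult_distrib sum_distrib_left)
  then show ?thesis by (simp add: real_sqrt_mult norm_vec_def L2_set_def)
qed

text \<open>On the complement of the line, the inverse derivative sends a basis vector to a multiple
  of the projected cofactor vector. The factor \<open>c\<close> is arbitrary because the
  representative of a projective point is an unspecified choice; its powers cancel against those in
  the norm of the representative.\<close>

lemma mu_F_chart:
  fixes d :: "'n::finite \<Rightarrow> nat"
  assumes d: "\<And>i. d i > 0" and c: "c \<noteq> 0" and z: "chart_map d f z = 0" and det: "det (chart_jac d f z) \<noteq> 0"
  shows "nondegenerate d f (c *s pt z)"
    and "(mu_F d f (c *s pt z))\<^sup>2 = ennreal (sys_sq d f * (\<Sum>j\<in>UNIV. cof_weight d j f z / (norm (det (chart_jac d f z)))\<^sup>2))"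
proof -
  let ?\<zeta> = "c *s pt z" and ?J = "chart_jac d f z"
  let ?T = "D_system d f ?\<zeta>" and ?S = "hermitian_complement ?\<zeta>"
  have ev: "eval_hpoly (d i) (f i) (pt z) = 0" for i
    using z by (simp add: vec_eq_iff chart_map_def eval_system_def)
  have T: "?T w = (\<chi> i. c ^ (d i - 1) * deriv_hpoly (d i) (f i) (pt z) w)" for w
    unfolding D_system_eq by (simp add: deriv_hpoly_homogeneous)
  \<comment> \<open>At a zero, Euler's identity lets the chart direction be replaced by its
    projection, so on the complement the derivative is the chart Jacobian up to the row factors
    \<open>c ^ (d i - 1)\<close>.\<close>
  have Tt: "?T (tangent z C) = (\<chi> i. c ^ (d i - 1) * (?J *v C) $ i)" for C
    using deriv_hpoly_tangent[of _ _ z C] by (simp add: T ev chart_jac_mult)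
  have tS: "tangent z C \<in> ?S" for C
    by (simp add: hermitian_complement_scale[OF c] dot_tangent)
  have inj: "inj_on ?T ?S"
  proof (rule inj_onI)
    fix w w' assume w: "w \<in> ?S" "w' \<in> ?S" "?T w = ?T w'"
    define u where "u = w - w'"
    have ud: "dot u (cnjv (pt z)) = 0"
      using w(1,2) by (simp add: u_def hermitian_complement_scale[OF c] dot_diff_left)
    \<comment> \<open>Splitting off the multiple of \<open>pt z\<close> with the same entry at
      \<open>None\<close> leaves a chart direction. The derivative kills the multiple, so the
      Jacobian kills \<open>C\<close>.\<close>
    define C where "C = (\<chi> k. u $ Some k - u $ None * z $ k)"
    have uC: "u = u $ None *s pt z + emb C"
      by (simp add: vec_option_eq_iff C_def)
    have "w = w' + u" by (simp add: u_def)
    then have du: "deriv_hpoly (d i) (f i) (pt z) u = 0" for i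
    proof -
      have "c ^ (d i - 1) * deriv_hpoly (d i) (f i) (pt z) (w' + u) = c ^ (d i - 1) * deriv_hpoly (d i) (f i) (pt z) w'"
        using w(3) \<open>w = w' + u\<close> by (simp add: T vec_eq_iff)
      then show ?thesis using c by (simp add: deriv_hpoly_add)
    qed
    have "(?J *v C) $ i = 0" for i
    proof -
      have "deriv_hpoly (d i) (f i) (pt z) (u $ None *s pt z + emb C) = 0"
        by (simp only: uC[symmetric] du)
      then show ?thesis
        by (simp add: chart_jac_mult deriv_hpoly_add deriv_hpoly_scale deriv_hpoly_self ev)
    qed
    then have "?J *v C = ?J *v 0" by (simp add: vec_eq_iff)
    then have "C = 0" using inj_matrix_vector_mult[OF det] by (simp add: inj_def)
    then have "u = u $ None *s pt z" using uC by (simp add: vec_option_eq_iff)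
    moreover have "u $ None = 0"
    proof -
      have "dot (u $ None *s pt z) (cnjv (pt z)) = 0" using ud \<open>u = u $ None *s pt z\<close> by simp
      then show ?thesis by (simp add: dot_scale_left dot_cnj_self)
    qed
    ultimately have "u = 0" by (metis vector_smult_lzero)
    then show "w = w'" by (simp add: u_def)
  qed
  have surj: "?T ` ?S = UNIV"
  proof -
    have "y \<in> ?T ` ?S" for y
    proof -
      obtain A' where A': "?J ** A' = mat 1"
        using det invertible_det_nz[of ?J] by (auto simp: invertible_def)
      define C where "C = A' *v (\<chi> i. y $ i / c ^ (d i - 1))"
      have "?J *v C = (\<chi> i. y $ i / c ^ (d i - 1))"
        by (simp add: C_def matrix_vector_mul_assoc A')
      then have "?T (tangent z C) = y" using c by (simp add: Tt vec_eq_iff)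
      then show ?thesis using tS by (metis imageI)
    qed
    then show ?thesis by blast
  qed
  show nd: "nondegenerate d f ?\<zeta>"
    unfolding nondegenerate_def bij_betw_def using inj surj by blast
  define A where "A y = inv_into ?S ?T (\<chi> i. of_real (norm ?\<zeta> ^ (d i - 1) * sqrt (real (d i))) * y $ i)" for y
  have col: "(norm (A (axis j 1)))\<^sup>2 = cof_weight d j f z / (norm (det ?J))\<^sup>2" for j
  proof -
    \<comment> \<open>The diagonal scaling combined with the row factor from homogeneity; its
      modulus is free of \<open>c\<close>, and its square together with the squared norm of the
      projected cofactor vector forms \<open>riesz_sq\<close>.\<close>
    define \<kappa> where "\<kappa> = of_real (norm ?\<zeta> ^ (d j - 1) * sqrt (real (d j))) / c ^ (d j - 1)"
    have Tcol: "?T (tangent z ((\<kappa> / det ?J) *s cofvec j ?J))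
        = (\<chi> i. of_real (norm ?\<zeta> ^ (d i - 1) * sqrt (real (d i))) * axis j 1 $ i)"
    proof -
      have "?J *v ((\<kappa> / det ?J) *s cofvec j ?J) = (\<kappa> / det ?J) *s axis j (det ?J)"
        by (simp add: vector_scalar_commute mult_cofvec)
      then show ?thesis
        unfolding Tt using c det by (auto simp: vec_eq_iff axis_def \<kappa>_def)
    qed
    have A: "A (axis j 1) = (\<kappa> / det ?J) *s tangent z (cofvec j ?J)"
      unfolding A_def tangent_scale[symmetric] by (rule inv_into_f_eq[OF inj tS Tcol])
    have "norm \<kappa> = norm (pt z) ^ (d j - 1) * sqrt (real (d j))"
      using c by (simp add: \<kappa>_def norm_divide norm_mult norm_power norm_scale_vec power_mult_distrib)
    then have "(norm \<kappa>)\<^sup>2 = real (d j) * norm (pt z) ^ (2 * (d j - 1))"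
      by (simp add: power_mult_distrib power_mult[symmetric] mult.commute)
    then show ?thesis
      by (simp add: A norm_scale_vec norm_divide power_mult_distrib power_divide cof_weight_def riesz_sq_def)
  qed
  have S0: "(\<Sum>j\<in>UNIV. cof_weight d j f z / (norm (det ?J))\<^sup>2) \<ge> 0"
    by (intro sum_nonneg divide_nonneg_nonneg cof_weight_nonneg) simp
  have fr: "(frobenius_norm A)\<^sup>2 = (\<Sum>j\<in>UNIV. cof_weight d j f z / (norm (det ?J))\<^sup>2)"
    unfolding frobenius_norm_def col using S0 by simp
  have f0: "frobenius_norm A \<ge> 0" unfolding frobenius_norm_def by (simp add: sum_nonneg)
  have n0: "system_norm d f \<ge> 0"
    unfolding system_norm_def system_inner_def by (simp add: weyl_inner_self weyl_sq_def sum_nonneg less_imp_le)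
  have "mu_F d f ?\<zeta> = ennreal (system_norm d f * frobenius_norm A)"
    unfolding mu_F_def using nd by (simp add: A_def[abs_def])
  then show "(mu_F d f ?\<zeta>)\<^sup>2 = ennreal (sys_sq d f * (\<Sum>j\<in>UNIV. cof_weight d j f z / (norm (det ?J))\<^sup>2))"
    using f0 n0 by (simp add: ennreal_power power_mult_distrib system_norm_sq fr)
qed

section \<open>Projective zeros and chart zeros\<close>

lemma proj_point_eq_iff:
  assumes "\<zeta> \<noteq> 0" shows "proj_point \<zeta> = proj_point \<xi> \<longleftrightarrow> (\<exists>c. c \<noteq> 0 \<and> \<zeta> = c *s \<xi>)"
proof
  assume "proj_point \<zeta> = proj_point \<xi>"
  then have "\<zeta> \<in> vec.span {\<xi>}" using vec.span_base[of \<zeta> "{\<zeta>}"] by (simp add: proj_point_def)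
  then obtain c where c: "\<zeta> = c *s \<xi>" by (auto simp: vec.span_singleton)
  then have "c \<noteq> 0" using assms by auto
  then show "\<exists>c. c \<noteq> 0 \<and> \<zeta> = c *s \<xi>" using c by blast
next
  assume "\<exists>c. c \<noteq> 0 \<and> \<zeta> = c *s \<xi>"
  then obtain c where c: "c \<noteq> 0" "\<zeta> = c *s \<xi>" by blast
  have 1: "k *s \<zeta> = (k * c) *s \<xi>" for k by (simp add: c(2) vec_eq_iff)
  have 2: "k *s \<xi> = (k / c) *s \<zeta>" for k using c(1) by (simp add: c(2) vec_eq_iff)
  show "proj_point \<zeta> = proj_point \<xi>"
    unfolding proj_point_def vec.span_singleton
  proof (intro equalityI image_subsetI)
    show "k *s \<zeta> \<in> range (\<lambda>k. k *s \<xi>)" for k unfolding 1 by (rule rangeI)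
    show "k *s \<xi> \<in> range (\<lambda>k. k *s \<zeta>)" for k unfolding 2 by (rule rangeI)
  qed
qed

lemma representative_proj_point:
  assumes "\<xi> \<noteq> 0"
  obtains c where "c \<noteq> 0" "representative (proj_point \<xi>) = c *s \<xi>"
proof -
  have "representative (proj_point \<xi>) \<noteq> 0 \<and> proj_point (representative (proj_point \<xi>)) = proj_point \<xi>"
    unfolding representative_def by (rule someI[of _ \<xi>]) (use assms in simp)
  then show thesis using proj_point_eq_iff that by blast
qed

text \<open>Genericity rules out zeros with vanishing coordinate \<open>None\<close>; every other
  line has exactly one point with that coordinate equal to 1.\<close>

lemma proj_zeros_chart:
  assumes "generic_system d f"
  shows "bij_betw (\<lambda>z. proj_point (pt z)) {z. chart_map d f z = 0} (proj_zeros d f)"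
  unfolding bij_betw_def
proof
  show "inj_on (\<lambda>z. proj_point (pt z)) {z. chart_map d f z = 0}"
  proof (rule inj_onI)
    fix y z assume "proj_point (pt y) = proj_point (pt z)"
    then obtain c where c: "pt y = c *s pt z" using proj_point_eq_iff[OF pt_nz] by blast
    then have "c = 1" by (metis mult.right_neutral pt_nth(1) vector_smult_component)
    then show "y = z" using c by (simp add: vec_option_eq_iff vec_eq_iff)
  qed
  show "(\<lambda>z. proj_point (pt z)) ` {z. chart_map d f z = 0} = proj_zeros d f"
  proof (intro equalityI subsetI)
    fix L assume "L \<in> (\<lambda>z. proj_point (pt z)) ` {z. chart_map d f z = 0}"
    then show "L \<in> proj_zeros d f" unfolding proj_zeros_def chart_map_def using pt_nz by blast
  next
    fix L assume "L \<in> proj_zeros d f"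
    then obtain \<zeta> where \<zeta>: "L = proj_point \<zeta>" "\<zeta> \<noteq> 0" "eval_system d f \<zeta> = 0"
      unfolding proj_zeros_def by blast
    have n: "\<zeta> $ None \<noteq> 0"
    proof
      assume "\<zeta> $ None = 0"
      then have e: "\<zeta> = emb (\<chi> k. \<zeta> $ Some k)" by (simp add: vec_option_eq_iff)
      then have "(\<chi> k. \<zeta> $ Some k) = 0" using assms \<zeta>(3) unfolding generic_system_def by metis
      then have "\<zeta> = emb 0" using e by simp
      also have "emb 0 = 0" by (simp add: vec_option_eq_iff)
      finally show False using \<zeta>(2) by simp
    qed
    define z where "z = (\<chi> k. \<zeta> $ Some k / \<zeta> $ None)"
    have pz: "pt z = (1 / \<zeta> $ None) *s \<zeta>" using n by (simp add: vec_option_eq_iff z_def)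
    have "chart_map d f z = 0"
      unfolding chart_map_def pz by (rule eval_system_scale_zero[OF \<zeta>(3)])
    moreover have "proj_point (pt z) = L"
      unfolding \<zeta>(1) using proj_point_eq_iff[OF pt_nz, of z \<zeta>] pz n by auto
    ultimately show "L \<in> (\<lambda>z. proj_point (pt z)) ` {z. chart_map d f z = 0}" by blast
  qed
qed

text \<open>The zero system has a degenerate zero at the origin of the chart. Positivity permits the
  cancellation of the squared norm against that in the condition number.\<close>

lemma generic_system_imp_sys_sq_pos:
  assumes "generic_system d f" shows "sys_sq d f > 0"
proof (rule ccontr)
  assume "\<not> sys_sq d f > 0"
  moreover have w: "weyl_sq (d i) (f i) \<ge> 0" for i
    unfolding weyl_sq_def by (intro sum_nonneg divide_nonneg_nonneg) (simp_all add: less_imp_le)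
  ultimately have z: "(\<Sum>i\<in>UNIV. weyl_sq (d i) (f i)) = 0"
    unfolding sys_sq_def by (intro antisym sum_nonneg) simp_all
  have "weyl_sq (d i) (f i) = 0" for i
    using z w sum_nonneg_eq_0_iff[of UNIV "\<lambda>i. weyl_sq (d i) (f i)"] by simp
  then have "(norm (f i \<alpha>))\<^sup>2 / multinom (d i) \<alpha> = 0" if "\<alpha> \<in> multi_indices (d i)" for i \<alpha>
    using that sum_nonneg_eq_0_iff[of "multi_indices (d i)" "\<lambda>\<alpha>. (norm (f i \<alpha>))\<^sup>2 / multinom (d i) \<alpha>"]
    by (simp add: weyl_sq_def less_imp_le)
  then have coef: "f i \<alpha> = 0" if "\<alpha> \<in> multi_indices (d i)" for i \<alpha>
    using that by simp
  then have "chart_map d f 0 = 0"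
    by (simp add: vec_eq_iff chart_map_def eval_system_def eval_hpoly_def)
  moreover have "chart_jac d f 0 = 0"
    using coef by (simp add: vec_eq_iff chart_jac_def deriv_hpoly_def)
  then have "det (chart_jac d f 0) = 0"
    by (intro det_zero_row(2)[of undefined]) (simp add: row_def vec_eq_iff)
  ultimately show False using assms unfolding generic_system_def by blast
qed

text \<open>Genericity makes every projective zero a nondegenerate chart zero, so the unordered sum
  is a finite sum of the chart expressions. The squared norm of the system factors out of it and
  cancels because it is positive and finite.\<close>

lemma mu_F_av_sq_eq:
  fixes d :: "'n::finite \<Rightarrow> nat"
  assumes d: "\<And>i. d i > 0" and f: "f \<in> hsystems d" and generic_system: "generic_system d f"
    and fin: "finite {z. chart_map d f z = 0}"
  shows "mu_F_av_sq d f / ennreal ((system_norm d f)\<^sup>2)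
    = (\<Sum>j\<in>UNIV. zero_sum d (cof_weight d j) f) / of_nat (\<Prod>i\<in>UNIV. d i)"
proof -
  let ?Z = "{z. chart_map d f z = 0}" and ?D = "of_nat (\<Prod>i\<in>UNIV. d i) :: ennreal"
  define q where "q z = (\<Sum>j\<in>UNIV. cof_weight d j f z / (norm (det (chart_jac d f z)))\<^sup>2)" for z
  have q0: "q z \<ge> 0" for z unfolding q_def by (intro sum_nonneg divide_nonneg_nonneg cof_weight_nonneg) simp
  have det: "det (chart_jac d f z) \<noteq> 0" if "z \<in> ?Z" for z using generic_system that unfolding generic_system_def by blast
  have mu: "nondegenerate d f (representative (proj_point (pt z)))"
    "(mu_F d f (representative (proj_point (pt z))))\<^sup>2 = ennreal (sys_sq d f * q z)" if z: "z \<in> ?Z" for z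
  proof -
    obtain c where c: "c \<noteq> 0" "representative (proj_point (pt z)) = c *s pt z"
      by (rule representative_proj_point[OF pt_nz])
    show "nondegenerate d f (representative (proj_point (pt z)))"
      "(mu_F d f (representative (proj_point (pt z))))\<^sup>2 = ennreal (sys_sq d f * q z)"
      unfolding c(2) q_def using mu_F_chart[OF d c(1) _ det[OF z]] z by simp_all
  qed
  note bij = proj_zeros_chart[OF generic_system]
  have pz: "proj_zeros d f = (\<lambda>z. proj_point (pt z)) ` ?Z" using bij by (simp add: bij_betw_def)
  have "f \<notin> discriminant d"
  proof
    assume "f \<in> discriminant d"
    then obtain L where "L \<in> proj_zeros d f" "\<not> nondegenerate d f (representative L)"
      unfolding discriminant_def by blast
    then show False using mu(1) unfolding pz by blast
  qed
  then have "mu_F_av_sq d f = (\<Sum>\<^sub>\<infinity>L\<in>proj_zeros d f. (mu_F d f (representative L))\<^sup>2) / ?D"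
    by (simp add: mu_F_av_sq_def)
  also have "(\<Sum>\<^sub>\<infinity>L\<in>proj_zeros d f. (mu_F d f (representative L))\<^sup>2) = (\<Sum>L\<in>proj_zeros d f. (mu_F d f (representative L))\<^sup>2)"
    using fin by (intro infsum_finite) (simp add: pz)
  also have "\<dots> = (\<Sum>z\<in>?Z. (mu_F d f (representative (proj_point (pt z))))\<^sup>2)"
    by (rule sum.reindex_bij_betw[OF bij, symmetric])
  also have "\<dots> = (\<Sum>z\<in>?Z. ennreal (sys_sq d f * q z))"
    by (rule sum.cong) (auto simp: mu(2))
  also have "\<dots> = ennreal (sys_sq d f) * (\<Sum>z\<in>?Z. ennreal (q z))"
    unfolding sum_distrib_left
    by (intro sum.cong refl ennreal_mult q0) (use generic_system_imp_sys_sq_pos[OF generic_system] in simp)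
  finally have 1: "mu_F_av_sq d f = ennreal (sys_sq d f) * (\<Sum>z\<in>?Z. ennreal (q z)) / ?D" .
  have Zeq: "{z. det (chart_jac d f z) \<noteq> 0 \<and> chart_map d f z = 0} = ?Z" using det by blast
  have zs: "zero_sum d (cof_weight d j) f = (\<Sum>z\<in>?Z. ennreal (cof_weight d j f z / (norm (det (chart_jac d f z)))\<^sup>2))" for j
    unfolding zero_sum_def Zeq by (rule nn_integral_count_space_finite[OF fin])
  have "(\<Sum>j\<in>UNIV. zero_sum d (cof_weight d j) f) = (\<Sum>z\<in>?Z. \<Sum>j\<in>UNIV. ennreal (cof_weight d j f z / (norm (det (chart_jac d f z)))\<^sup>2))"
    unfolding zs by (rule sum.swap)
  also have "\<dots> = (\<Sum>z\<in>?Z. ennreal (q z))"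
    unfolding q_def by (intro sum.cong refl sum_ennreal) (simp add: cof_weight_nonneg)
  finally have 2: "(\<Sum>j\<in>UNIV. zero_sum d (cof_weight d j) f) = (\<Sum>z\<in>?Z. ennreal (q z))" .
  have s: "ennreal (sys_sq d f) \<noteq> 0" "ennreal (sys_sq d f) \<noteq> \<top>"
    using generic_system_imp_sys_sq_pos[OF generic_system] by simp_all
  have "ennreal (sys_sq d f) * X / ?D = X / ?D * ennreal (sys_sq d f)" for X
    by (metis ennreal_times_divide mult.commute)
  then show ?thesis
    unfolding 1 2 system_norm_sq by (simp only: ennreal_mult_divide_eq[OF s])
qed

text \<open>With the Jacobian itself as weight every nondegenerate zero contributes 1.\<close>

lemma zero_sum_jac_sq:
  assumes "generic_system d f" "finite {z. chart_map d f z = 0}"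
  shows "zero_sum d (jac_sq d) f = of_nat (card {z. chart_map d f z = 0})"
proof -
  have det: "det (chart_jac d f z) \<noteq> 0" if "chart_map d f z = 0" for z using assms(1) that unfolding generic_system_def by blast
  then have "{z. det (chart_jac d f z) \<noteq> 0 \<and> chart_map d f z = 0} = {z. chart_map d f z = 0}" by blast
  then have "zero_sum d (jac_sq d) f = (\<Sum>z\<in>{z. chart_map d f z = 0}. ennreal (jac_sq d f z / (norm (det (chart_jac d f z)))\<^sup>2))"
    unfolding zero_sum_def by (simp only: nn_integral_count_space_finite[OF assms(2)])
  also have "\<dots> = (\<Sum>z\<in>{z. chart_map d f z = 0}. 1)"
    by (rule sum.cong) (auto simp: jac_sq_def det)
  finally show ?thesis by simp
qed

theorem theorem2:
  fixes d :: "'n::finite \<Rightarrow> nat" and fhat :: "'n \<Rightarrow> 'n hpoly" and \<sigma> :: real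
  assumes "\<And>i. d i > 0"
    and "fhat \<in> hsystems d"
    and "\<sigma> > 0"
  shows "(\<integral>\<^sup>+ f. mu_F_av_sq d f / ennreal ((system_norm d f)\<^sup>2) \<partial>gaussian d fhat \<sigma>)
           \<le> ennreal (real CARD('n) / \<sigma>\<^sup>2) \<and>
         (fhat = zero_system d \<longrightarrow>
           (\<integral>\<^sup>+ f. mu_F_av_sq d f / ennreal ((system_norm d f)\<^sup>2) \<partial>gaussian d fhat \<sigma>)
             = ennreal (real CARD('n) / \<sigma>\<^sup>2))"
proof -
  note d = assms(1) and \<sigma> = assms(3)
  let ?L = "system_lebesgue d"
  define c where "c = 1 / (\<sigma> ^ (2 * system_dim d) * pi ^ system_dim d)"
  have c: "c \<ge> 0" using \<sigma> by (simp add: c_def)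
  define \<rho> where "\<rho> f = ennreal (c * exp (- (sys_sq d (\<lambda>i \<alpha>. f i \<alpha> - fhat i \<alpha>) / \<sigma>\<^sup>2)))" for f
  have \<rho>m[measurable]: "\<rho> \<in> borel_measurable ?L"
  proof -
    have [measurable]: "(\<lambda>f. sys_sq d (\<lambda>i \<alpha>. f i \<alpha> - fhat i \<alpha>)) \<in> borel_measurable ?L"
      by (rule measurable_sys_sq) simp
    show ?thesis unfolding \<rho>_def by measurable
  qed
  have gauss: "gaussian d fhat \<sigma> = density ?L \<rho>"
    unfolding gaussian_def \<rho>_def c_def by (simp add: system_norm_sq)
  have mass: "(\<integral>\<^sup>+f. \<rho> f \<partial>?L) = 1"
    unfolding \<rho>_def c_def by (rule system_gaussian_mass[OF \<sigma>])
  define D where "D = (\<Prod>i\<in>UNIV. d i)"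
  have D: "D > 0" unfolding D_def using d by (simp add: prod_pos)
  have zm[measurable]: "zero_sum d (cof_weight d j) \<in> borel_measurable ?L" for j
    by (rule zero_sum_measurable[OF measurable_cof_weight continuous_on_cof_weight cof_weight_nonneg]) auto
  have "AE f in ?L. f \<in> hsystems d"
    unfolding space_system_lebesgue[symmetric] by (rule AE_space)
  with AE_zero_count[OF d]
  \<comment> \<open>The integrand is replaced almost everywhere by sums over chart zeros, whose
    measurability is established; the normalised condition number is thereby integrated without a
    separate measurability argument.\<close>
  have AE: "AE f in ?L. mu_F_av_sq d f / ennreal ((system_norm d f)\<^sup>2) = (\<Sum>j\<in>UNIV. zero_sum d (cof_weight d j) f) / of_nat D
      \<and> zero_sum d (jac_sq d) f = of_nat D"
  proof eventually_elim
    case (elim f)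
    then show ?case
      using mu_F_av_sq_eq[OF d, of f] zero_sum_jac_sq[of d f] by (simp add: D_def)
  qed
  have "(\<integral>\<^sup>+f. mu_F_av_sq d f / ennreal ((system_norm d f)\<^sup>2) \<partial>gaussian d fhat \<sigma>)
      = (\<integral>\<^sup>+f. (\<Sum>j\<in>UNIV. zero_sum d (cof_weight d j) f) / of_nat D \<partial>density ?L \<rho>)"
    unfolding gauss
  proof (rule nn_integral_cong_AE)
    show "AE f in density ?L \<rho>. mu_F_av_sq d f / ennreal ((system_norm d f)\<^sup>2) = (\<Sum>j\<in>UNIV. zero_sum d (cof_weight d j) f) / of_nat D"
      unfolding AE_density[OF \<rho>m] using AE by eventually_elim simp
  qed
  also have "\<dots> = (\<integral>\<^sup>+f. \<rho> f * ((\<Sum>j\<in>UNIV. zero_sum d (cof_weight d j) f) / of_nat D) \<partial>?L)"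
    by (rule nn_integral_density) measurable
  also have "\<dots> = (\<integral>\<^sup>+f. (\<Sum>j\<in>UNIV. \<rho> f * zero_sum d (cof_weight d j) f) / of_nat D \<partial>?L)"
    by (simp only: divide_ennreal_def mult.assoc[symmetric] sum_distrib_left)
  also have "\<dots> = (\<integral>\<^sup>+f. (\<Sum>j\<in>UNIV. \<rho> f * zero_sum d (cof_weight d j) f) \<partial>?L) / of_nat D"
    by (rule nn_integral_divide) measurable
  also have "\<dots> = (\<Sum>j\<in>UNIV. \<integral>\<^sup>+f. \<rho> f * zero_sum d (cof_weight d j) f \<partial>?L) / of_nat D"
    by (subst nn_integral_sum) simp_all
  finally have E: "(\<integral>\<^sup>+f. mu_F_av_sq d f / ennreal ((system_norm d f)\<^sup>2) \<partial>gaussian d fhat \<sigma>)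
      = (\<Sum>j\<in>UNIV. \<integral>\<^sup>+f. \<rho> f * zero_sum d (cof_weight d j) f \<partial>?L) / of_nat D" .
  \<comment> \<open>The zero count is almost surely \<open>D\<close> and the density has mass one,
    so the right-hand side of the Kac--Rice comparison is the same for every mean.\<close>
  have count: "(\<integral>\<^sup>+f. \<rho> f * zero_sum d (jac_sq d) f \<partial>?L) = of_nat D"
  proof -
    have "(\<integral>\<^sup>+f. \<rho> f * zero_sum d (jac_sq d) f \<partial>?L) = (\<integral>\<^sup>+f. \<rho> f * of_nat D \<partial>?L)"
      by (rule nn_integral_cong_AE) (use AE in \<open>eventually_elim, simp\<close>)
    also have "\<dots> = of_nat D" by (subst nn_integral_multc) (measurable, simp add: mass)
    finally show ?thesis .
  qed
  let ?I = "\<lambda>j. \<integral>\<^sup>+f. \<rho> f * zero_sum d (cof_weight d j) f \<partial>?L"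
  have s2: "\<sigma>\<^sup>2 > 0" using \<sigma> by simp
  have le: "ennreal (\<sigma>\<^sup>2) * ?I j \<le> of_nat D" for j
    using zero_sum_inequality(1)[where d = d and j = j and fhat = fhat, OF d \<sigma> c] count by (simp add: \<rho>_def)
  have val: "(\<Sum>j\<in>(UNIV :: 'n set). ennreal (real D / \<sigma>\<^sup>2)) / of_nat D = ennreal (real CARD('n) / \<sigma>\<^sup>2)"
  proof -
    have "(\<Sum>j\<in>(UNIV :: 'n set). ennreal (real D / \<sigma>\<^sup>2)) = ennreal (real CARD('n) * (real D / \<sigma>\<^sup>2))"
      by (subst ennreal_mult) (simp_all add: ennreal_of_nat_eq_real_of_nat)
    then show ?thesis
      using D by (simp add: ennreal_of_nat_eq_real_of_nat divide_ennreal)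
  qed
  have rescale: "ennreal (real D / \<sigma>\<^sup>2) = of_nat D / ennreal (\<sigma>\<^sup>2)"
    using s2 by (simp add: ennreal_of_nat_eq_real_of_nat divide_ennreal)
  \<comment> \<open>Since \<open>\<sigma>\<^sup>2\<close> is neither zero nor infinite, the division
    is legitimate for extended values; finiteness of \<open>?I j\<close> is a consequence of the
    bound and not an assumption.\<close>
  have cancel: "?I j = ennreal (\<sigma>\<^sup>2) * ?I j / ennreal (\<sigma>\<^sup>2)" for j
    by (subst mult.commute, rule ennreal_mult_divide_eq[symmetric]) (use s2 in auto)
  have I_le: "?I j \<le> ennreal (real D / \<sigma>\<^sup>2)" for j
    unfolding rescale by (subst cancel) (rule divide_right_mono_ennreal[OF le])
  have bound: "(\<Sum>j\<in>UNIV. ?I j) / of_nat D \<le> ennreal (real CARD('n) / \<sigma>\<^sup>2)"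
    unfolding val[symmetric] by (intro divide_right_mono_ennreal sum_mono I_le)
  \<comment> \<open>A zero mean turns all \<open>CARD('n)\<close> row inequalities into equalities;
    each row contributes \<open>D / \<sigma>\<^sup>2\<close>, and the division by \<open>D\<close>
    leaves the stated value.\<close>
  have eq: "(\<Sum>j\<in>UNIV. ?I j) / of_nat D = ennreal (real CARD('n) / \<sigma>\<^sup>2)" if "fhat = zero_system d"
  proof -
    have "ennreal (\<sigma>\<^sup>2) * ?I j = of_nat D" for j
      using zero_sum_inequality(2)[where d = d and j = j and fhat = fhat, OF d \<sigma> c] count that
      by (simp add: \<rho>_def zero_system_def)
    then have "?I j = ennreal (real D / \<sigma>\<^sup>2)" for j
      unfolding rescale by (subst cancel) simp
    then show ?thesis unfolding val[symmetric] by simp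
  qed
  show ?thesis unfolding E using bound eq by blast
qed

end
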